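(* Let $1<p,q<\infty$, $\theta_1,\theta_2>0$, and let $a,b$ be weight functions on $\mathbb R^n$ with $a,b\in L^1(\mathbb R^n)$. Then: (a) $C_0^\infty(\mathbb R^n)$ is dense in $A^{p,q}(\mathbb R^n)$; (b) the closure of $A^{p,q}(\mathbb R^n)$ in $A_{q),\theta_2}^{p),\theta_1}(\mathbb R^n,a,b)$ equals the closure of $C_0^\infty(\mathbb R^n)$ in $A_{q),\theta_2}^{p),\theta_1}(\mathbb R^n,a,b)$.
   Context: A weight function on $\mathbb R^n$ is a positive, measurable, locally integrable function (vanishing at most on a set of measure zero). $C_0^\infty(\mathbb R^n)$ denotes the infinitely differentiable compactly supported functions. For $1<p<\infty$, $\theta\ge 0$ and a weight $a$, the generalized grand Lebesgue space $L_a^{p),\theta}(\mathbb R^n)$ is the space of measurable $f$ with $\|f\|_{L_a^{p),\theta}}=\sup_{0<\varepsilon\le p-1}\varepsilon^{\theta}\Big(\int_{\mathbb R^n}|f(x)|^{p-\varepsilon}a(x)^{\varepsilon/p}\,dx\Big)^{1/(p-\varepsilon)}<\infty$. The Fourier transform is $\hat f(\gamma)=\int_{\mathbb R^n}f(x)e^{-i\langle\gamma,x\rangle}dx$, extended to tempered distributions by $\langle\hat\sigma,\varphi\rangle=\langle\sigma,\hat\varphi\rangle$ for Schwartz functions $\varphi$. For $1<p,q<\infty$, $\theta_1,\theta_2> 0$ and weights $a,b$ on $\mathbb R^n$, $A_{q),\theta_2}^{p),\theta_1}(\mathbb R^n,a,b)$ is the space of $f\in L_a^{p),\theta_1}(\mathbb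 R^n)$ whose (generalized) Fourier transform $\hat f$ exists and belongs to $L_b^{q),\theta_2}(\mathbb R^n)$, with norm $\|f\|_{A_{q),\theta_2}^{p),\theta_1}}=\|f\|_{L_a^{p),\theta_1}}+\|\hat f\|_{L_b^{q),\theta_2}}$. $A^{p,q}(\mathbb R^n)$ is the space of $f\in L^p(\mathbb R^n)$ with $\hat f\in L^q(\mathbb R^n)$, normed by $\|f\|_{L^p}+\|\hat f\|_{L^q}$. *)

theory Defs
  imports "HOL-Analysis.Analysis"
begin

definition weight :: "(real^'n \<Rightarrow> real) \<Rightarrow> bool" where
  "weight a \<longleftrightarrow> a \<in> borel_measurable lebesgue \<and> (\<forall>x. 0 \<le> a x)
     \<and> (AE x in lebesgue. 0 < a x)
     \<and> (\<forall>K. compact K \<longrightarrow> set_integrable lebesgue K a)"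

definition partial_deriv :: "'n::finite \<Rightarrow> (real^'n \<Rightarrow> complex) \<Rightarrow> real^'n \<Rightarrow> complex" where
  "partial_deriv i f = (\<lambda>x. frechet_derivative f (at x) (axis i 1))"

fun iter_pderiv :: "'n::finite list \<Rightarrow> (real^'n \<Rightarrow> complex) \<Rightarrow> real^'n \<Rightarrow> complex" where
  "iter_pderiv [] f = f"
| "iter_pderiv (i # is) f = partial_deriv i (iter_pderiv is f)"

definition smooth_fun :: "(real^'n::finite \<Rightarrow> complex) \<Rightarrow> bool" where
  "smooth_fun f \<longleftrightarrow> (\<forall>is x. iter_pderiv is f differentiable (at x))"

definition C0_inf :: "(real^'n::finite \<Rightarrow> complex) \<Rightarrow> bool" where
  "C0_inf f \<longleftrightarrow> smooth_fun f \<and> compact (closure {x. f x \<noteq> 0})"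

definition schwartz :: "(real^'n::finite \<Rightarrow> complex) \<Rightarrow> bool" where
  "schwartz f \<longleftrightarrow> smooth_fun f \<and>
     (\<forall>is (k::nat). bounded (range (\<lambda>x. (1 + norm x) ^ k * norm (iter_pderiv is f x))))"

definition fourier :: "(real^'n::finite \<Rightarrow> complex) \<Rightarrow> real^'n \<Rightarrow> complex" where
  "fourier f = (\<lambda>\<gamma>. \<integral>x. f x * cis (- (\<gamma> \<bullet> x)) \<partial>lebesgue)"

text \<open>g is the (generalized) Fourier transform of f: the tempered distribution
  \<open>\<phi> \<mapsto> \<integral> f \<phi>^\<close> is the regular distribution given by g.\<close>
definition has_fourier :: "(real^'n::finite \<Rightarrow> complex) \<Rightarrow> (real^'n \<Rightarrow> complex) \<Rightarrow> bool" where
  "has_fourier f g \<longleftrightarrow> g \<in> borel_measurable lebesgue \<and>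
     (\<forall>\<phi>. schwartz \<phi> \<longrightarrow>
        integrable lebesgue (\<lambda>x. g x * \<phi> x) \<and>
        integrable lebesgue (\<lambda>x. f x * fourier \<phi> x) \<and>
        (\<integral>x. g x * \<phi> x \<partial>lebesgue) = (\<integral>x. f x * fourier \<phi> x \<partial>lebesgue))"

definition in_Lp :: "real \<Rightarrow> (real^'n::finite \<Rightarrow> complex) \<Rightarrow> bool" where
  "in_Lp p f \<longleftrightarrow> f \<in> borel_measurable lebesgue \<and>
     (\<integral>\<^sup>+x. ennreal (norm (f x) powr p) \<partial>lebesgue) < \<infinity>"

definition Lp_norm :: "real \<Rightarrow> (real^'n::finite \<Rightarrow> complex) \<Rightarrow> real" where
  "Lp_norm p f = enn2real (\<integral>\<^sup>+x. ennreal (norm (f x) powr p) \<partial>lebesgue) powr (1 / p)"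

definition glp_int :: "(real^'n::finite \<Rightarrow> real) \<Rightarrow> real \<Rightarrow> (real^'n \<Rightarrow> complex) \<Rightarrow> real \<Rightarrow> ennreal" where
  "glp_int a p f \<epsilon> = (\<integral>\<^sup>+x. ennreal (norm (f x) powr (p - \<epsilon>) * a x powr (\<epsilon> / p)) \<partial>lebesgue)"

definition glp_term :: "(real^'n::finite \<Rightarrow> real) \<Rightarrow> real \<Rightarrow> real \<Rightarrow> (real^'n \<Rightarrow> complex) \<Rightarrow> real \<Rightarrow> real" where
  "glp_term a p \<theta> f \<epsilon> = \<epsilon> powr \<theta> * enn2real (glp_int a p f \<epsilon>) powr (1 / (p - \<epsilon>))"

definition in_GLp :: "(real^'n::finite \<Rightarrow> real) \<Rightarrow> real \<Rightarrow> real \<Rightarrow> (real^'n \<Rightarrow> complex) \<Rightarrow> bool" where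
  "in_GLp a p \<theta> f \<longleftrightarrow> f \<in> borel_measurable lebesgue \<and>
     (\<forall>\<epsilon>\<in>{0<..p-1}. glp_int a p f \<epsilon> < \<infinity>) \<and>
     bdd_above (glp_term a p \<theta> f ` {0<..p-1})"

definition GLp_norm :: "(real^'n::finite \<Rightarrow> real) \<Rightarrow> real \<Rightarrow> real \<Rightarrow> (real^'n \<Rightarrow> complex) \<Rightarrow> real" where
  "GLp_norm a p \<theta> f = (SUP \<epsilon>\<in>{0<..p-1}. glp_term a p \<theta> f \<epsilon>)"

definition in_Apq :: "real \<Rightarrow> real \<Rightarrow> (real^'n::finite \<Rightarrow> complex) \<Rightarrow> bool" where
  "in_Apq p q f \<longleftrightarrow> in_Lp p f \<and> (\<exists>g. has_fourier f g \<and> in_Lp q g)"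

definition Apq_norm :: "real \<Rightarrow> real \<Rightarrow> (real^'n::finite \<Rightarrow> complex) \<Rightarrow> real" where
  "Apq_norm p q f = Lp_norm p f + Lp_norm q (SOME g. has_fourier f g \<and> in_Lp q g)"

definition in_Agl :: "real \<Rightarrow> real \<Rightarrow> real \<Rightarrow> real \<Rightarrow> (real^'n::finite \<Rightarrow> real) \<Rightarrow> (real^'n \<Rightarrow> real)
    \<Rightarrow> (real^'n \<Rightarrow> complex) \<Rightarrow> bool" where
  "in_Agl p \<theta>1 q \<theta>2 a b f \<longleftrightarrow> in_GLp a p \<theta>1 f \<and> (\<exists>g. has_fourier f g \<and> in_GLp b q \<theta>2 g)"

definition Agl_norm :: "real \<Rightarrow> real \<Rightarrow> real \<Rightarrow> real \<Rightarrow> (real^'n::finite \<Rightarrow> real) \<Rightarrow> (real^'n \<Rightarrow> real)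
    \<Rightarrow> (real^'n \<Rightarrow> complex) \<Rightarrow> real" where
  "Agl_norm p \<theta>1 q \<theta>2 a b f = GLp_norm a p \<theta>1 f
     + GLp_norm b q \<theta>2 (SOME g. has_fourier f g \<and> in_GLp b q \<theta>2 g)"

definition Agl_closure :: "real \<Rightarrow> real \<Rightarrow> real \<Rightarrow> real \<Rightarrow> (real^'n::finite \<Rightarrow> real) \<Rightarrow> (real^'n \<Rightarrow> real)
    \<Rightarrow> (real^'n \<Rightarrow> complex) set \<Rightarrow> (real^'n \<Rightarrow> complex) set" where
  "Agl_closure p \<theta>1 q \<theta>2 a b S = {f. in_Agl p \<theta>1 q \<theta>2 a b f \<and>
     (\<forall>e>0. \<exists>h\<in>S. in_Agl p \<theta>1 q \<theta>2 a b h \<and> Agl_norm p \<theta>1 q \<theta>2 a b (f - h) < e)}"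

end

theory Submission
  imports Defs "HOL-Probability.Sinc_Integral"
begin

text \<open>Given \<open>f \<in> L^p\<close> with transform \<open>g \<in> L^q\<close>, multiply \<open>f\<close> by the Fourier transform of a
  mollifier \<open>k\<close> of small support. This mollifies \<open>g\<close>, and since \<open>fourier k\<close> decays fast it makes \<open>f\<close>
  an \<open>L^1\<close> function \<open>F\<close>. Then mollify \<open>F\<close>, which multiplies its transform by \<open>fourier k\<close>. Finally
  replace \<open>F\<close> by its sharp truncation to a large ball before mollifying: the result is a test
  function, and on the Fourier side the error is at most an \<open>L^1\<close> norm times \<open>fourier k \<in> L^q\<close>.
  No Fourier inversion is needed. Part (b) follows because integrability of the weights gives, by
  Young's inequality, an embedding of \<open>L^p\<close> into the grand Lebesgue space. Generalized transforms are
  unique almost everywhere, so the choice operator in the norms is harmless. The triangle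
  inequalities are only used with a factor 2, which suffices for density.\<close>

section \<open>Smooth functions\<close>

text \<open>The obstacle is that a function and its transform must be approximated at once by a
  single compactly supported smooth function. A sharp cutoff by itself controls the transform only
  uniformly, through an \<open>L^1\<close> norm. The factor \<open>fourier k\<close> of a fixed
  mollifier turns that uniform bound into an \<open>L^q\<close> bound, and this is why
  \<open>F\<close> has to be integrable: \<open>f\<close> lies in \<open>L^p\<close> with
  \<open>p > 1\<close>, and \<open>fourier k\<close> lies in every \<open>L^r\<close> with
  \<open>r \<ge> 1\<close>, in particular for the conjugate exponent. The choices are nested: the
  first mollifier determines \<open>F\<close>, the second depends on \<open>F\<close>, and the
  cutoff radius depends on the second. Errors are measured by \<open>r\<close>-th powers of norms,
  so each triangle inequality costs a factor \<open>2 powr r\<close> there. In the grand space the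
  loss must not depend on \<open>\<epsilon>\<close>; taking the root of order
  \<open>p - \<epsilon>\<close> makes it the constant 2. The analysis is carried out for Borel
  functions on \<open>lborel\<close>, where Fubini applies, while the spaces are defined on the
  completion \<open>lebesgue\<close>; almost everywhere equal Borel representatives connect the
  two.\<close>

lemma has_derivative_partial:
  fixes f :: "real^'n \<Rightarrow> complex"
  assumes "f differentiable (at x)"
  shows "(f has_derivative (\<lambda>v. \<Sum>i\<in>UNIV. v $ i *\<^sub>R partial_deriv i f x)) (at x)"
proof -
  have D: "(f has_derivative frechet_derivative f (at x)) (at x)"
    using assms frechet_derivative_works by blast
  have lin: "linear (frechet_derivative f (at x))"
    using assms linear_frechet_derivative by blast
  have "frechet_derivative f (at x) v = (\<Sum>i\<in>UNIV. v $ i *\<^sub>R partial_deriv i f x)" for v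
  proof -
    have "v = (\<Sum>i\<in>UNIV. v $ i *\<^sub>R axis i 1)"
      by (simp add: vec_eq_iff axis_def if_distrib[of "\<lambda>t. _ * t"] cong: if_cong)
    then have "frechet_derivative f (at x) v = frechet_derivative f (at x) (\<Sum>i\<in>UNIV. v $ i *\<^sub>R axis i 1)"
      by simp
    also have "\<dots> = (\<Sum>i\<in>UNIV. v $ i *\<^sub>R partial_deriv i f x)"
      using lin by (simp add: linear_sum linear_cmul partial_deriv_def)
    finally show ?thesis .
  qed
  with D show ?thesis
    by (metis (no_types, lifting) ext)
qed

lemma partial_derivI:
  assumes "(f has_derivative f') (at x)"
  shows "partial_deriv i f x = f' (axis i 1)"
  using frechet_derivative_at[OF assms] by (simp add: partial_deriv_def)

text \<open>The recursion of \<open>iter_pderiv\<close> adds derivatives on the outside; this form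
  exposes the innermost one, which is what inductions with varying \<open>f\<close> need.\<close>

lemma iter_pderiv_snoc: "iter_pderiv (is @ [i]) f = iter_pderiv is (partial_deriv i f)"
  by (induction "is") auto

text \<open>A recursion from the inside: differentiating once lowers the order and changes the
  function. Closure under sums, products and affine substitutions then follows by induction on the
  order with the function left arbitrary.\<close>

fun smooth_upto :: "nat \<Rightarrow> (real^'n \<Rightarrow> complex) \<Rightarrow> bool" where
  "smooth_upto 0 f \<longleftrightarrow> (\<forall>x. f differentiable (at x))"
| "smooth_upto (Suc n) f \<longleftrightarrow> (\<forall>x. f differentiable (at x)) \<and> (\<forall>i. smooth_upto n (partial_deriv i f))"

lemma smooth_upto_differentiable: "smooth_upto n f \<Longrightarrow> f differentiable (at x)"
  by (cases n) auto

lemma smooth_upto_Suc_imp: "smooth_upto (Suc n) f \<Longrightarrow> smooth_upto n f"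
  by (induction n arbitrary: f) auto

lemma smooth_upto_iff:
  "smooth_upto n f \<longleftrightarrow> (\<forall>is x. length is \<le> n \<longrightarrow> iter_pderiv is f differentiable (at x))"
proof (induction n arbitrary: f)
  case 0
  show ?case by simp
next
  case (Suc n)
  show ?case
  proof
    assume L: "smooth_upto (Suc n) f"
    show "\<forall>is x. length is \<le> Suc n \<longrightarrow> iter_pderiv is f differentiable (at x)"
    proof (intro allI impI)
      fix "is" :: "'a list" and x assume "length is \<le> Suc n"
      then show "iter_pderiv is f differentiable (at x)"
        using L Suc by (cases "is" rule: rev_cases) (auto simp: iter_pderiv_snoc)
    qed
  next
    assume R: "\<forall>is x. length is \<le> Suc n \<longrightarrow> iter_pderiv is f differentiable (at x)"
    have "f differentiable (at x)" for x
      using R[rule_format, of "[]"] by simp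
    moreover have "iter_pderiv is (partial_deriv i f) differentiable (at x)" if "length is \<le> n" for "is" i x
      using R[rule_format, of "is @ [i]"] that by (simp add: iter_pderiv_snoc)
    ultimately show "smooth_upto (Suc n) f"
      using Suc by simp
  qed
qed

lemma smooth_fun_iff_upto: "smooth_fun f \<longleftrightarrow> (\<forall>n. smooth_upto n f)"
  unfolding smooth_fun_def smooth_upto_iff by blast

lemma smooth_fun_differentiable: "smooth_fun f \<Longrightarrow> f differentiable (at x)"
  using smooth_fun_iff_upto smooth_upto_differentiable by blast

lemma smooth_fun_partial_deriv: "smooth_fun f \<Longrightarrow> smooth_fun (partial_deriv i f)"
  by (metis smooth_fun_iff_upto smooth_upto.simps(2))

lemma smooth_fun_continuous: "smooth_fun f \<Longrightarrow> continuous_on S f"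
  by (meson continuous_at_imp_continuous_on differentiable_imp_continuous_within smooth_fun_differentiable)

lemma partial_deriv_add:
  assumes "f differentiable (at x)" "g differentiable (at x)"
  shows "partial_deriv i (\<lambda>y. f y + g y) x = partial_deriv i f x + partial_deriv i g x"
proof -
  have "((\<lambda>y. f y + g y) has_derivative (\<lambda>v. frechet_derivative f (at x) v + frechet_derivative g (at x) v)) (at x)"
    using assms frechet_derivative_works by (intro has_derivative_add) blast+
  then show ?thesis by (subst partial_derivI) (auto simp: partial_deriv_def)
qed

lemma partial_deriv_mult:
  assumes "f differentiable (at x)" "g differentiable (at x)"
  shows "partial_deriv i (\<lambda>y. f y * g y) x = f x * partial_deriv i g x + partial_deriv i f x * g x"
proof -
  have "((\<lambda>y. f y * g y) has_derivative
     (\<lambda>v. f x * frechet_derivative g (at x) v + frechet_derivative f (at x) v * g x)) (at x)"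
    using assms frechet_derivative_works by (intro has_derivative_mult) blast+
  then show ?thesis by (subst partial_derivI) (auto simp: partial_deriv_def)
qed

lemma smooth_upto_add: "smooth_upto n f \<Longrightarrow> smooth_upto n g \<Longrightarrow> smooth_upto n (\<lambda>x. f x + g x)"
proof (induction n arbitrary: f g)
  case (Suc n)
  have "partial_deriv i (\<lambda>x. f x + g x) = (\<lambda>x. partial_deriv i f x + partial_deriv i g x)" for i
    using Suc.prems by (auto simp: partial_deriv_add)
  with Suc show ?case by auto
qed auto

lemma smooth_upto_mult: "smooth_upto n f \<Longrightarrow> smooth_upto n g \<Longrightarrow> smooth_upto n (\<lambda>x. f x * g x)"
proof (induction n arbitrary: f g)
  case (Suc n)
  have "partial_deriv i (\<lambda>x. f x * g x) = (\<lambda>x. f x * partial_deriv i g x + partial_deriv i f x * g x)" for i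
    using Suc.prems by (auto simp: partial_deriv_mult)
  \<comment> \<open>The product rule leaves one factor undifferentiated, so the induction hypothesis
    is applied to \<open>f\<close> and \<open>g\<close> themselves at the lower order too.\<close>
  moreover have "smooth_upto n f" "smooth_upto n g"
    using Suc.prems smooth_upto_Suc_imp by blast+
  ultimately show ?case using Suc by (auto intro!: smooth_upto_add)
qed auto

lemma partial_deriv_const [simp]: "partial_deriv i (\<lambda>x. c) = (\<lambda>x. 0)"
  by (rule ext) (rule trans[OF partial_derivI[OF has_derivative_const]], simp)

lemma smooth_upto_const [simp]: "smooth_upto n (\<lambda>x. c)"
  by (induction n arbitrary: c) auto

lemma smooth_upto_component: "smooth_upto n (\<lambda>x::real^'n. complex_of_real (x $ j))"
proof -
  have D: "((\<lambda>x. complex_of_real (x $ j)) has_derivative (\<lambda>x. complex_of_real (x $ j))) (at x)" for x :: "real^'n"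
    by (intro bounded_linear_imp_has_derivative bounded_linear_compose[OF bounded_linear_of_real bounded_linear_vec_nth])
  then have *: "\<forall>x. (\<lambda>x::real^'n. complex_of_real (x $ j)) differentiable (at x)"
    unfolding differentiable_def by blast
  have "partial_deriv i (\<lambda>x. complex_of_real (x $ j)) = (\<lambda>x. complex_of_real (axis i 1 $ j))" for i
    using partial_derivI[OF D] by auto
  with * show ?thesis by (cases n) auto
qed

lemma partial_deriv_affine:
  assumes "f differentiable (at (c *\<^sub>R x + d))"
  shows "(\<lambda>y. f (c *\<^sub>R y + d)) differentiable (at x)"
    and "partial_deriv i (\<lambda>y. f (c *\<^sub>R y + d)) x = of_real c * partial_deriv i f (c *\<^sub>R x + d)"
proof -
  have lin: "linear (frechet_derivative f (at (c *\<^sub>R x + d)))"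
    using assms linear_frechet_derivative by blast
  have "((\<lambda>y. c *\<^sub>R y + d) has_derivative (\<lambda>v. c *\<^sub>R v)) (at x)"
    by (auto intro!: derivative_eq_intros)
  then have D: "((\<lambda>y. f (c *\<^sub>R y + d)) has_derivative (\<lambda>v. frechet_derivative f (at (c *\<^sub>R x + d)) (c *\<^sub>R v))) (at x)"
    using has_derivative_compose[of "\<lambda>y. c *\<^sub>R y + d" "\<lambda>v. c *\<^sub>R v" x UNIV f] assms frechet_derivative_works by blast
  then show "(\<lambda>y. f (c *\<^sub>R y + d)) differentiable (at x)"
    unfolding differentiable_def by blast
  show "partial_deriv i (\<lambda>y. f (c *\<^sub>R y + d)) x = of_real c * partial_deriv i f (c *\<^sub>R x + d)"
    using partial_derivI[OF D, of i] linear_cmul[OF lin, of c "axis i 1"]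
    by (simp add: partial_deriv_def scaleR_conv_of_real[where 'a = complex])
qed

lemma smooth_upto_affine: "smooth_upto n f \<Longrightarrow> smooth_upto n (\<lambda>x. f (c *\<^sub>R x + d))"
proof (induction n arbitrary: f)
  case 0
  then show ?case by (auto intro: partial_deriv_affine)
next
  case (Suc n)
  have "partial_deriv i (\<lambda>x. f (c *\<^sub>R x + d)) = (\<lambda>x. of_real c * partial_deriv i f (c *\<^sub>R x + d))" for i
    using Suc.prems by (auto simp: partial_deriv_affine)
  with Suc show ?case by (auto intro!: smooth_upto_mult partial_deriv_affine)
qed

lemma smooth_fun_add: "smooth_fun f \<Longrightarrow> smooth_fun g \<Longrightarrow> smooth_fun (\<lambda>x. f x + g x)"
  by (simp add: smooth_fun_iff_upto smooth_upto_add)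

lemma smooth_fun_mult: "smooth_fun f \<Longrightarrow> smooth_fun g \<Longrightarrow> smooth_fun (\<lambda>x. f x * g x)"
  by (simp add: smooth_fun_iff_upto smooth_upto_mult)

lemma smooth_fun_const: "smooth_fun (\<lambda>x. c)"
  by (simp add: smooth_fun_iff_upto)

lemma smooth_fun_affine: "smooth_fun f \<Longrightarrow> smooth_fun (\<lambda>x. f (c *\<^sub>R x + d))"
  by (simp add: smooth_fun_iff_upto smooth_upto_affine)

section \<open>Test functions and a bump function\<close>

lemma C0_inf_iff: "C0_inf f \<longleftrightarrow> smooth_fun f \<and> (\<exists>R. \<forall>x. R < norm x \<longrightarrow> f x = 0)"
proof -
  have "compact (closure {x. f x \<noteq> 0}) \<longleftrightarrow> bounded {x. f x \<noteq> 0}"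
    by simp
  also have "\<dots> \<longleftrightarrow> (\<exists>R. \<forall>x. R < norm x \<longrightarrow> f x = 0)"
    unfolding bounded_iff Ball_def mem_Collect_eq by (intro ex_cong1 all_cong1) (metis not_le)
  finally show ?thesis
    by (simp add: C0_inf_def)
qed

lemma C0_infI: "smooth_fun f \<Longrightarrow> (\<And>x. R < norm x \<Longrightarrow> f x = 0) \<Longrightarrow> C0_inf f"
  unfolding C0_inf_iff by blast

lemma C0_inf_smooth: "C0_inf f \<Longrightarrow> smooth_fun f"
  by (simp add: C0_inf_def)

lemma C0_inf_support:
  assumes "C0_inf f"
  obtains R where "R > 0" "\<And>x. R < norm x \<Longrightarrow> f x = 0"
proof -
  obtain R where "\<forall>x. R < norm x \<longrightarrow> f x = 0"
    using assms C0_inf_iff by blast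
  then show ?thesis
    using that[of "max R 1"] by simp
qed

text \<open>The exterior of the closed ball is open, so \<open>f\<close> agrees with the zero
  function near \<open>x\<close> and inherits its derivative.\<close>

lemma partial_deriv_zero_outside:
  assumes "\<And>x. R < norm x \<Longrightarrow> f x = 0" "R < norm x"
  shows "partial_deriv i f x = 0"
proof -
  have "open {x::real^'a. R < norm x}"
    by (intro open_Collect_less continuous_intros)
  moreover have "((\<lambda>x. 0) has_derivative (\<lambda>_. 0)) (at x)"
    by simp
  ultimately have "(f has_derivative (\<lambda>_. 0)) (at x)"
    by (intro has_derivative_transform_within_open[of "\<lambda>_. 0" "\<lambda>_. 0" x UNIV "{x. R < norm x}" f])
       (use assms in auto)
  then show ?thesis
    by (rule partial_derivI)
qed

lemma C0_inf_partial_deriv: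
  assumes "C0_inf f" shows "C0_inf (partial_deriv i f)"
proof -
  obtain R where R: "\<And>x. R < norm x \<Longrightarrow> f x = 0"
    using assms C0_inf_support by blast
  show ?thesis
  proof (rule C0_infI)
    show "smooth_fun (partial_deriv i f)"
      using assms by (intro smooth_fun_partial_deriv C0_inf_smooth)
    show "partial_deriv i f x = 0" if "R < norm x" for x
      using R that by (rule partial_deriv_zero_outside)
  qed
qed

lemma C0_inf_iter_pderiv: "C0_inf f \<Longrightarrow> C0_inf (iter_pderiv is f)"
  by (induction "is") (auto intro: C0_inf_partial_deriv)

lemma C0_inf_mult_smooth:
  assumes "C0_inf f" "smooth_fun g" shows "C0_inf (\<lambda>x. f x * g x)"
proof -
  obtain R where "\<And>x. R < norm x \<Longrightarrow> f x = 0"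
    using assms(1) C0_inf_support by blast
  with assms show ?thesis
    by (intro C0_infI[of _ R] smooth_fun_mult) (auto simp: C0_inf_smooth)
qed

lemma C0_inf_add:
  assumes "C0_inf f" "C0_inf g" shows "C0_inf (\<lambda>x. f x + g x)"
proof -
  obtain R where "\<And>x. R < norm x \<Longrightarrow> f x = 0"
    using assms(1) C0_inf_support by blast
  moreover obtain R' where "\<And>x. R' < norm x \<Longrightarrow> g x = 0"
    using assms(2) C0_inf_support by blast
  ultimately show ?thesis
    using assms by (intro C0_infI[of _ "max R R'"] smooth_fun_add) (auto simp: C0_inf_smooth)
qed

lemma continuous_bounded_support:
  fixes f :: "real^'n \<Rightarrow> 'b::real_normed_vector"
  assumes "continuous_on UNIV f" "\<And>x. R < norm x \<Longrightarrow> f x = 0"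
  obtains B where "B > 0" "\<And>x. norm (f x) \<le> B"
proof -
  have "compact (f ` cball 0 R)"
    using assms(1) by (intro compact_continuous_image) (auto intro: continuous_on_subset)
  then obtain B where B: "B > 0" "\<And>x. x \<in> cball 0 R \<Longrightarrow> norm (f x) \<le> B"
    by (metis bounded_pos compact_imp_bounded imageI)
  have "norm (f x) \<le> B" for x
    using B assms(2)[of x] by (cases "norm x \<le> R") auto
  with B that show ?thesis by blast
qed

lemma continuous_support_integrable:
  fixes f :: "real^'n \<Rightarrow> complex"
  assumes "continuous_on UNIV f" "\<And>x. R < norm x \<Longrightarrow> f x = 0"
  shows "integrable lborel f"
proof -
  have "integrable lborel (\<lambda>x. indicator (cball 0 R) x *\<^sub>R f x)"
    using assms(1) by (intro borel_integrable_compact[of _ f, unfolded set_integrable_def])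
      (auto intro: continuous_on_subset)
  moreover have "(\<lambda>x. indicator (cball 0 R) x *\<^sub>R f x) = f"
    using assms(2) by (fastforce simp: indicator_def)
  ultimately show ?thesis by simp
qed

lemma C0_inf_continuous: "C0_inf f \<Longrightarrow> continuous_on S f"
  by (intro smooth_fun_continuous C0_inf_smooth)

lemma C0_inf_integrable:
  assumes "C0_inf f" shows "integrable lborel f"
proof -
  obtain R where R: "\<And>x. R < norm x \<Longrightarrow> f x = 0"
    using assms C0_inf_support by blast
  show ?thesis
    using C0_inf_continuous[OF assms] R by (rule continuous_support_integrable)
qed

lemma C0_inf_schwartz:
  assumes "C0_inf f" shows "schwartz f"
  unfolding schwartz_def
proof (intro conjI allI)
  show "smooth_fun f" using assms by (rule C0_inf_smooth)
  fix "is" k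
  have C: "C0_inf (iter_pderiv is f)" using assms by (rule C0_inf_iter_pderiv)
  then obtain R where R: "\<And>x. R < norm x \<Longrightarrow> iter_pderiv is f x = 0"
    using C0_inf_support by blast
  let ?g = "\<lambda>x. (1 + norm x) ^ k * norm (iter_pderiv is f x)"
  have "continuous_on UNIV ?g"
    using C by (intro continuous_intros C0_inf_continuous)
  moreover have "?g x = 0" if "R < norm x" for x
    using R[OF that] by simp
  ultimately obtain B where "\<And>x. norm (?g x) \<le> B"
    using continuous_bounded_support[of ?g R] by blast
  then show "bounded (range ?g)"
    unfolding bounded_iff by blast
qed

section \<open>The flat function and the standard bump\<close>

text \<open>All derivatives of \<open>exp (-1/t)\<close> are combinations of these functions.\<close>
definition flat :: "nat \<Rightarrow> real \<Rightarrow> real" where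
  "flat k t = (if 0 < t then exp (- 1 / t) / t ^ k else 0)"

text \<open>A nonnegative series dominates each single term; here the series is that of
  \<open>exp s\<close>.\<close>

lemma power_le_fact_exp:
  fixes s :: real assumes "0 \<le> s" shows "s ^ n \<le> fact n * exp s"
proof -
  have "sum (\<lambda>n. s ^ n /\<^sub>R fact n) {n} \<le> suminf (\<lambda>n. s ^ n /\<^sub>R fact n)"
    using assms by (intro sum_le_suminf summable_exp_generic) auto
  also have "\<dots> = exp s"
    using exp_converges sums_unique by metis
  finally show ?thesis
    by (simp add: field_simps)
qed

text \<open>Taking \<open>s = 1 / t\<close> and the power \<open>k + 2\<close> in the exponential
  bound leaves two spare powers of \<open>t\<close>. A quadratic bound makes the difference quotient
  at 0 tend to 0, which is the only delicate point of differentiability.\<close>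

lemma flat_le: "\<bar>flat k t\<bar> \<le> fact (k + 2) * t\<^sup>2"
proof (cases "0 < t")
  case True
  have "(1 / t) ^ (k + 2) * exp (- 1 / t) \<le> fact (k + 2) * exp (1 / t) * exp (- 1 / t)"
    using True by (intro mult_right_mono power_le_fact_exp) auto
  also have "\<dots> = fact (k + 2)"
    using exp_add[of "1 / t" "- 1 / t"] by simp
  also have "(1 / t) ^ (k + 2) * exp (- 1 / t) = exp (- 1 / t) / t ^ k / t\<^sup>2"
    by (simp add: power_add divide_inverse power_inverse power2_eq_square mult_ac)
  finally have "exp (- 1 / t) / t ^ k / t\<^sup>2 \<le> fact (k + 2)" .
  then have "exp (- 1 / t) / t ^ k \<le> fact (k + 2) * t\<^sup>2"
    using True by (subst (asm) pos_divide_le_eq) auto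
  then show ?thesis
    using True by (simp add: flat_def)
qed (simp add: flat_def)

lemma flat_has_real_derivative:
  "(flat k has_real_derivative (flat (k + 2) t - k * flat (k + 1) t)) (at t)"
proof -
  consider "t < 0" | "t = 0" | "t > 0" by linarith
  then show ?thesis
  proof cases
    case 1
    have "((\<lambda>_. 0) has_real_derivative 0) (at t)" by simp
    then have "(flat k has_real_derivative 0) (at t)"
      by (rule has_field_derivative_transform_within_open[of _ _ _ "{..<0}"]) (use 1 in \<open>auto simp: flat_def\<close>)
    then show ?thesis using 1 by (simp add: flat_def)
  next
    case 2
    have "((\<lambda>h. flat k h / h) \<longlongrightarrow> 0) (at 0)"
    proof (rule Lim_null_comparison)
      show "\<forall>\<^sub>F h in at 0. norm (flat k h / h) \<le> fact (k + 2) * \<bar>h\<bar>"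
      proof (rule eventually_at_filter[THEN iffD2], rule always_eventually, intro allI impI)
        fix h :: real assume "h \<noteq> 0"
        then show "norm (flat k h / h) \<le> fact (k + 2) * \<bar>h\<bar>"
          using flat_le[of k h] by (simp add: field_simps power2_eq_square abs_if split: if_splits)
      qed
      show "((\<lambda>h. fact (k + 2) * \<bar>h\<bar>) \<longlongrightarrow> (0::real)) (at 0)"
        by (intro tendsto_mult_right_zero tendsto_rabs_zero tendsto_ident_at)
    qed
    then have "((\<lambda>h. (flat k (0 + h) - flat k 0) / h) \<longlongrightarrow> 0) (at 0)"
      by (simp add: flat_def)
    then have "(flat k has_real_derivative 0) (at 0)"
      unfolding DERIV_def .
    then show ?thesis
      using 2 by (simp add: flat_def)
  next
    case 3
    have "((\<lambda>t. exp (- 1 / t) / t ^ k) has_real_derivative (flat (k + 2) t - k * flat (k + 1) t)) (at t)"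
    proof -
      have A: "((\<lambda>t. exp (- 1 / t)) has_real_derivative exp (- 1 / t) / t\<^sup>2) (at t)"
        using 3 by (auto intro!: derivative_eq_intros simp: power2_eq_square)
      have B: "((\<lambda>t. inverse (t ^ k)) has_real_derivative - (k * t ^ (k - 1) / (t ^ k)\<^sup>2)) (at t)"
        using 3 by (auto intro!: derivative_eq_intros simp: power2_eq_square divide_inverse)
      \<comment> \<open>For \<open>k = 0\<close> the exponent \<open>k - 1\<close> is truncated to
        0, but then the factor \<open>k\<close> makes both sides vanish.\<close>
      have C: "k * t ^ (k - 1) / (t ^ k)\<^sup>2 = k / t ^ (k + 1)"
        using 3 by (cases k) (simp_all add: power2_eq_square divide_simps)
      have "((\<lambda>t. exp (- 1 / t) * inverse (t ^ k)) has_real_derivative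
          exp (- 1 / t) / t\<^sup>2 * inverse (t ^ k) + - (k / t ^ (k + 1)) * exp (- 1 / t)) (at t)"
        using DERIV_mult[OF A B] unfolding C .
      then show ?thesis
        using 3 by (simp add: flat_def divide_inverse power_add mult_ac power2_eq_square)
    qed
    then show ?thesis
      by (rule has_field_derivative_transform_within_open[of _ _ _ "{0<..}"]) (use 3 in \<open>auto simp: flat_def\<close>)
  qed
qed

text \<open>The classical \<open>exp (-1 / (1 - |x|^2))\<close> on the unit ball, extended by 0.
  Using \<open>x \<bullet> x\<close> keeps the inner function polynomial, hence smooth at the origin
  too.\<close>

definition bump :: "real^'n \<Rightarrow> real" where
  "bump x = flat 0 (1 - x \<bullet> x)"

text \<open>A partial derivative is a combination of two functions of the same form, with indices
  \<open>k + 2\<close> and \<open>k + 1\<close>, times a coordinate function. The induction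
  therefore runs over the order for all \<open>k\<close> simultaneously.\<close>

lemma smooth_upto_flat_sphere: "smooth_upto n (\<lambda>x::real^'n. complex_of_real (flat k (1 - x \<bullet> x)))"
proof (induction n arbitrary: k)
  have D: "((\<lambda>x::real^'n. complex_of_real (flat k (1 - x \<bullet> x))) has_derivative
       (\<lambda>v. complex_of_real ((flat (k + 2) (1 - x \<bullet> x) - k * flat (k + 1) (1 - x \<bullet> x)) * - (2 * (x \<bullet> v))))) (at x)"
    for x k
  proof -
    have 1: "(flat k has_derivative (\<lambda>h. (flat (k + 2) (1 - x \<bullet> x) - k * flat (k + 1) (1 - x \<bullet> x)) * h))
        (at (1 - x \<bullet> x))"
      using flat_has_real_derivative by (simp add: has_field_derivative_def)
    have 2: "((\<lambda>x::real^'n. 1 - x \<bullet> x) has_derivative (\<lambda>v. - (2 * (x \<bullet> v)))) (at x)"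
      by (auto intro!: derivative_eq_intros simp: inner_commute)
    show ?thesis
      using has_derivative_compose[OF 2 1] by (intro has_derivative_of_real)
  qed
  then have diff: "(\<lambda>x::real^'n. complex_of_real (flat k (1 - x \<bullet> x))) differentiable (at x)" for x k
    unfolding differentiable_def by blast
  case 0
  show ?case using diff by simp
  case (Suc n)
  have "partial_deriv i (\<lambda>x::real^'n. complex_of_real (flat k (1 - x \<bullet> x))) =
      (\<lambda>x. (complex_of_real (flat (k + 2) (1 - x \<bullet> x)) + (- of_nat k) * complex_of_real (flat (k + 1) (1 - x \<bullet> x)))
          * ((- 2) * complex_of_real (x $ i)))" for i
    by (rule ext, subst partial_derivI[OF D]) (simp add: inner_axis algebra_simps)
  then have "smooth_upto n (partial_deriv i (\<lambda>x::real^'n. complex_of_real (flat k (1 - x \<bullet> x))))" for i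
    by (simp only:) (intro smooth_upto_mult smooth_upto_add smooth_upto_component smooth_upto_const Suc.IH)
  then show ?case
    using diff by simp
qed

lemma smooth_bump: "smooth_fun (\<lambda>x::real^'n. complex_of_real (bump x))"
  unfolding bump_def smooth_fun_iff_upto by (simp add: smooth_upto_flat_sphere)

lemma bump_nonneg: "0 \<le> bump x"
  by (simp add: bump_def flat_def)

lemma bump_pos_iff: "0 < bump x \<longleftrightarrow> norm x < 1"
  by (simp add: bump_def flat_def norm_eq_sqrt_inner)

lemma bump_eq_0_iff: "bump x = 0 \<longleftrightarrow> 1 \<le> norm x"
  using bump_nonneg[of x] bump_pos_iff[of x] by linarith

lemma bump_uminus: "bump (- x) = bump x"
  by (simp add: bump_def)

section \<open>Convolution with bounded smooth functions\<close>

lemma lborel_distr_reflect: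
  fixes c :: "'a::euclidean_space"
  shows "distr lborel borel (\<lambda>x. c - x) = lborel"
  by (subst lborel_affine[of "- 1" c], auto simp: density_1)

lemma nn_integral_lborel_translate:
  fixes c :: "'a::euclidean_space"
  assumes "f \<in> borel_measurable borel"
  shows "(\<integral>\<^sup>+x. f (x + c) \<partial>lborel) = (\<integral>\<^sup>+x. f x \<partial>lborel)"
proof -
  have "(\<integral>\<^sup>+x. f x \<partial>lborel) = (\<integral>\<^sup>+x. f x \<partial>distr lborel borel ((+) c))"
    by (simp add: lborel_distr_plus)
  also have "\<dots> = (\<integral>\<^sup>+x. f (x + c) \<partial>lborel)"
    using assms by (subst nn_integral_distr) (auto simp: add.commute)
  finally show ?thesis ..
qed

lemma integral_lborel_translate:
  fixes c :: "'a::euclidean_space" and f :: "'a \<Rightarrow> 'b::{banach, second_countable_topology}"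
  assumes "f \<in> borel_measurable borel"
  shows "(\<integral>x. f (x + c) \<partial>lborel) = (\<integral>x. f x \<partial>lborel)"
proof -
  have "(\<integral>x. f x \<partial>lborel) = (\<integral>x. f x \<partial>distr lborel borel ((+) c))"
    by (simp add: lborel_distr_plus)
  also have "\<dots> = (\<integral>x. f (x + c) \<partial>lborel)"
    using assms by (subst integral_distr) (auto simp: add.commute)
  finally show ?thesis ..
qed

lemma integral_lborel_reflect:
  fixes c :: "'a::euclidean_space" and f :: "'a \<Rightarrow> 'b::{banach, second_countable_topology}"
  assumes "f \<in> borel_measurable borel"
  shows "(\<integral>x. f (c - x) \<partial>lborel) = (\<integral>x. f x \<partial>lborel)"
proof -
  have "(\<integral>x. f x \<partial>lborel) = (\<integral>x. f x \<partial>distr lborel borel (\<lambda>x. c - x))"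
    by (simp add: lborel_distr_reflect)
  also have "\<dots> = (\<integral>x. f (c - x) \<partial>lborel)"
    using assms by (subst integral_distr) auto
  finally show ?thesis ..
qed

lemma integrable_lborel_reflect:
  fixes c :: "'a::euclidean_space" and f :: "'a \<Rightarrow> 'b::{banach, second_countable_topology}"
  assumes "integrable lborel f"
  shows "integrable lborel (\<lambda>x. f (c - x))"
proof -
  have "integrable (distr lborel borel (\<lambda>x. c - x)) f"
    using assms by (simp add: lborel_distr_reflect)
  then show ?thesis
    by (rule integrable_distr[rotated]) simp
qed

lemma integrable_mult_bounded:
  fixes f g :: "'a \<Rightarrow> complex"
  assumes "integrable M f" "g \<in> borel_measurable M" "\<And>x. norm (g x) \<le> B"
  shows "integrable M (\<lambda>x. f x * g x)"
proof (rule Bochner_Integration.integrable_bound)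
  show "integrable M (\<lambda>x. B * norm (f x))"
    using assms by simp
  show "(\<lambda>x. f x * g x) \<in> borel_measurable M"
    using assms by simp
  show "AE x in M. norm (f x * g x) \<le> norm (B * norm (f x))"
  proof (intro always_eventually allI)
    fix x
    have "norm (f x * g x) \<le> norm (f x) * B"
      unfolding norm_mult by (intro mult_left_mono assms) auto
    also have "\<dots> \<le> norm (B * norm (f x))"
      by (simp add: abs_mult mult.commute mult_right_mono)
    finally show "norm (f x * g x) \<le> norm (B * norm (f x))" .
  qed
qed

text \<open>Derivatives are always put on the second argument, so the first may be merely
  integrable.\<close>

definition conv :: "(real^'n \<Rightarrow> complex) \<Rightarrow> (real^'n \<Rightarrow> complex) \<Rightarrow> real^'n \<Rightarrow> complex" where
  "conv m u = (\<lambda>x. \<integral>w. m w * u (x - w) \<partial>lborel)"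

lemma partial_deriv_sum_bound:
  fixes u :: "real^'n \<Rightarrow> complex"
  assumes "\<And>i y. norm (partial_deriv i u y) \<le> B"
  shows "norm (\<Sum>i\<in>UNIV. v $ i *\<^sub>R partial_deriv i u y) \<le> real CARD('n) * B * norm v"
proof -
  have "norm (\<Sum>i\<in>UNIV. v $ i *\<^sub>R partial_deriv i u y) \<le> (\<Sum>i\<in>(UNIV::'n set). norm v * B)"
    by (rule order_trans[OF norm_sum], rule sum_mono)
       (auto intro!: mult_mono assms component_le_norm_cart)
  then show ?thesis by (simp add: mult_ac)
qed

lemma smooth_lipschitz:
  fixes u :: "real^'n \<Rightarrow> complex"
  assumes "smooth_fun u" "\<And>i y. norm (partial_deriv i u y) \<le> B"
  shows "norm (u x - u y) \<le> real CARD('n) * B * norm (x - y)"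
proof (rule differentiable_bound[where S = UNIV])
  fix x :: "real^'n"
  show "(u has_derivative (\<lambda>v. \<Sum>i\<in>UNIV. v $ i *\<^sub>R partial_deriv i u x)) (at x within UNIV)"
    using assms(1) by (simp add: has_derivative_partial smooth_fun_differentiable)
  show "onorm (\<lambda>v. \<Sum>i\<in>UNIV. v $ i *\<^sub>R partial_deriv i u x) \<le> real CARD('n) * B"
    by (rule onorm_le) (rule partial_deriv_sum_bound[OF assms(2)])
qed auto

text \<open>Differentiation under the integral by dominated convergence: along any sequence tending
  to \<open>x\<close>, the normalized first-order remainder of \<open>u\<close> tends to 0 pointwise
  and is uniformly bounded, so \<open>m\<close> times it has an integrable majorant.\<close>

lemma conv_has_derivative:
  fixes u :: "real^'n \<Rightarrow> complex"
  assumes m: "integrable lborel m" and u: "smooth_fun u"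
    and B0: "\<And>y. norm (u y) \<le> B" and B: "\<And>i y. norm (partial_deriv i u y) \<le> B"
  shows "(conv m u has_derivative (\<lambda>v. \<Sum>i\<in>UNIV. v $ i *\<^sub>R conv m (partial_deriv i u) x)) (at x)"
  unfolding has_derivative_iff_norm
proof (intro conjI)
  show "bounded_linear (\<lambda>v. \<Sum>i\<in>UNIV. v $ i *\<^sub>R conv m (partial_deriv i u) x)"
    by (intro bounded_linear_sum bounded_linear_scaleR_left[THEN bounded_linear_compose] bounded_linear_vec_nth)
  define L where "L = (\<lambda>v y. \<Sum>i\<in>UNIV. v $ i *\<^sub>R partial_deriv i u y)"
  have [measurable]: "u \<in> borel_measurable borel" "partial_deriv i u \<in> borel_measurable borel" for i
    using u by (auto intro!: borel_measurable_continuous_onI smooth_fun_continuous smooth_fun_partial_deriv)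
  have [measurable]: "m \<in> borel_measurable borel"
    using m by (auto dest: borel_measurable_integrable)
  have i1: "integrable lborel (\<lambda>w. m w * u (y - w))" for y
    by (rule integrable_mult_bounded[OF m _ B0]) simp
  have i2: "integrable lborel (\<lambda>w. m w * partial_deriv i u (y - w))" for y i
    by (rule integrable_mult_bounded[OF m _ B]) simp
  have i3: "integrable lborel (\<lambda>w. m w * L v (y - w))" for y v
    unfolding L_def sum_distrib_left mult_scaleR_right
    by (intro Bochner_Integration.integrable_sum integrable_scaleR_right i2)
  have e3: "(\<integral>w. m w * L v (y - w) \<partial>lborel) = (\<Sum>i\<in>UNIV. v $ i *\<^sub>R conv m (partial_deriv i u) y)" for y v
    unfolding L_def sum_distrib_left mult_scaleR_right conv_def
    by (subst Bochner_Integration.integral_sum) (auto intro!: integrable_scaleR_right i2)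
  have [measurable]: "L v \<in> borel_measurable borel" for v
    unfolding L_def by measurable
  let ?C = "real CARD('n) * B"
  show "((\<lambda>y. norm (conv m u y - conv m u x - (\<Sum>i\<in>UNIV. (y - x) $ i *\<^sub>R conv m (partial_deriv i u) x)) / norm (y - x)) \<longlongrightarrow> 0) (at x)"
    unfolding tendsto_at_iff_sequentially comp_def
  proof (intro allI impI)
    fix X :: "nat \<Rightarrow> real^'n"
    assume X0: "\<forall>i. X i \<in> UNIV - {x}" and X: "X \<longlonglongrightarrow> x"
    define r where "r n w = (u (X n - w) - u (x - w) - L (X n - x) (x - w)) /\<^sub>R norm (X n - x)" for n w
    have [measurable]: "r n \<in> borel_measurable borel" for n
      unfolding r_def by measurable
    \<comment> \<open>One copy of \<open>?C\<close> comes from the Lipschitz bound for the increment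
      of \<open>u\<close>, the other from its linear part.\<close>
    have rb: "norm (r n w) \<le> 2 * ?C" for n w
    proof -
      have "norm (u (X n - w) - u (x - w) - L (X n - x) (x - w)) \<le>
         norm (u (X n - w) - u (x - w)) + norm (L (X n - x) (x - w))"
        by (rule norm_triangle_ineq4)
      also have "\<dots> \<le> 2 * ?C * norm (X n - x)"
        using smooth_lipschitz[OF u B, of "X n - w" "x - w"]
          partial_deriv_sum_bound[OF B, of "X n - x" "x - w"] by (simp add: L_def)
      finally have "norm (u (X n - w) - u (x - w) - L (X n - x) (x - w)) / norm (X n - x) \<le> 2 * ?C"
        using X0 by (subst pos_divide_le_eq) auto
      then show ?thesis
        by (simp add: r_def divide_inverse mult.commute)
    qed
    have r0: "(\<lambda>n. r n w) \<longlonglongrightarrow> 0" for w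
    proof -
      have "(u has_derivative (\<lambda>v. L v (x - w))) (at (x - w))"
        unfolding L_def using u by (simp add: has_derivative_partial smooth_fun_differentiable)
      then have "((\<lambda>y. norm (u y - u (x - w) - L (y - (x - w)) (x - w)) / norm (y - (x - w))) \<longlongrightarrow> 0) (at (x - w))"
        unfolding has_derivative_iff_norm by blast
      then have "(\<lambda>n. norm (u (X n - w) - u (x - w) - L (X n - w - (x - w)) (x - w)) / norm (X n - w - (x - w))) \<longlonglongrightarrow> 0"
        unfolding tendsto_at_iff_sequentially comp_def
        using X0 X by (auto elim!: allE[of _ "\<lambda>n. X n - w"] intro!: tendsto_intros)
      then have "(\<lambda>n. norm (r n w)) \<longlonglongrightarrow> 0"
        by (simp add: r_def divide_inverse mult.commute)
      then show ?thesis
        by (rule tendsto_norm_zero_cancel)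
    qed
    have "(\<lambda>n. \<integral>w. m w * r n w \<partial>lborel) \<longlonglongrightarrow> (\<integral>w. 0 \<partial>(lborel :: (real^'n) measure))"
    proof (rule integral_dominated_convergence)
      show "integrable lborel (\<lambda>w. norm (m w) * (2 * ?C))"
        using m by simp
      show "AE w in lborel. (\<lambda>n. m w * r n w) \<longlonglongrightarrow> 0"
        using r0 by (intro always_eventually allI tendsto_mult_right_zero)
      show "AE w in lborel. norm (m w * r n w) \<le> norm (m w) * (2 * ?C)" for n
        using rb by (intro always_eventually allI) (simp add: norm_mult mult_left_mono)
    qed auto
    then have "(\<lambda>n. norm (\<integral>w. m w * r n w \<partial>lborel)) \<longlonglongrightarrow> 0"
      by (simp add: tendsto_norm_zero)
    moreover have "norm (\<integral>w. m w * r n w \<partial>lborel) = norm (conv m u (X n) - conv m u x -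
        (\<Sum>i\<in>UNIV. (X n - x) $ i *\<^sub>R conv m (partial_deriv i u) x)) / norm (X n - x)" for n
    proof -
      have "(\<integral>w. m w * r n w \<partial>lborel) =
        (\<integral>w. m w * u (X n - w) - m w * u (x - w) - m w * L (X n - x) (x - w) \<partial>lborel) /\<^sub>R norm (X n - x)"
        unfolding r_def by (simp add: algebra_simps flip: integral_scaleR_right)
      also have "\<dots> = (conv m u (X n) - conv m u x -
        (\<Sum>i\<in>UNIV. (X n - x) $ i *\<^sub>R conv m (partial_deriv i u) x)) /\<^sub>R norm (X n - x)"
        using i1 i3 by (simp add: conv_def e3[unfolded conv_def])
      finally show ?thesis
        by (simp add: divide_inverse mult.commute)
    qed
    ultimately show "(\<lambda>n. norm (conv m u (X n) - conv m u x -
        (\<Sum>i\<in>UNIV. (X n - x) $ i *\<^sub>R conv m (partial_deriv i u) x)) / norm (X n - x)) \<longlonglongrightarrow> 0"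
      by simp
  qed
qed

lemma sum_axis_scaleR:
  fixes c :: "'n::finite \<Rightarrow> complex"
  shows "(\<Sum>j\<in>UNIV. axis i 1 $ j *\<^sub>R c j) = c i"
  by (simp add: axis_def if_distrib[of "\<lambda>t. t *\<^sub>R _"] cong: if_cong)

text \<open>The class of second factors on which convolution with an integrable function can be
  differentiated repeatedly: it is closed under partial derivatives and contains the Schwartz
  functions.\<close>

definition bounded_smooth :: "(real^'n \<Rightarrow> complex) \<Rightarrow> bool" where
  "bounded_smooth u \<longleftrightarrow> smooth_fun u \<and> (\<forall>is. bounded (range (iter_pderiv is u)))"

lemma bounded_smooth_partial_deriv: "bounded_smooth u \<Longrightarrow> bounded_smooth (partial_deriv i u)"
  unfolding bounded_smooth_def
  by (auto intro: smooth_fun_partial_deriv simp flip: iter_pderiv_snoc)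

lemma bounded_smooth_bounds:
  assumes "bounded_smooth (u :: real^'n \<Rightarrow> complex)"
  obtains B where "\<And>y. norm (u y) \<le> B" "\<And>i y. norm (partial_deriv i u y) \<le> B"
proof -
  have "bounded (range (iter_pderiv is u))" for "is"
    using assms unfolding bounded_smooth_def by blast
  then have "bounded (range (iter_pderiv [] u) \<union> (\<Union>i. range (iter_pderiv [i] u)))"
    by (intro bounded_Un[THEN iffD2] conjI bounded_UN ballI finite)
  then obtain B where "\<forall>z \<in> range u \<union> (\<Union>i. range (partial_deriv i u)). norm z \<le> B"
    unfolding bounded_iff iter_pderiv.simps by blast
  then show ?thesis
    by (intro that[of B]) blast+
qed

lemma conv_differentiable:
  assumes "integrable lborel m" "bounded_smooth u"
  shows "conv m u differentiable (at x)"
    and "partial_deriv i (conv m u) = conv m (partial_deriv i u)"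
proof -
  obtain B where "\<And>y. norm (u y) \<le> B" "\<And>i y. norm (partial_deriv i u y) \<le> B"
    using bounded_smooth_bounds[OF assms(2)] by blast
  then have D: "(conv m u has_derivative (\<lambda>v. \<Sum>i\<in>UNIV. v $ i *\<^sub>R conv m (partial_deriv i u) x)) (at x)" for x
    using assms by (intro conv_has_derivative) (auto simp: bounded_smooth_def)
  from D[of x] show "conv m u differentiable (at x)"
    unfolding differentiable_def by blast
  show "partial_deriv i (conv m u) = conv m (partial_deriv i u)"
    using partial_derivI[OF D] by (simp add: sum_axis_scaleR fun_eq_iff)
qed

lemma iter_pderiv_conv:
  assumes "integrable lborel m" "bounded_smooth u"
  shows "iter_pderiv is (conv m u) = conv m (iter_pderiv is u)"
  using assms(2)
\<comment> \<open>Reverse induction splits off the innermost derivative, which passes from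
  \<open>conv m u\<close> to \<open>u\<close> and so changes the \<open>u\<close> of the induction
  hypothesis.\<close>
proof (induction "is" arbitrary: u rule: rev_induct)
  case (snoc i "is")
  then show ?case
    using assms(1) by (simp add: iter_pderiv_snoc conv_differentiable bounded_smooth_partial_deriv)
qed simp

lemma bounded_smooth_iter_pderiv: "bounded_smooth u \<Longrightarrow> bounded_smooth (iter_pderiv is u)"
  by (induction "is") (auto intro: bounded_smooth_partial_deriv)

lemma smooth_fun_conv:
  assumes "integrable lborel m" "bounded_smooth u"
  shows "smooth_fun (conv m u)"
  unfolding smooth_fun_def iter_pderiv_conv[OF assms]
  using assms by (auto intro: conv_differentiable bounded_smooth_iter_pderiv)

lemma schwartz_bounded_smooth: assumes "schwartz u" shows "bounded_smooth u"
  unfolding bounded_smooth_def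
proof (intro conjI allI)
  show "smooth_fun u" using assms by (simp add: schwartz_def)
  fix "is"
  have "bounded (range (\<lambda>x. (1 + norm x) ^ 0 * norm (iter_pderiv is u x)))"
    using assms unfolding schwartz_def by blast
  then show "bounded (range (iter_pderiv is u))"
    by (simp add: bounded_iff)
qed

section \<open>Fourier transforms of integrable functions\<close>

lemma borel_measurable_cis [measurable]:
  "g \<in> borel_measurable M \<Longrightarrow> (\<lambda>x. cis (g x)) \<in> borel_measurable M"
  by (rule measurable_compose[where g = cis]) (auto intro!: borel_measurable_continuous_onI continuous_intros)

text \<open>Passage from the completed measure of the definition to \<open>lborel\<close>, where
  Fubini and translation invariance are applied.\<close>

lemma fourier_lborel:
  fixes f :: "real^'n \<Rightarrow> complex"
  assumes [measurable]: "f \<in> borel_measurable borel"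
  shows "fourier f \<gamma> = (\<integral>x. f x * cis (- (\<gamma> \<bullet> x)) \<partial>lborel)"
  unfolding fourier_def by (subst integral_completion) auto

lemma integrable_mult_cis:
  assumes "integrable lborel f"
  shows "integrable lborel (\<lambda>x. f x * cis (- (\<gamma> \<bullet> x)))"
  by (rule integrable_mult_bounded[OF assms, of _ 1]) auto

lemma norm_fourier_le:
  assumes "integrable lborel f"
  shows "norm (fourier f \<gamma>) \<le> (\<integral>x. norm (f x) \<partial>lborel)"
proof -
  have "norm (\<integral>x. f x * cis (- (\<gamma> \<bullet> x)) \<partial>lborel) \<le> (\<integral>x. norm (f x * cis (- (\<gamma> \<bullet> x))) \<partial>lborel)"
    by simp
  then show ?thesis
    using borel_measurable_integrable[OF assms] by (simp add: fourier_lborel norm_mult)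
qed

lemma borel_measurable_fourier:
  assumes "integrable lborel f"
  shows "fourier f \<in> borel_measurable borel"
proof -
  have [measurable]: "f \<in> borel_measurable borel"
    using borel_measurable_integrable[OF assms] by simp
  have "(\<lambda>\<gamma>. \<integral>x. f x * cis (- (\<gamma> \<bullet> x)) \<partial>lborel) \<in> borel_measurable borel"
    by measurable
  then show ?thesis
    by (subst measurable_cong[where g = "\<lambda>\<gamma>. \<integral>x. f x * cis (- (\<gamma> \<bullet> x)) \<partial>lborel"]) (auto simp: fourier_lborel)
qed

text \<open>For \<open>norm x < 1\<close> the support of \<open>\<lambda>w. h (x - w)\<close> lies
  within distance \<open>R + norm x < R + 1\<close> of the origin, so the cutoff has no effect and
  reflection invariance gives the full integral.\<close>

lemma conv_indicator_ball:
  fixes h :: "real^'n \<Rightarrow> complex"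
  assumes "h \<in> borel_measurable borel" "\<And>x. R < norm x \<Longrightarrow> h x = 0" "norm x < 1"
  shows "conv (indicator (ball 0 (R + 1))) h x = (\<integral>w. h w \<partial>lborel)"
proof -
  have "indicator (ball 0 (R + 1)) w * h (x - w) = h (x - w)" for w
  proof (cases "w \<in> ball 0 (R + 1)")
    case False
    have "norm w \<le> norm x + norm (x - w)"
      by (metis norm_minus_commute norm_triangle_sub)
    with False assms(3) have "R < norm (x - w)"
      by simp
    then show ?thesis
      using assms(2) by simp
  qed simp
  then have "conv (indicator (ball 0 (R + 1))) h x = (\<integral>w. h (x - w) \<partial>lborel)"
    unfolding conv_def by (intro Bochner_Integration.integral_cong refl)
  then show ?thesis
    using assms(1) by (simp add: integral_lborel_reflect)
qed

lemma C0_inf_borel: "C0_inf f \<Longrightarrow> f \<in> borel_measurable borel"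
  by (intro borel_measurable_continuous_onI C0_inf_continuous)

lemma C0_inf_bounded_smooth: "C0_inf f \<Longrightarrow> bounded_smooth f"
  by (intro schwartz_bounded_smooth C0_inf_schwartz)

text \<open>The convolution of \<open>h\<close> with the indicator of a large ball is constant near the origin,
  so its derivative vanishes there.\<close>
lemma integral_partial_deriv_eq_0:
  fixes h :: "real^'n \<Rightarrow> complex"
  assumes h: "C0_inf h"
  shows "(\<integral>x. partial_deriv i h x \<partial>lborel) = 0"
proof -
  obtain R where R: "\<And>x. R < norm x \<Longrightarrow> h x = 0"
    using h C0_inf_support by blast
  let ?m = "indicator (ball 0 (R + 1)) :: real^'n \<Rightarrow> complex"
  have m: "integrable lborel ?m"
  proof (rule integrableI_bounded)
    have "(\<integral>\<^sup>+x. ennreal (norm (?m x)) \<partial>lborel) = (\<integral>\<^sup>+x. indicator (ball (0::real^'n) (R + 1)) x \<partial>lborel)"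
      by (intro nn_integral_cong) (auto split: split_indicator)
    also have "\<dots> < \<infinity>"
      using emeasure_lborel_ball_finite by simp
    finally show "(\<integral>\<^sup>+x. ennreal (norm (?m x)) \<partial>lborel) < \<infinity>" .
    have "?m = (\<lambda>x. complex_of_real (indicator (ball 0 (R + 1)) x))"
      by (auto split: split_indicator)
    moreover have [measurable]: "ball (0::real^'n) (R + 1) \<in> sets borel"
      by simp
    have "(\<lambda>x. complex_of_real (indicator (ball (0::real^'n) (R + 1)) x)) \<in> borel_measurable lborel"
      by measurable
    ultimately show "?m \<in> borel_measurable lborel"
      by (simp only:)
  qed
  have "((\<lambda>x. \<integral>w. h w \<partial>lborel) has_derivative (\<lambda>_. 0)) (at (0 :: real^'n))"
    by simp
  then have "(conv ?m h has_derivative (\<lambda>_. 0)) (at 0)"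
    by (rule has_derivative_transform_within_open[where s = "ball 0 1"])
       (use R h in \<open>auto simp: conv_indicator_ball C0_inf_borel\<close>)
  then have "partial_deriv i (conv ?m h) 0 = 0"
    by (rule partial_derivI)
  then have "conv ?m (partial_deriv i h) 0 = 0"
    using conv_differentiable(2)[OF m C0_inf_bounded_smooth[OF h], of i] by simp
  moreover have "partial_deriv i h x = 0" if "R < norm x" for x
    using R that by (rule partial_deriv_zero_outside)
  then have "conv ?m (partial_deriv i h) 0 = (\<integral>w. partial_deriv i h w \<partial>lborel)"
    using C0_inf_borel[OF C0_inf_partial_deriv[OF h]] by (intro conv_indicator_ball) auto
  ultimately show ?thesis by simp
qed

lemma character_has_derivative:
  fixes \<gamma> :: "real^'n"
  shows "((\<lambda>x. cis (- (\<gamma> \<bullet> x))) has_derivative (\<lambda>v. - \<i> * of_real (\<gamma> \<bullet> v) * cis (- (\<gamma> \<bullet> x)))) (at x)"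
proof -
  have 1: "((\<lambda>x. \<i> * of_real (- (\<gamma> \<bullet> x))) has_derivative (\<lambda>v. \<i> * of_real (- (\<gamma> \<bullet> v)))) (at x)"
    by (auto intro!: derivative_eq_intros)
  have 2: "(exp has_derivative (\<lambda>h. exp (\<i> * of_real (- (\<gamma> \<bullet> x))) * h)) (at (\<i> * of_real (- (\<gamma> \<bullet> x))))"
    using DERIV_exp by (simp add: has_field_derivative_def)
  show ?thesis
    using has_derivative_compose[OF 1 2] by (simp add: cis_conv_exp mult_ac)
qed

lemma smooth_character:
  fixes \<gamma> :: "real^'n"
  shows "smooth_fun (\<lambda>x. cis (- (\<gamma> \<bullet> x)))"
    and "partial_deriv i (\<lambda>x. cis (- (\<gamma> \<bullet> x))) = (\<lambda>x. - \<i> * of_real (\<gamma> $ i) * cis (- (\<gamma> \<bullet> x)))"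
proof -
  have diff: "(\<lambda>x. cis (- (\<gamma> \<bullet> x))) differentiable (at x)" for x
    using character_has_derivative unfolding differentiable_def by blast
  have P: "partial_deriv i (\<lambda>x. cis (- (\<gamma> \<bullet> x))) = (\<lambda>x. - \<i> * of_real (\<gamma> $ i) * cis (- (\<gamma> \<bullet> x)))" for i
    by (rule ext) (simp add: partial_derivI[OF character_has_derivative] inner_axis)
  have "smooth_upto n (\<lambda>x. cis (- (\<gamma> \<bullet> x)))" for n
  proof (induction n)
    case (Suc n)
    then have "smooth_upto n (partial_deriv i (\<lambda>x. cis (- (\<gamma> \<bullet> x))))" for i
      unfolding P by (intro smooth_upto_mult smooth_upto_const)
    then show ?case by (simp add: diff)
  qed (simp add: diff)
  then show "smooth_fun (\<lambda>x. cis (- (\<gamma> \<bullet> x)))"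
    by (simp add: smooth_fun_iff_upto)
  show "partial_deriv i (\<lambda>x. cis (- (\<gamma> \<bullet> x))) = (\<lambda>x. - \<i> * of_real (\<gamma> $ i) * cis (- (\<gamma> \<bullet> x)))"
    by (rule P)
qed

text \<open>Integration by parts: the partial derivative of \<open>h\<close> times a character has
  integral 0, and the product rule expands it into the two transforms.\<close>

lemma fourier_partial_deriv:
  fixes h :: "real^'n \<Rightarrow> complex"
  assumes h: "C0_inf h"
  shows "fourier (partial_deriv i h) \<gamma> = \<i> * of_real (\<gamma> $ i) * fourier h \<gamma>"
proof -
  let ?e = "\<lambda>x. cis (- (\<gamma> \<bullet> x))"
  have "partial_deriv i (\<lambda>x. h x * ?e x) = (\<lambda>x. partial_deriv i h x * ?e x - \<i> * of_real (\<gamma> $ i) * (h x * ?e x))"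
    using h by (auto simp: partial_deriv_mult smooth_character smooth_fun_differentiable C0_inf_smooth)
  moreover have "C0_inf (\<lambda>x. h x * ?e x)"
    using h smooth_character by (intro C0_inf_mult_smooth)
  ultimately have "0 = (\<integral>x. partial_deriv i h x * ?e x - \<i> * of_real (\<gamma> $ i) * (h x * ?e x) \<partial>lborel)"
    using integral_partial_deriv_eq_0 by metis
  also have "\<dots> = (\<integral>x. partial_deriv i h x * ?e x \<partial>lborel) - \<i> * of_real (\<gamma> $ i) * (\<integral>x. h x * ?e x \<partial>lborel)"
    using integrable_mult_cis[OF C0_inf_integrable[OF h]]
      integrable_mult_cis[OF C0_inf_integrable[OF C0_inf_partial_deriv[OF h]]]
    by (subst Bochner_Integration.integral_diff) (auto simp del: integrable_mult_right_iff)
  finally show ?thesis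
    using h by (simp add: fourier_lborel C0_inf_borel C0_inf_partial_deriv)
qed

section \<open>Decay and integrability of transforms of test functions\<close>

lemma fourier_add:
  assumes "integrable lborel f" "integrable lborel g"
  shows "fourier (\<lambda>x. f x + g x) \<gamma> = fourier f \<gamma> + fourier g \<gamma>"
  using borel_measurable_integrable[OF assms(1)] borel_measurable_integrable[OF assms(2)]
    integrable_mult_cis[OF assms(1)] integrable_mult_cis[OF assms(2)]
  by (simp add: fourier_lborel distrib_right)

lemma fourier_cmult:
  assumes "integrable lborel f"
  shows "fourier (\<lambda>x. c * f x) \<gamma> = c * fourier f \<gamma>"
  using borel_measurable_integrable[OF assms] by (simp add: fourier_lborel mult.assoc)

text \<open>Coordinates are added one at a time: passing from \<open>h\<close> to \<open>h\<close>
  minus its second derivative in direction \<open>j\<close> multiplies the transform by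
  \<open>1 + (\<gamma> $ j)^2\<close>, and the result is again a test function. The product form of
  the weight is chosen because its inverse integrates coordinatewise.\<close>

lemma fourier_decay:
  fixes h :: "real^'n \<Rightarrow> complex"
  assumes "C0_inf h" "finite A"
  shows "\<exists>C. \<forall>\<gamma>. (\<Prod>i\<in>A. 1 + (\<gamma> $ i)\<^sup>2) * norm (fourier h \<gamma>) \<le> C"
  using assms(2,1)
proof (induction A arbitrary: h rule: finite_induct)
  case empty
  then show ?case
    using norm_fourier_le[OF C0_inf_integrable] by auto
next
  case (insert j A)
  let ?k = "\<lambda>x. (- 1) * partial_deriv j (partial_deriv j h) x"
  have k: "C0_inf (partial_deriv j (partial_deriv j h))"
    using insert by (intro C0_inf_partial_deriv)
  then have k': "C0_inf ?k"
    using C0_inf_mult_smooth[OF k smooth_fun_const[of "- 1"]] by simp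
  then have "C0_inf (\<lambda>x. h x + ?k x)"
    using insert by (intro C0_inf_add)
  then obtain C where C: "\<And>\<gamma>. (\<Prod>i\<in>A. 1 + (\<gamma> $ i)\<^sup>2) * norm (fourier (\<lambda>x. h x + ?k x) \<gamma>) \<le> C"
    using insert.IH by blast
  have "fourier (\<lambda>x. h x + ?k x) \<gamma> = of_real (1 + (\<gamma> $ j)\<^sup>2) * fourier h \<gamma>" for \<gamma>
    using k k' insert.prems by (subst fourier_add; (subst fourier_cmult)?)
      (auto simp: C0_inf_integrable fourier_partial_deriv C0_inf_partial_deriv algebra_simps power2_eq_square simp del: mult_minus_left)
  then have "norm (fourier (\<lambda>x. h x + ?k x) \<gamma>) = (1 + (\<gamma> $ j)\<^sup>2) * norm (fourier h \<gamma>)" for \<gamma>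
    by (simp add: norm_mult del: of_real_add)
  then show ?case
    using C insert.hyps by (auto simp: mult_ac)
qed

lemma prod_Basis_cart:
  fixes x :: "real^'n"
  shows "(\<Prod>b\<in>Basis. f (x \<bullet> b)) = (\<Prod>i\<in>UNIV. f (x $ i))"
proof -
  have eq: "Basis = range (\<lambda>i::'n. axis i (1::real))"
    by (auto simp: Basis_vec_def)
  have inj: "inj (\<lambda>i::'n. axis i (1::real))"
    by (auto simp: inj_on_def axis_eq_axis)
  show ?thesis
    unfolding eq prod.reindex[OF inj] by (simp add: inner_axis)
qed

text \<open>By Tonelli the integral is a power of the one-dimensional integral of
  \<open>1 / (1 + t^2)\<close>.\<close>

lemma nn_integral_inverse_prod_finite:
  "(\<integral>\<^sup>+x. ennreal (inverse (\<Prod>i\<in>UNIV. 1 + ((x::real^'n) $ i)\<^sup>2)) \<partial>lborel) < \<infinity>"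
proof -
  have "integrable lborel (\<lambda>t::real. inverse (1 + t\<^sup>2))"
    using integrable_inverse_1_plus_square by (simp add: set_integrable_def)
  then have fin: "(\<integral>\<^sup>+t. ennreal (inverse (1 + t\<^sup>2)) \<partial>lborel) < \<infinity>"
    by (simp add: integrable_iff_bounded)
  have "(\<integral>\<^sup>+x. ennreal (inverse (\<Prod>i\<in>UNIV. 1 + ((x::real^'n) $ i)\<^sup>2)) \<partial>lborel) =
     (\<integral>\<^sup>+x. (\<Prod>b\<in>Basis. ennreal (inverse (1 + ((x::real^'n) \<bullet> b)\<^sup>2))) \<partial>lborel)"
    unfolding prod_Basis_cart[where f = "\<lambda>t. ennreal (inverse (1 + t\<^sup>2))"]
    by (simp add: prod_ennreal prod_inversef[symmetric] comp_def)
  also have "\<dots> = (\<Prod>b\<in>(Basis :: (real^'n) set). (\<integral>\<^sup>+t. ennreal (inverse (1 + t\<^sup>2)) \<partial>lborel))"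
    by (rule nn_integral_lborel_prod) auto
  also have "\<dots> < \<infinity>"
    using fin by (simp add: power_less_top_ennreal)
  finally show ?thesis .
qed

text \<open>The \<open>r\<close>-th power of the \<open>L^r\<close> norm, kept in
  \<open>ennreal\<close> so that monotonicity, Tonelli and dominated convergence apply without
  finiteness conditions; the root is taken only at the end.\<close>

definition Lp_int :: "real \<Rightarrow> (real^'n \<Rightarrow> complex) \<Rightarrow> ennreal" where
  "Lp_int r f = (\<integral>\<^sup>+x. ennreal (norm (f x) powr r) \<partial>lborel)"

lemma decay_Lp_finite:
  fixes f :: "real^'n \<Rightarrow> complex"
  assumes C: "\<And>x. (\<Prod>i\<in>UNIV. 1 + (x $ i)\<^sup>2) * norm (f x) \<le> C" and r: "1 \<le> r"
  shows "Lp_int r f < \<infinity>"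
proof -
  have "ennreal (norm (f x) powr r) \<le> ennreal (C powr r) * ennreal (inverse (\<Prod>i\<in>UNIV. 1 + (x $ i)\<^sup>2))" for x
  proof -
    let ?P = "\<Prod>i\<in>UNIV. 1 + (x $ i)\<^sup>2"
    have P: "1 \<le> ?P"
      by (rule prod_ge_1) simp
    have "norm (f x) \<le> C * inverse ?P"
      using C[of x] P by (simp add: field_simps)
    moreover have "0 \<le> C"
      using C[of x] P by (metis mult_nonneg_nonneg norm_ge_zero order_trans zero_le_one)
    ultimately have "norm (f x) powr r \<le> C powr r * inverse ?P powr r"
      using r P by (subst powr_mult[symmetric]) (auto intro!: powr_mono2)
    \<comment> \<open>As \<open>inverse ?P \<le> 1\<close>, an exponent \<open>r \<ge> 1\<close>
      only makes it smaller; this reduces every \<open>r\<close> to the integral for exponent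
      1.\<close>
    also have "inverse ?P powr r \<le> inverse ?P powr 1"
      using r P by (intro powr_mono') (auto simp: inverse_le_1_iff)
    finally have "norm (f x) powr r \<le> C powr r * inverse ?P"
      using P by (simp add: mult_left_mono)
    then show ?thesis
      using P by (subst ennreal_mult[symmetric]) (auto intro!: ennreal_leI)
  qed
  then have "Lp_int r f \<le> (\<integral>\<^sup>+x. ennreal (C powr r) * ennreal (inverse (\<Prod>i\<in>UNIV. 1 + ((x::real^'n) $ i)\<^sup>2)) \<partial>lborel)"
    unfolding Lp_int_def by (intro nn_integral_mono)
  also have "\<dots> = ennreal (C powr r) * (\<integral>\<^sup>+x. ennreal (inverse (\<Prod>i\<in>UNIV. 1 + ((x::real^'n) $ i)\<^sup>2)) \<partial>lborel)"
    by (rule nn_integral_cmult) simp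
  also have "\<dots> < \<infinity>"
    using nn_integral_inverse_prod_finite[where 'n = 'n] by (simp add: ennreal_mult_less_top)
  finally show ?thesis .
qed

lemma fourier_C0_inf_Lp_finite:
  assumes "C0_inf h" "1 \<le> r" shows "Lp_int r (fourier h) < \<infinity>"
proof -
  obtain C where "\<And>\<gamma>. (\<Prod>i\<in>UNIV. 1 + (\<gamma> $ i)\<^sup>2) * norm (fourier h \<gamma>) \<le> C"
    using fourier_decay[OF assms(1), of UNIV] by auto
  then show ?thesis
    using assms(2) by (rule decay_Lp_finite)
qed

lemma schwartz_Lp_finite:
  fixes u :: "real^'n \<Rightarrow> complex"
  assumes "schwartz u" "1 \<le> r" shows "Lp_int r u < \<infinity>"
proof -
  \<comment> \<open>Each of the \<open>CARD('n)\<close> factors \<open>1 + (x $ i)^2\<close> is at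
    most \<open>(1 + norm x)^2\<close>, which fixes the exponent.\<close>
  have "bounded (range (\<lambda>x. (1 + norm x) ^ (2 * CARD('n)) * norm (iter_pderiv [] u x)))"
    using assms unfolding schwartz_def by blast
  then obtain C where C: "\<And>x. (1 + norm x) ^ (2 * CARD('n)) * norm (u x) \<le> C"
    by (auto simp: bounded_iff abs_mult)
  have "(\<Prod>i\<in>UNIV. 1 + (x $ i)\<^sup>2) * norm (u x) \<le> C" for x
  proof -
    have "(\<Prod>i\<in>UNIV. 1 + (x $ i)\<^sup>2) \<le> (\<Prod>i\<in>(UNIV::'n set). (1 + norm x)\<^sup>2)"
    proof (intro prod_mono conjI)
      fix i
      have "\<bar>x $ i\<bar>\<^sup>2 \<le> (norm x)\<^sup>2"
        by (intro power_mono component_le_norm_cart) simp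
      then show "1 + (x $ i)\<^sup>2 \<le> (1 + norm x)\<^sup>2"
        using norm_ge_zero[of x] unfolding power2_sum by (simp del: norm_ge_zero)
    qed simp
    then have "(\<Prod>i\<in>UNIV. 1 + (x $ i)\<^sup>2) * norm (u x) \<le> (1 + norm x) ^ (2 * CARD('n)) * norm (u x)"
      by (simp add: power_mult mult_right_mono)
    then show ?thesis using C by (rule order_trans)
  qed
  then show ?thesis
    using assms(2) by (rule decay_Lp_finite)
qed

lemma Lp_int_1_integrable:
  assumes "f \<in> borel_measurable borel" "Lp_int 1 f < \<infinity>"
  shows "integrable lborel f"
  using assms by (simp add: integrable_iff_bounded Lp_int_def)

section \<open>Mollifiers\<close>

abbreviation (input) cplx :: "('a \<Rightarrow> real) \<Rightarrow> 'a \<Rightarrow> complex" where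
  "cplx u \<equiv> \<lambda>x. complex_of_real (u x)"

text \<open>Evenness is required so that convolution becomes an average of translates and so that
  the kernel may be transposed under Fubini. The real-valued form lets \<open>\<phi>\<close> act as
  a probability density in Jensen's inequality.\<close>

definition mollifier :: "real \<Rightarrow> (real^'n \<Rightarrow> real) \<Rightarrow> bool" where
  "mollifier d \<phi> \<longleftrightarrow> C0_inf (cplx \<phi>) \<and> (\<forall>x. 0 \<le> \<phi> x) \<and> (\<forall>x. \<phi> (- x) = \<phi> x)
     \<and> (\<forall>x. d < norm x \<longrightarrow> \<phi> x = 0) \<and> integral\<^sup>L lborel \<phi> = 1"

lemma smooth_bump_scaled: "smooth_fun (\<lambda>x::real^'n. complex_of_real (bump (c *\<^sub>R x + v)))"
  using smooth_fun_affine[OF smooth_bump, of c v] .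

lemma C0_inf_bump_scaled:
  assumes "0 < d" shows "C0_inf (\<lambda>x::real^'n. complex_of_real (bump ((1 / d) *\<^sub>R x)))"
proof (rule C0_infI[where R = d])
  show "smooth_fun (\<lambda>x::real^'n. complex_of_real (bump ((1 / d) *\<^sub>R x)))"
    using smooth_bump_scaled[of "1 / d" 0] by simp
  fix x :: "real^'n" assume "d < norm x"
  then have "1 \<le> norm ((1 / d) *\<^sub>R x)"
    using assms by simp
  then show "complex_of_real (bump ((1 / d) *\<^sub>R x)) = 0"
    by (simp only: bump_eq_0_iff[symmetric] of_real_eq_0_iff)
qed

lemma mollifier_exists:
  assumes "0 < d"
  obtains \<phi> :: "real^'n \<Rightarrow> real" where "mollifier d \<phi>"
proof -
  define b where "b = (\<lambda>x::real^'n. bump ((1 / d) *\<^sub>R x))"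
  have C: "C0_inf (\<lambda>x. complex_of_real (b x))"
    unfolding b_def using assms by (rule C0_inf_bump_scaled)
  then have int: "integrable lborel b"
    using C0_inf_integrable[OF C] complex_of_real_integrable_eq by blast
  have nonneg: "0 \<le> b x" for x
    by (simp add: b_def bump_nonneg)
  have zero: "b x = 0 \<longleftrightarrow> d \<le> norm x" for x
    using assms by (simp add: b_def bump_eq_0_iff)
  have "integral\<^sup>L lborel b \<noteq> 0"
  proof
    assume "integral\<^sup>L lborel b = 0"
    \<comment> \<open>A zero integral would make the nonnegative \<open>b\<close> vanish almost
      everywhere, but \<open>b\<close> is positive on a nonempty open ball, which is not
      negligible.\<close>
    then have "AE x in lborel. b x = 0"
      using int nonneg by (subst (asm) integral_nonneg_eq_0_iff_AE) auto
    then have "AE x in lborel. x \<notin> ball (0::real^'n) d"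
      by eventually_elim (simp add: zero)
    then have "ball (0::real^'n) d \<in> null_sets lborel"
      by (subst AE_iff_null_sets) auto
    then have "negligible (ball (0::real^'n) d)"
      by (simp add: negligible_iff_null_sets null_sets_completionI)
    moreover have "ball (0::real^'n) d \<noteq> {}"
      using assms by simp
    ultimately show False
      using open_not_negligible open_ball by blast
  qed
  moreover have "0 \<le> integral\<^sup>L lborel b"
    using nonneg by simp
  ultimately have pos: "0 < integral\<^sup>L lborel b" by simp
  define \<phi> where "\<phi> x = inverse (integral\<^sup>L lborel b) * b x" for x
  have "C0_inf (cplx \<phi>)"
    using C0_inf_mult_smooth[OF C smooth_fun_const[of "complex_of_real (inverse (integral\<^sup>L lborel b))"]]
    by (simp add: \<phi>_def mult.commute)
  moreover have "\<phi> (- x) = \<phi> x" for x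
    using bump_uminus[of "(1 / d) *\<^sub>R x"] by (simp add: \<phi>_def b_def)
  moreover have "integral\<^sup>L lborel \<phi> = 1"
    unfolding \<phi>_def[abs_def] using pos by simp
  moreover have "0 \<le> \<phi> x" "d < norm x \<Longrightarrow> \<phi> x = 0" for x
    using pos nonneg zero[of x] by (auto simp: \<phi>_def)
  ultimately have "mollifier d \<phi>"
    unfolding mollifier_def by blast
  then show ?thesis by (rule that)
qed

lemma mollifier_C0_inf: "mollifier d \<phi> \<Longrightarrow> C0_inf (cplx \<phi>)"
  by (simp add: mollifier_def)

lemma mollifier_nonneg: "mollifier d \<phi> \<Longrightarrow> 0 \<le> \<phi> x"
  by (simp add: mollifier_def)

lemma mollifier_even: "mollifier d \<phi> \<Longrightarrow> \<phi> (- x) = \<phi> x"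
  by (simp add: mollifier_def)

lemma mollifier_integrable:
  assumes "mollifier d \<phi>" shows "integrable lborel \<phi>"
  using C0_inf_integrable[OF mollifier_C0_inf[OF assms]] complex_of_real_integrable_eq by blast

lemma mollifier_borel:
  assumes "mollifier d \<phi>" shows "\<phi> \<in> borel_measurable borel"
  using borel_measurable_integrable[OF mollifier_integrable[OF assms]] by simp

lemma mollifier_nn_integral:
  assumes "mollifier d \<phi>" shows "(\<integral>\<^sup>+x. ennreal (\<phi> x) \<partial>lborel) = 1"
  using nn_integral_eq_integral[OF mollifier_integrable[OF assms]] assms by (simp add: mollifier_def)

lemma mollifier_bounded:
  assumes "mollifier d \<phi>"
  obtains B where "\<And>x. norm (complex_of_real (\<phi> x)) \<le> B"
proof (rule bounded_smooth_bounds[OF C0_inf_bounded_smooth[OF mollifier_C0_inf[OF assms]]])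
  fix B assume "\<And>x. norm (complex_of_real (\<phi> x)) \<le> B"
  then show thesis by (rule that)
qed

section \<open>Averages of translates and Jensen's inequality\<close>

lemma conv_even:
  fixes g k :: "real^'n \<Rightarrow> complex"
  assumes [measurable]: "g \<in> borel_measurable borel" "k \<in> borel_measurable borel"
    and "\<And>x. k (- x) = k x"
  shows "conv g k y = (\<integral>z. g (y + z) * k z \<partial>lborel)"
proof -
  \<comment> \<open>Shifting by \<open>y\<close> turns the kernel into \<open>k (- z)\<close>, and
    evenness leaves an average of the translates \<open>g (y + z)\<close>. Jensen's inequality and
    continuity of translations apply in this form.\<close>
  have "conv g k y = (\<integral>z. g (z + y) * k (y - (z + y)) \<partial>lborel)"
    unfolding conv_def by (rule integral_lborel_translate[symmetric]) simp
  then show ?thesis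
    using assms(3) by (simp add: add.commute)
qed

text \<open>With \<open>a\<close> the mean of \<open>norm (F z)\<close> under the density, Young's
  inequality for \<open>norm (F z)\<close> and \<open>a powr (r - 1)\<close> is integrated; it is
  sharp for constant \<open>norm (F z)\<close>, so the power of the mean comes out with constant
  1.\<close>

lemma jensen_powr:
  fixes F :: "'a \<Rightarrow> complex" and \<phi> :: "'a \<Rightarrow> real"
  assumes [measurable]: "F \<in> borel_measurable M" and \<phi>: "integrable M \<phi>" "\<And>x. 0 \<le> \<phi> x"
    "integral\<^sup>L M \<phi> = 1" and r: "1 \<le> r"
  shows "ennreal (norm (\<integral>z. F z * of_real (\<phi> z) \<partial>M) powr r) \<le> (\<integral>\<^sup>+z. ennreal (norm (F z) powr r * \<phi> z) \<partial>M)"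
proof (cases "integrable M (\<lambda>z. F z * of_real (\<phi> z)) \<and> (\<integral>\<^sup>+z. ennreal (norm (F z) powr r * \<phi> z) \<partial>M) < \<infinity>")
  case False
  \<comment> \<open>A nonintegrable integrand has Bochner integral 0 by convention, and an infinite
    right-hand side bounds everything.\<close>
  then show ?thesis
    by (auto simp: not_integrable_integral_eq less_top[symmetric])
next
  case True
  have [measurable]: "\<phi> \<in> borel_measurable M"
    using \<phi> by auto
  have i1: "integrable M (\<lambda>z. norm (F z) * \<phi> z)"
    using True \<phi> integrable_norm[of M "\<lambda>z. F z * of_real (\<phi> z)"] by (simp add: norm_mult)
  have i2: "integrable M (\<lambda>z. norm (F z) powr r * \<phi> z)"
    using True \<phi> by (intro integrableI_bounded) auto
  define a where "a = (\<integral>z. norm (F z) * \<phi> z \<partial>M)"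
  have a0: "0 \<le> a" unfolding a_def using \<phi> by (intro integral_nonneg_AE) auto
  have "norm (\<integral>z. F z * of_real (\<phi> z) \<partial>M) \<le> (\<integral>z. norm (F z * of_real (\<phi> z)) \<partial>M)"
    by simp
  also have "\<dots> = a"
    using \<phi> by (simp add: norm_mult a_def)
  finally have 1: "norm (\<integral>z. F z * of_real (\<phi> z) \<partial>M) powr r \<le> a powr r"
    using r by (intro powr_mono2) auto
  have "a powr r \<le> (\<integral>z. norm (F z) powr r * \<phi> z \<partial>M)"
  proof (cases "r = 1")
    case True
    then show ?thesis using a0 by (simp add: a_def)
  next
    case False
    \<comment> \<open>The conjugate exponent, for which \<open>a powr (r - 1)\<close> raised to
      \<open>q\<close> is \<open>a powr r\<close>; the resulting term \<open>a powr r / q\<close> is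
      then absorbed on the left.\<close>
    define q where "q = r / (r - 1)"
    have r1: "1 < r" using False r by simp
    have q: "1 < q" "1 / r + 1 / q = 1"
      using r1 by (auto simp: q_def field_simps)
    have aq: "(a powr (r - 1)) powr q = a powr r"
      using r1 by (simp add: powr_powr q_def)
    have "(\<integral>z. a powr (r - 1) * (norm (F z) * \<phi> z) \<partial>M) \<le> (\<integral>z. (1 / r) * (norm (F z) powr r * \<phi> z) + (a powr r / q) * \<phi> z \<partial>M)"
    proof (rule integral_mono)
      fix z
      have "norm (F z) * a powr (r - 1) \<le> norm (F z) powr r / r + a powr r / q"
        using Youngs_inequality[OF r1 q, of "norm (F z)" "a powr (r - 1)"] aq by simp
      then have "norm (F z) * a powr (r - 1) * \<phi> z \<le> (norm (F z) powr r / r + a powr r / q) * \<phi> z"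
        using \<phi> by (intro mult_right_mono)
      then show "a powr (r - 1) * (norm (F z) * \<phi> z) \<le> (1 / r) * (norm (F z) powr r * \<phi> z) + (a powr r / q) * \<phi> z"
        by (simp add: algebra_simps)
    qed (use i1 i2 \<phi> in auto)
    also have "\<dots> = (1 / r) * (\<integral>z. norm (F z) powr r * \<phi> z \<partial>M) + (a powr r / q)"
      using i2 \<phi> by simp
    also have "(\<integral>z. a powr (r - 1) * (norm (F z) * \<phi> z) \<partial>M) = a powr (r - 1) * a"
      by (simp add: a_def)
    also have "a powr (r - 1) * a = a powr r"
      using a0 r1 by (cases "a = 0") (auto simp: powr_diff)
    also have "a powr r / q = a powr r - a powr r / r"
      using q r1 by (simp add: q_def field_simps)
    finally have "a powr r / r \<le> (\<integral>z. norm (F z) powr r * \<phi> z \<partial>M) / r"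
      by simp
    then show ?thesis using r1 by (simp add: divide_le_cancel)
  qed
  with 1 have "norm (\<integral>z. F z * of_real (\<phi> z) \<partial>M) powr r \<le> (\<integral>z. norm (F z) powr r * \<phi> z \<partial>M)"
    by simp
  then show ?thesis
    using i2 \<phi> by (subst nn_integral_eq_integral) (auto intro: ennreal_leI)
qed

lemma norm_powr_le_one_plus:
  assumes "1 \<le> r" "0 \<le> (t::real)" shows "t \<le> 1 + t powr r"
proof (cases "t \<le> 1")
  case False
  then have "t powr 1 \<le> t powr r"
    using assms by (intro powr_mono) auto
  then show ?thesis using False by simp
qed (simp add: add_increasing2)

text \<open>From \<open>norm (f x) \<le> 1 + norm (f x) powr r\<close> the product is dominated by
  \<open>norm (u x) + B * norm (f x) powr r\<close>. The argument includes \<open>r = 1\<close>,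
  where there is no finite conjugate exponent.\<close>

lemma Lp_int_mult_integrable:
  fixes f u :: "real^'n \<Rightarrow> complex"
  assumes [measurable]: "f \<in> borel_measurable borel" and f: "Lp_int r f < \<infinity>" "1 \<le> r"
    and u: "integrable lborel u" "\<And>x. norm (u x) \<le> B"
  shows "integrable lborel (\<lambda>x. f x * u x)"
proof -
  have "integrable lborel (\<lambda>x. norm (f x) powr r)"
    using f by (intro integrableI_bounded) (auto simp: Lp_int_def)
  then have "integrable lborel (\<lambda>x. norm (u x) + B * (norm (f x) powr r))"
    using u by auto
  then show ?thesis
  proof (rule Bochner_Integration.integrable_bound)
    show "(\<lambda>x. f x * u x) \<in> borel_measurable lborel"
      using u borel_measurable_integrable[OF u(1)] by simp
    show "AE x in lborel. norm (f x * u x) \<le> norm (norm (u x) + B * (norm (f x) powr r))"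
    proof (intro always_eventually allI)
      fix x
      have "norm (f x * u x) \<le> (1 + norm (f x) powr r) * norm (u x)"
        unfolding norm_mult using f by (intro mult_right_mono norm_powr_le_one_plus) auto
      also have "\<dots> \<le> norm (u x) + B * (norm (f x) powr r)"
        using mult_left_mono[OF u(2)[of x], of "norm (f x) powr r"] by (simp add: algebra_simps)
      also have "\<dots> \<le> norm (norm (u x) + B * (norm (f x) powr r))"
        by simp
      finally show "norm (f x * u x) \<le> norm (norm (u x) + B * (norm (f x) powr r))" .
    qed
  qed
qed

lemma Lp_int_translate:
  assumes [measurable]: "g \<in> borel_measurable borel"
  shows "Lp_int r (\<lambda>y. g (y + z)) = Lp_int r g"
  unfolding Lp_int_def by (rule nn_integral_lborel_translate) simp

text \<open>A substitute for Minkowski's integral inequality: Jensen moves the power inside the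
  average and Tonelli exchanges the integrals. The general \<open>G\<close> covers both
  \<open>g (y + z)\<close>, giving contractivity, and \<open>g (y + z) - g y\<close>, giving
  approximation.\<close>

lemma mollified_Lp_int_le:
  fixes G :: "real^'n \<Rightarrow> real^'n \<Rightarrow> complex"
  assumes [measurable]: "(\<lambda>p. G (fst p) (snd p)) \<in> borel_measurable (borel \<Otimes>\<^sub>M borel)"
    and \<phi>: "mollifier d \<phi>" and r: "1 \<le> r"
    and le: "\<And>z. norm z \<le> d \<Longrightarrow> Lp_int r (\<lambda>y. G y z) \<le> \<eta>"
  shows "Lp_int r (\<lambda>y. \<integral>z. G y z * of_real (\<phi> z) \<partial>lborel) \<le> \<eta>"
proof -
  have [measurable]: "\<phi> \<in> borel_measurable borel"
    using \<phi> by (rule mollifier_borel)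
  have "Lp_int r (\<lambda>y. \<integral>z. G y z * of_real (\<phi> z) \<partial>lborel) \<le>
    (\<integral>\<^sup>+y. \<integral>\<^sup>+z. ennreal (norm (G y z) powr r * \<phi> z) \<partial>lborel \<partial>lborel)"
    unfolding Lp_int_def
  proof (rule nn_integral_mono, rule jensen_powr)
    fix y
    have "(\<lambda>z. G (fst (y, z)) (snd (y, z))) \<in> borel_measurable borel"
      by measurable
    then show "G y \<in> borel_measurable lborel" by simp
  qed (use \<phi> r in \<open>auto simp: mollifier_integrable mollifier_def\<close>)
  also have "\<dots> = (\<integral>\<^sup>+z. \<integral>\<^sup>+y. ennreal (norm (G y z) powr r * \<phi> z) \<partial>lborel \<partial>lborel)"
  proof (rule lborel_pair.Fubini'[symmetric])
    have "(\<lambda>p. ennreal (norm (G (fst p) (snd p)) powr r * \<phi> (snd p))) \<in> borel_measurable (borel \<Otimes>\<^sub>M borel)"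
      by measurable
    then show "(\<lambda>(y, z). ennreal (norm (G y z) powr r * \<phi> z)) \<in> borel_measurable (lborel \<Otimes>\<^sub>M lborel)"
      by (simp add: case_prod_beta)
  qed
  also have "\<dots> \<le> (\<integral>\<^sup>+z. \<eta> * ennreal (\<phi> z) \<partial>lborel)"
  proof (rule nn_integral_mono)
    fix z
    have "(\<lambda>y. G (fst (y, z)) (snd (y, z))) \<in> borel_measurable borel"
      by measurable
    then have [measurable]: "(\<lambda>y. G y z) \<in> borel_measurable borel" by simp
    have "(\<integral>\<^sup>+y. ennreal (norm (G y z) powr r * \<phi> z) \<partial>lborel) = Lp_int r (\<lambda>y. G y z) * ennreal (\<phi> z)"
      unfolding Lp_int_def using mollifier_nonneg[OF \<phi>] by (simp add: ennreal_mult nn_integral_multc)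
    \<comment> \<open>The hypothesis concerns only shifts with \<open>norm z \<le> d\<close>; for
      all others \<open>\<phi> z = 0\<close>.\<close>
    also have "\<dots> \<le> \<eta> * ennreal (\<phi> z)"
      using \<phi> le[of z] by (cases "norm z \<le> d") (auto simp: mollifier_def intro: mult_right_mono)
    finally show "(\<integral>\<^sup>+y. ennreal (norm (G y z) powr r * \<phi> z) \<partial>lborel) \<le> \<eta> * ennreal (\<phi> z)" .
  qed
  also have "\<dots> = \<eta>"
    using mollifier_nn_integral[OF \<phi>] by (simp add: nn_integral_cmult)
  finally show ?thesis .
qed

lemma conv_mollifier:
  fixes g :: "real^'n \<Rightarrow> complex"
  assumes "g \<in> borel_measurable borel" "mollifier d \<phi>"
  shows "conv g (cplx \<phi>) y = (\<integral>z. g (y + z) * of_real (\<phi> z) \<partial>lborel)"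
  using assms mollifier_borel[OF assms(2)] by (intro conv_even) (auto simp: mollifier_even)

lemma conv_Lp_int_le:
  fixes g :: "real^'n \<Rightarrow> complex"
  assumes [measurable]: "g \<in> borel_measurable borel" and "mollifier d \<phi>" "1 \<le> r"
  shows "Lp_int r (conv g (cplx \<phi>)) \<le> Lp_int r g"
  unfolding conv_mollifier[OF assms(1,2), abs_def]
  by (rule mollified_Lp_int_le[OF _ assms(2,3)]) (auto simp: Lp_int_translate)

text \<open>Because \<open>\<phi>\<close> has integral 1, \<open>g y\<close> is itself an average of
  the constant \<open>g y\<close>; the two averages may be subtracted since both integrands are
  integrable.\<close>

lemma conv_mollifier_diff:
  fixes g :: "real^'n \<Rightarrow> complex"
  assumes [measurable]: "g \<in> borel_measurable borel" and "Lp_int r g < \<infinity>" "1 \<le> r" and \<phi>: "mollifier d \<phi>"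
  shows "conv g (cplx \<phi>) y - g y = (\<integral>z. (g (y + z) - g y) * of_real (\<phi> z) \<partial>lborel)"
proof -
  obtain B where B: "\<And>x. norm (complex_of_real (\<phi> x)) \<le> B"
    using mollifier_bounded[OF \<phi>] by blast
  have "Lp_int r (\<lambda>z. g (y + z)) < \<infinity>"
    using assms Lp_int_translate[of g r y] by (simp add: add.commute)
  then have "integrable lborel (\<lambda>z. g (y + z) * of_real (\<phi> z))"
    using assms mollifier_integrable[OF \<phi>] B by (intro Lp_int_mult_integrable[where r = r]) auto
  moreover have "integrable lborel (\<lambda>z. g y * of_real (\<phi> z))"
    using mollifier_integrable[OF \<phi>] by auto
  moreover have "(\<integral>z. g y * of_real (\<phi> z) \<partial>lborel) = g y"
    using \<phi> by (simp add: mollifier_def)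
  ultimately show ?thesis
    by (simp add: conv_mollifier[OF assms(1) \<phi>] left_diff_distrib)
qed

section \<open>Approximation in the mean\<close>

lemma powr_add_le:
  assumes "0 \<le> r" "0 \<le> (a::real)" "0 \<le> b"
  shows "(a + b) powr r \<le> 2 powr r * (a powr r + b powr r)"
proof -
  have "(a + b) powr r \<le> (2 * max a b) powr r"
    using assms by (intro powr_mono2) auto
  also have "\<dots> = 2 powr r * (max a b) powr r"
    using assms by (intro powr_mult)
  also have "\<dots> \<le> 2 powr r * (a powr r + b powr r)"
    using assms by (intro mult_left_mono) (auto simp: max_def)
  finally show ?thesis .
qed

lemma Lp_int_triangle:
  fixes f g h :: "real^'n \<Rightarrow> complex"
  assumes [measurable]: "f \<in> borel_measurable lborel" "g \<in> borel_measurable lborel"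
    and r: "0 \<le> r" and le: "\<And>x. norm (h x) \<le> norm (f x) + norm (g x)"
  shows "Lp_int r h \<le> ennreal (2 powr r) * (Lp_int r f + Lp_int r g)"
proof -
  have "Lp_int r h \<le> (\<integral>\<^sup>+x. ennreal (2 powr r) * (ennreal (norm (f x) powr r) + ennreal (norm (g x) powr r)) \<partial>lborel)"
    unfolding Lp_int_def
  proof (rule nn_integral_mono)
    fix x
    have "norm (h x) powr r \<le> (norm (f x) + norm (g x)) powr r"
      using r le by (intro powr_mono2) auto
    also have "\<dots> \<le> 2 powr r * (norm (f x) powr r + norm (g x) powr r)"
      using r by (intro powr_add_le) auto
    finally show "ennreal (norm (h x) powr r) \<le> ennreal (2 powr r) * (ennreal (norm (f x) powr r) + ennreal (norm (g x) powr r))"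
      by (subst ennreal_plus[symmetric], simp, simp, subst ennreal_mult[symmetric]) (auto intro: ennreal_leI)
  qed
  also have "\<dots> = ennreal (2 powr r) * (Lp_int r f + Lp_int r g)"
    unfolding Lp_int_def by (simp add: nn_integral_cmult nn_integral_add)
  finally show ?thesis .
qed

lemma Lp_int_mono:
  assumes "0 \<le> r" "\<And>x. norm (f x) \<le> norm (g x)"
  shows "Lp_int r f \<le> Lp_int r g"
  unfolding Lp_int_def using assms by (intro nn_integral_mono ennreal_leI powr_mono2) auto

lemma Lp_int_cmult:
  fixes f :: "real^'n \<Rightarrow> complex"
  assumes [measurable]: "f \<in> borel_measurable lborel" and "0 \<le> c" "\<And>x. norm (h x) \<le> c * norm (f x)" "0 \<le> r"
  shows "Lp_int r h \<le> ennreal (c powr r) * Lp_int r f"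
proof -
  have "Lp_int r h \<le> (\<integral>\<^sup>+x. ennreal (c powr r) * ennreal (norm (f x) powr r) \<partial>lborel)"
    unfolding Lp_int_def
  proof (rule nn_integral_mono)
    fix x
    have "norm (h x) powr r \<le> (c * norm (f x)) powr r"
      using assms by (intro powr_mono2) auto
    then show "ennreal (norm (h x) powr r) \<le> ennreal (c powr r) * ennreal (norm (f x) powr r)"
      using assms by (simp add: powr_mult ennreal_mult[symmetric] ennreal_leI)
  qed
  then show ?thesis
    unfolding Lp_int_def by (simp add: nn_integral_cmult)
qed

lemma Lp_int_dominated:
  fixes f :: "real^'n \<Rightarrow> complex" and s :: "nat \<Rightarrow> real^'n \<Rightarrow> complex"
  assumes [measurable]: "f \<in> borel_measurable lborel" "\<And>n. s n \<in> borel_measurable lborel"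
    and f: "Lp_int r f < \<infinity>" and r: "0 < r"
    and le: "\<And>n x. norm (s n x) \<le> norm (f x)"
    and lim: "\<And>x. (\<lambda>n. s n x) \<longlonglongrightarrow> 0"
  shows "(\<lambda>n. Lp_int r (s n)) \<longlonglongrightarrow> 0"
proof -
  have "(\<lambda>n. \<integral>\<^sup>+x. ennreal (norm (s n x) powr r) \<partial>lborel) \<longlonglongrightarrow> (\<integral>\<^sup>+x. 0 \<partial>(lborel :: (real^'n) measure))"
  proof (rule nn_integral_dominated_convergence[where w = "\<lambda>x. ennreal (norm (f x) powr r)"])
    show "AE x in lborel. ennreal (norm (s n x) powr r) \<le> ennreal (norm (f x) powr r)" for n
      using le r by (intro always_eventually allI ennreal_leI powr_mono2) auto
    show "AE x in lborel. (\<lambda>n. ennreal (norm (s n x) powr r)) \<longlonglongrightarrow> 0"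
    proof (intro always_eventually allI)
      fix x
      have "(\<lambda>n. norm (s n x) powr r) \<longlonglongrightarrow> 0 powr r"
        using lim[of x] r by (intro tendsto_powr2 tendsto_norm_zero tendsto_const) auto
      then show "(\<lambda>n. ennreal (norm (s n x) powr r)) \<longlonglongrightarrow> 0"
        using tendsto_ennrealI by fastforce
    qed
    show "(\<integral>\<^sup>+x. ennreal (norm (f x) powr r) \<partial>lborel) < \<infinity>"
      using f by (simp add: Lp_int_def)
  qed auto
  then show ?thesis by (simp add: Lp_int_def)
qed

section \<open>Continuity of translations, from open sets to \<open>L^r\<close>\<close>

lemma tendsto_0_ex_less:
  assumes "(s :: nat \<Rightarrow> ennreal) \<longlonglongrightarrow> 0" "0 < \<eta>"
  obtains n where "s n < \<eta>"
  using order_tendstoD(2)[OF assms] by (auto simp: eventually_sequentially)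

text \<open>If the claim failed, some sequence of shifts tending to 0 would keep the measure above
  \<open>\<eta>\<close>. But each point of an open \<open>U\<close> eventually stays in
  \<open>U\<close> under these shifts, and dominated convergence with majorant
  \<open>indicator U\<close> forces the measures to 0.\<close>

lemma open_translate_tendsto:
  fixes U :: "(real^'n) set"
  assumes U: "open U" "emeasure lborel U < \<infinity>" and \<eta>: "0 < (\<eta>::ennreal)"
  shows "\<exists>d>0. \<forall>z. norm z \<le> d \<longrightarrow> emeasure lborel {y \<in> U. y + z \<notin> U} \<le> \<eta>"
proof (rule ccontr)
  assume neg: "\<not> ?thesis"
  have "\<exists>z. norm z \<le> inverse (real (Suc n)) \<and> \<not> emeasure lborel {y \<in> U. y + z \<notin> U} \<le> \<eta>" for n
  proof -
    have "0 < inverse (real (Suc n))" by simp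
    with neg show ?thesis by blast
  qed
  then have "\<forall>n. \<exists>z. norm z \<le> inverse (real (Suc n)) \<and> \<not> emeasure lborel {y \<in> U. y + z \<notin> U} \<le> \<eta>"
    by (rule allI)
  from choice[OF this] obtain z where
    z': "\<forall>n. norm (z n) \<le> inverse (real (Suc n)) \<and> \<not> emeasure lborel {y \<in> U. y + z n \<notin> U} \<le> \<eta>" ..
  have z: "norm (z n) \<le> inverse (real (Suc n))" "\<not> emeasure lborel {y \<in> U. y + z n \<notin> U} \<le> \<eta>" for n
    using z'[rule_format, of n] by simp_all
  have z0: "z \<longlonglongrightarrow> 0"
    using z(1) LIMSEQ_inverse_real_of_nat by (intro Lim_null_comparison[OF _ LIMSEQ_inverse_real_of_nat]) auto
  have [measurable]: "U \<in> sets borel" using U by simp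
  have "(\<lambda>n. \<integral>\<^sup>+y. indicator {y \<in> U. y + z n \<notin> U} y \<partial>lborel) \<longlonglongrightarrow> (\<integral>\<^sup>+y. 0 \<partial>(lborel :: (real^'n) measure))"
  proof (rule nn_integral_dominated_convergence[where w = "indicator U"])
    show "AE x in lborel. (\<lambda>n. indicator {y \<in> U. y + z n \<notin> U} x :: ennreal) \<longlonglongrightarrow> 0"
    proof (intro always_eventually allI)
      fix x
      show "(\<lambda>n. indicator {y \<in> U. y + z n \<notin> U} x :: ennreal) \<longlonglongrightarrow> 0"
      proof (cases "x \<in> U")
        case True
        have "(\<lambda>n. x + z n) \<longlonglongrightarrow> x + 0"
          by (intro tendsto_intros z0)
        then have "eventually (\<lambda>n. x + z n \<in> U) sequentially"
          using True U(1) by (intro topological_tendstoD) auto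
        then show ?thesis
          by (intro tendsto_eventually) (auto elim: eventually_mono)
      qed simp
    qed
    show "AE x in lborel. indicator {y \<in> U. y + z n \<notin> U} x \<le> (indicator U x :: ennreal)" for n
      by (auto split: split_indicator)
    show "(\<integral>\<^sup>+x. indicator U x \<partial>lborel) < \<infinity>"
      using U by simp
  qed auto
  then have lim: "(\<lambda>n. \<integral>\<^sup>+y. indicator {y \<in> U. y + z n \<notin> U} y \<partial>lborel) \<longlonglongrightarrow> 0"
    by simp
  obtain n where "(\<integral>\<^sup>+y. indicator {y \<in> U. y + z n \<notin> U} y \<partial>lborel) < \<eta>"
    using tendsto_0_ex_less[OF lim \<eta>] .
  then show False
    using z(2)[of n] by simp
qed

lemma indicator_translate_continuous:
  fixes A :: "(real^'n) set"
  assumes A: "A \<in> sets borel" "emeasure lborel A < \<infinity>" and \<eta>: "0 < (\<eta>::real)"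
  shows "\<exists>d>0. \<forall>z. norm z \<le> d \<longrightarrow>
    (\<integral>\<^sup>+y. ennreal \<bar>indicator A (y + z) - indicator A y\<bar> \<partial>lborel) \<le> ennreal \<eta>"
proof -
  obtain U where U: "open U" "A \<subseteq> U" "emeasure lebesgue (U - A) < ennreal (\<eta> / 4)"
    using sets_lebesgue_outer_open[of A "\<eta> / 4"] A \<eta> by auto
  have [measurable]: "U \<in> sets borel" "A \<in> sets borel" using U A by auto
  have UA: "emeasure lborel (U - A) < ennreal (\<eta> / 4)"
    using U by simp
  have "emeasure lborel U \<le> emeasure lborel A + emeasure lborel (U - A)"
    by (rule order_trans[OF emeasure_mono emeasure_subadditive]) auto
  also have "\<dots> < \<infinity>"
    using A order.strict_trans[OF UA ennreal_less_top] by simp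
  finally have "emeasure lborel U < \<infinity>" .
  then obtain d where d: "d > 0" "\<And>z. norm z \<le> d \<Longrightarrow> emeasure lborel {y \<in> U. y + z \<notin> U} \<le> ennreal (\<eta> / 4)"
    using open_translate_tendsto[OF U(1), of "ennreal (\<eta> / 4)"] \<eta> by auto
  show ?thesis
  proof (intro exI conjI allI impI)
    fix z :: "real^'n" assume z: "norm z \<le> d"
    have [measurable]: "{y \<in> U. y + z \<notin> U} \<in> sets borel" for z
      by measurable
    \<comment> \<open>If exactly one of \<open>y\<close> and \<open>y + z\<close> lies in
      \<open>A\<close>, then one of four things happens: \<open>y + z\<close> or \<open>y\<close>
      lies in \<open>U - A\<close>, the shift leaves \<open>U\<close>, or it enters
      \<open>U\<close>. Entering is leaving under \<open>- z\<close>, read at the point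
      \<open>y + z\<close>. Each event costs at most \<open>\<eta> / 4\<close>.\<close>
    let ?N = "\<lambda>S. \<integral>\<^sup>+y. indicator S y \<partial>(lborel :: (real^'n) measure)"
    have "(\<integral>\<^sup>+y. ennreal \<bar>indicator A (y + z) - indicator A y\<bar> \<partial>lborel) \<le>
      (\<integral>\<^sup>+y. indicator (U - A) (y + z) + indicator {y \<in> U. y + z \<notin> U} y
         + indicator {y \<in> U. y + - z \<notin> U} (y + z) + indicator (U - A) y \<partial>lborel)"
      using U(2) by (intro nn_integral_mono) (auto split: split_indicator)
    also have "\<dots> = (\<integral>\<^sup>+y. indicator (U - A) (y + z) \<partial>lborel) + ?N {y \<in> U. y + z \<notin> U}
         + (\<integral>\<^sup>+y. indicator {y \<in> U. y + - z \<notin> U} (y + z) \<partial>lborel) + ?N (U - A)"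
      by (simp add: nn_integral_add del: nn_integral_indicator)
    also have "\<dots> = ?N (U - A) + ?N {y \<in> U. y + z \<notin> U} + ?N {y \<in> U. y + - z \<notin> U} + ?N (U - A)"
      using nn_integral_lborel_translate[of "indicator (U - A)" z]
        nn_integral_lborel_translate[of "indicator {y \<in> U. y + - z \<notin> U}" z] by simp
    also have "\<dots> \<le> ennreal (\<eta> / 4) + ennreal (\<eta> / 4) + ennreal (\<eta> / 4) + ennreal (\<eta> / 4)"
      using UA d(2)[of z] d(2)[of "- z"] z by (intro add_mono) auto
    also have "\<dots> = ennreal \<eta>"
      using \<eta> by (simp add: ennreal_plus[symmetric] del: ennreal_plus)
    finally show "(\<integral>\<^sup>+y. ennreal \<bar>indicator A (y + z) - indicator A y\<bar> \<partial>lborel) \<le> ennreal \<eta>" .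
  qed (rule d)
qed

lemma L1_translate_continuous:
  fixes f :: "real^'n \<Rightarrow> complex"
  assumes "integrable lborel f" "0 < (\<eta>::real)"
  shows "\<exists>d>0. \<forall>z. norm z \<le> d \<longrightarrow> (\<integral>\<^sup>+y. ennreal (norm (f (y + z) - f y)) \<partial>lborel) \<le> ennreal \<eta>"
  using assms
proof (induction f arbitrary: \<eta> rule: integrable_induct)
  case (base A c)
  have [measurable]: "A \<in> sets borel" using base by simp
  \<comment> \<open>The summand 1 keeps the denominator positive when \<open>c = 0\<close>.\<close>
  have "0 < \<eta> / (norm c + 1)"
    using base by (simp add: add_nonneg_pos)
  then obtain d where d: "d > 0" "\<And>z. norm z \<le> d \<Longrightarrow>
    (\<integral>\<^sup>+y. ennreal \<bar>indicator A (y + z) - indicator A y\<bar> \<partial>lborel) \<le> ennreal (\<eta> / (norm c + 1))"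
    using indicator_translate_continuous[of A "\<eta> / (norm c + 1)"] base by auto
  show ?case
  proof (intro exI conjI allI impI)
    fix z :: "real^'n" assume z: "norm z \<le> d"
    have "norm (indicator A (y + z) *\<^sub>R c - indicator A y *\<^sub>R c) \<le> (norm c + 1) * \<bar>indicator A (y + z) - indicator A y\<bar>" for y
      by (auto split: split_indicator)
    then have "(\<integral>\<^sup>+y. ennreal (norm (indicator A (y + z) *\<^sub>R c - indicator A y *\<^sub>R c)) \<partial>lborel) \<le>
      (\<integral>\<^sup>+y. ennreal (norm c + 1) * ennreal \<bar>indicator A (y + z) - indicator A y\<bar> \<partial>lborel)"
      by (intro nn_integral_mono) (simp add: ennreal_mult[symmetric] ennreal_leI del: ennreal_plus)
    also have "\<dots> = ennreal (norm c + 1) * (\<integral>\<^sup>+y. ennreal \<bar>indicator A (y + z) - indicator A y\<bar> \<partial>lborel)"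
      by (rule nn_integral_cmult) simp
    also have "\<dots> \<le> ennreal (norm c + 1) * ennreal (\<eta> / (norm c + 1))"
      using d z by (intro mult_left_mono) auto
    also have "\<dots> = ennreal \<eta>"
      using base by (simp add: ennreal_mult[symmetric] add_nonneg_eq_0_iff del: ennreal_plus)
    finally show "(\<integral>\<^sup>+y. ennreal (norm (indicator A (y + z) *\<^sub>R c - indicator A y *\<^sub>R c)) \<partial>lborel) \<le> ennreal \<eta>" .
  qed (rule d)
next
  case (add f g)
  have [measurable]: "f \<in> borel_measurable borel" "g \<in> borel_measurable borel"
    using add.hyps borel_measurable_integrable by fastforce+
  obtain d where d: "d > 0" "\<And>z. norm z \<le> d \<Longrightarrow> (\<integral>\<^sup>+y. ennreal (norm (f (y + z) - f y)) \<partial>lborel) \<le> ennreal (\<eta> / 2)"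
    using add.IH(1)[of "\<eta> / 2"] add.prems by auto
  obtain e where e: "e > 0" "\<And>z. norm z \<le> e \<Longrightarrow> (\<integral>\<^sup>+y. ennreal (norm (g (y + z) - g y)) \<partial>lborel) \<le> ennreal (\<eta> / 2)"
    using add.IH(2)[of "\<eta> / 2"] add.prems by auto
  show ?case
  proof (intro exI[of _ "min d e"] conjI allI impI)
    fix z :: "real^'n" assume z: "norm z \<le> min d e"
    have "norm (f (y + z) + g (y + z) - (f y + g y)) \<le> norm (f (y + z) - f y) + norm (g (y + z) - g y)" for y
      by (rule order_trans[OF eq_refl norm_triangle_ineq]) (simp add: algebra_simps)
    then have "(\<integral>\<^sup>+y. ennreal (norm (f (y + z) + g (y + z) - (f y + g y))) \<partial>lborel) \<le>
        (\<integral>\<^sup>+y. ennreal (norm (f (y + z) - f y)) + ennreal (norm (g (y + z) - g y)) \<partial>lborel)"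
      by (intro nn_integral_mono) (simp add: ennreal_plus[symmetric] ennreal_leI del: ennreal_plus)
    also have "\<dots> = (\<integral>\<^sup>+y. ennreal (norm (f (y + z) - f y)) \<partial>lborel) + (\<integral>\<^sup>+y. ennreal (norm (g (y + z) - g y)) \<partial>lborel)"
      by (rule nn_integral_add) auto
    also have "\<dots> \<le> ennreal (\<eta> / 2) + ennreal (\<eta> / 2)"
      using d e z by (intro add_mono) auto
    also have "\<dots> = ennreal \<eta>"
      using add.prems by (simp add: ennreal_plus[symmetric] del: ennreal_plus)
    finally show "(\<integral>\<^sup>+y. ennreal (norm (f (y + z) + g (y + z) - (f y + g y))) \<partial>lborel) \<le> ennreal \<eta>" .
  qed (use d e in auto)
next
  case (lim f s)
  have [measurable]: "f \<in> borel_measurable borel" "s i \<in> borel_measurable borel" for i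
    using lim.hyps borel_measurable_integrable by fastforce+
  have conv: "(\<lambda>i. \<integral>\<^sup>+x. ennreal (norm (f x - s i x)) \<partial>lborel) \<longlonglongrightarrow> 0"
  proof (rule tendsto_eq_rhs)
    show "(\<lambda>i. \<integral>\<^sup>+x. ennreal (norm (f x - s i x)) \<partial>lborel) \<longlonglongrightarrow> (\<integral>\<^sup>+x. 0 \<partial>(lborel :: (real^'n) measure))"
    \<comment> \<open>The induction rule supplies approximants with
      \<open>norm (s i x) \<le> 2 * norm (f x)\<close>, so differences are bounded with the constant
      3.\<close>
    proof (rule nn_integral_dominated_convergence[where w = "\<lambda>x. ennreal (3 * norm (f x))"])
      have "integrable lborel (\<lambda>x. 3 * norm (f x))"
        using lim.hyps by simp
      then have "(\<integral>\<^sup>+x. ennreal (norm (3 * norm (f x))) \<partial>lborel) < \<infinity>"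
        unfolding integrable_iff_bounded by (rule conjunct2)
      then show "(\<integral>\<^sup>+x. ennreal (3 * norm (f x)) \<partial>lborel) < \<infinity>"
        by (simp only: abs_mult abs_norm_cancel real_norm_def abs_numeral)
      show "AE x in lborel. ennreal (norm (f x - s i x)) \<le> ennreal (3 * norm (f x))" for i
      proof (intro always_eventually allI ennreal_leI)
        fix x show "norm (f x - s i x) \<le> 3 * norm (f x)"
          using lim.hyps(3)[of x i] norm_triangle_ineq4[of "f x" "s i x"] by simp
      qed
      show "AE x in lborel. (\<lambda>i. ennreal (norm (f x - s i x))) \<longlonglongrightarrow> 0"
      proof (intro always_eventually allI)
        fix x
        have "(\<lambda>i. norm (f x - s i x)) \<longlonglongrightarrow> norm (f x - f x)"
          using lim.hyps(2)[of x] by (intro tendsto_intros) simp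
        then show "(\<lambda>i. ennreal (norm (f x - s i x))) \<longlonglongrightarrow> 0"
          using tendsto_ennrealI by fastforce
      qed
    qed auto
  qed simp
  have "0 < ennreal (\<eta> / 3)"
    using lim.prems by simp
  from tendsto_0_ex_less[OF conv this]
  obtain i where i: "(\<integral>\<^sup>+x. ennreal (norm (f x - s i x)) \<partial>lborel) < ennreal (\<eta> / 3)" .
  obtain d where d: "d > 0" "\<And>z. norm z \<le> d \<Longrightarrow> (\<integral>\<^sup>+y. ennreal (norm (s i (y + z) - s i y)) \<partial>lborel) \<le> ennreal (\<eta> / 3)"
    using lim.IH[of "\<eta> / 3" i] lim.prems by auto
  show ?case
  proof (intro exI conjI allI impI)
    fix z :: "real^'n" assume z: "norm z \<le> d"
    have "norm (f (y + z) - f y) \<le> norm (f (y + z) - s i (y + z)) + norm (s i (y + z) - s i y) + norm (f y - s i y)" for y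
      using norm_triangle_ineq4[of "(f (y + z) - s i (y + z)) + (s i (y + z) - s i y)" "f y - s i y"]
        norm_triangle_ineq[of "f (y + z) - s i (y + z)" "s i (y + z) - s i y"] by simp
    then have "(\<integral>\<^sup>+y. ennreal (norm (f (y + z) - f y)) \<partial>lborel) \<le>
      (\<integral>\<^sup>+y. ennreal (norm (f (y + z) - s i (y + z))) + ennreal (norm (s i (y + z) - s i y)) + ennreal (norm (f y - s i y)) \<partial>lborel)"
      by (intro nn_integral_mono) (simp add: ennreal_plus[symmetric] ennreal_leI del: ennreal_plus)
    also have "\<dots> = (\<integral>\<^sup>+y. ennreal (norm (f (y + z) - s i (y + z))) \<partial>lborel) +
        (\<integral>\<^sup>+y. ennreal (norm (s i (y + z) - s i y)) \<partial>lborel) + (\<integral>\<^sup>+y. ennreal (norm (f y - s i y)) \<partial>lborel)"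
      by (simp add: nn_integral_add)
    also have "(\<integral>\<^sup>+y. ennreal (norm (f (y + z) - s i (y + z))) \<partial>lborel) = (\<integral>\<^sup>+y. ennreal (norm (f y - s i y)) \<partial>lborel)"
      by (rule nn_integral_lborel_translate) simp
    also have "(\<integral>\<^sup>+y. ennreal (norm (f y - s i y)) \<partial>lborel) + (\<integral>\<^sup>+y. ennreal (norm (s i (y + z) - s i y)) \<partial>lborel)
        + (\<integral>\<^sup>+y. ennreal (norm (f y - s i y)) \<partial>lborel) \<le> ennreal (\<eta> / 3) + ennreal (\<eta> / 3) + ennreal (\<eta> / 3)"
      using i d z by (intro add_mono) auto
    also have "\<dots> = ennreal \<eta>"
      using lim.prems by (simp add: ennreal_plus[symmetric] del: ennreal_plus)
    finally show "(\<integral>\<^sup>+y. ennreal (norm (f (y + z) - f y)) \<partial>lborel) \<le> ennreal \<eta>" .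
  qed (rule d)
qed

text \<open>Since \<open>1 - r \<le> 0\<close>, the power \<open>t powr (1 - r)\<close> is at most
  its value at the lower threshold \<open>m\<close>. Hence a function in \<open>L^r\<close> becomes
  integrable once its small values are removed.\<close>

lemma truncation_powr_le:
  assumes "0 < m" "1 \<le> r" "m \<le> t" shows "t \<le> m powr (1 - r) * (t::real) powr r"
proof -
  have "t = t powr (1 - r) * t powr r"
    using assms by (simp flip: powr_add)
  also have "\<dots> \<le> m powr (1 - r) * t powr r"
    using assms by (intro mult_right_mono powr_mono2') auto
  finally show ?thesis .
qed

text \<open>Truncating values to \<open>[1/n, n]\<close> reduces to the case of bounded integrable functions.\<close>
lemma Lp_translate_continuous:
  fixes g :: "real^'n \<Rightarrow> complex"
  assumes [measurable]: "g \<in> borel_measurable borel" and g: "Lp_int r g < \<infinity>" "1 \<le> r" and \<eta>: "0 < (\<eta>::real)"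
  shows "\<exists>d>0. \<forall>z. norm z \<le> d \<longrightarrow> Lp_int r (\<lambda>y. g (y + z) - g y) \<le> ennreal \<eta>"
proof -
  define s where "s n x = (if inverse (real (Suc n)) \<le> norm (g x) \<and> norm (g x) \<le> real (Suc n) then g x else 0)" for n x
  have [measurable]: "s n \<in> borel_measurable borel" for n
    unfolding s_def by measurable
  have lim: "(\<lambda>n. s n x) \<longlonglongrightarrow> g x" for x
  proof (cases "g x = 0")
    case False
    have "eventually (\<lambda>n. inverse (real (Suc n)) < norm (g x)) sequentially"
      using False by (intro order_tendstoD(2)[OF LIMSEQ_inverse_real_of_nat]) simp
    moreover have "eventually (\<lambda>n. norm (g x) \<le> real (Suc n)) sequentially"
      using eventually_ge_at_top[of "nat \<lceil>norm (g x)\<rceil>"] by eventually_elim linarith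
    ultimately have "eventually (\<lambda>n. s n x = g x) sequentially"
      by eventually_elim (simp add: s_def)
    then show ?thesis by (rule tendsto_eventually)
  qed (simp add: s_def)
  \<comment> \<open>The factor lost by two nested triangle inequalities over three errors, so each
    error is required to be at most \<open>\<eta> / K\<close>.\<close>
  define K where "K = 2 powr r * (1 + 2 powr r * 2)"
  have K: "0 < K" by (simp add: K_def add_pos_pos)
  have conv: "(\<lambda>n. Lp_int r (\<lambda>x. g x - s n x)) \<longlonglongrightarrow> 0"
  proof (rule Lp_int_dominated[where f = g])
    show "norm (g x - s n x) \<le> norm (g x)" for n x
      by (simp add: s_def)
    show "(\<lambda>n. g x - s n x) \<longlonglongrightarrow> 0" for x
      using tendsto_diff[OF tendsto_const lim, of "g x" x] by simp
  qed (use g in auto)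
  have "0 < ennreal (\<eta> / K)"
    using \<eta> K by simp
  from tendsto_0_ex_less[OF conv this] obtain n where n: "Lp_int r (\<lambda>x. g x - s n x) < ennreal (\<eta> / K)" .
  define N where "N = real (Suc n)"
  have N: "1 \<le> N" by (simp add: N_def)
  have sb: "norm (s n x) \<le> N" for x by (simp add: s_def N_def)
  have "integrable lborel (\<lambda>x. norm (g x) powr r)"
    using g by (intro integrableI_bounded) (auto simp: Lp_int_def)
  then have "integrable lborel (\<lambda>x. inverse N powr (1 - r) * (norm (g x) powr r))"
    by simp
  then have "integrable lborel (s n)"
  proof (rule Bochner_Integration.integrable_bound)
    show "AE x in lborel. norm (s n x) \<le> norm (inverse N powr (1 - r) * (norm (g x) powr r))"
      using truncation_powr_le[of "inverse N" r] N g by (intro always_eventually allI) (auto simp: s_def N_def)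
  qed simp
  moreover have M: "0 < (2 * N) powr (r - 1)"
    using N by simp
  ultimately obtain d where d: "d > 0" "\<And>z. norm z \<le> d \<Longrightarrow>
      (\<integral>\<^sup>+y. ennreal (norm (s n (y + z) - s n y)) \<partial>lborel) \<le> ennreal (\<eta> / K / (2 * N) powr (r - 1))"
    using L1_translate_continuous[of "s n" "\<eta> / K / (2 * N) powr (r - 1)"] \<eta> K by auto
  show ?thesis
  proof (intro exI conjI allI impI)
    fix z :: "real^'n" assume z: "norm z \<le> d"
    \<comment> \<open>For differences bounded by \<open>2 * N\<close>, all but one of the
      \<open>r\<close> powers can be replaced by that bound; this converts \<open>L^1\<close>
      smallness into \<open>L^r\<close> smallness.\<close>
    have le: "norm (s n (y + z) - s n y) powr r \<le> (2 * N) powr (r - 1) * norm (s n (y + z) - s n y)" for y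
    proof (cases "s n (y + z) - s n y = 0")
      case False
      have "norm (s n (y + z) - s n y) \<le> 2 * N"
        using norm_triangle_ineq4[of "s n (y + z)" "s n y"] sb[of "y + z"] sb[of y] by linarith
      then have "norm (s n (y + z) - s n y) powr (r - 1) \<le> (2 * N) powr (r - 1)"
        using g by (intro powr_mono2) auto
      moreover have "norm (s n (y + z) - s n y) powr r = norm (s n (y + z) - s n y) powr (r - 1) * norm (s n (y + z) - s n y)"
        using False by (simp add: powr_diff)
      ultimately show ?thesis by (simp add: mult_right_mono)
    qed simp
    have "Lp_int r (\<lambda>y. s n (y + z) - s n y) \<le> (\<integral>\<^sup>+y. ennreal ((2 * N) powr (r - 1)) * ennreal (norm (s n (y + z) - s n y)) \<partial>lborel)"
      unfolding Lp_int_def using le by (intro nn_integral_mono) (simp add: ennreal_mult[symmetric] ennreal_leI)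
    also have "\<dots> = ennreal ((2 * N) powr (r - 1)) * (\<integral>\<^sup>+y. ennreal (norm (s n (y + z) - s n y)) \<partial>lborel)"
      by (rule nn_integral_cmult) simp
    also have "\<dots> \<le> ennreal ((2 * N) powr (r - 1)) * ennreal (\<eta> / K / (2 * N) powr (r - 1))"
      using d z by (intro mult_left_mono) auto
    also have "\<dots> = ennreal (\<eta> / K)"
      using M \<eta> K by (simp add: ennreal_mult[symmetric])
    finally have 2: "Lp_int r (\<lambda>y. s n (y + z) - s n y) \<le> ennreal (\<eta> / K)" .
    have 1: "Lp_int r (\<lambda>y. g (y + z) - s n (y + z)) \<le> ennreal (\<eta> / K)"
      using n Lp_int_translate[of "\<lambda>x. g x - s n x" r z] by simp
    have 3: "Lp_int r (\<lambda>y. g y - s n y) \<le> ennreal (\<eta> / K)"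
      using n by simp
    have "Lp_int r (\<lambda>y. s n (y + z) - g y) \<le> ennreal (2 powr r) *
        (Lp_int r (\<lambda>y. s n (y + z) - s n y) + Lp_int r (\<lambda>y. g y - s n y))"
    proof (rule Lp_int_triangle)
      show "norm (s n (y + z) - g y) \<le> norm (s n (y + z) - s n y) + norm (g y - s n y)" for y
        using norm_triangle_ineq4[of "s n (y + z) - s n y" "g y - s n y"] by simp
    qed (use g in auto)
    also have "\<dots> \<le> ennreal (2 powr r) * (ennreal (\<eta> / K) + ennreal (\<eta> / K))"
      by (intro mult_left_mono add_mono 2 3) simp
    finally have 4: "Lp_int r (\<lambda>y. s n (y + z) - g y) \<le> ennreal (2 powr r * 2 * (\<eta> / K))"
      using \<eta> K by (simp add: ennreal_plus[symmetric] ennreal_mult[symmetric] mult_ac del: ennreal_plus)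
    have "Lp_int r (\<lambda>y. g (y + z) - g y) \<le> ennreal (2 powr r) *
        (Lp_int r (\<lambda>y. g (y + z) - s n (y + z)) + Lp_int r (\<lambda>y. s n (y + z) - g y))"
    proof (rule Lp_int_triangle)
      show "norm (g (y + z) - g y) \<le> norm (g (y + z) - s n (y + z)) + norm (s n (y + z) - g y)" for y
        using norm_triangle_ineq[of "g (y + z) - s n (y + z)" "s n (y + z) - g y"] by simp
    qed (use g in auto)
    also have "\<dots> \<le> ennreal (2 powr r) * (ennreal (\<eta> / K) + ennreal (2 powr r * 2 * (\<eta> / K)))"
      by (intro mult_left_mono add_mono 1 4) simp
    also have "\<dots> = ennreal (2 powr r * ((\<eta> / K) + 2 powr r * 2 * (\<eta> / K)))"
      using \<eta> K by (simp add: ennreal_plus[symmetric] ennreal_mult[symmetric] del: ennreal_plus)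
    also have "\<dots> = ennreal (K * (\<eta> / K))"
      unfolding K_def by (simp only: distrib_left distrib_right mult_1 mult.assoc)
    also have "\<dots> = ennreal \<eta>"
      using K by simp
    finally show "Lp_int r (\<lambda>y. g (y + z) - g y) \<le> ennreal \<eta>" .
  qed (rule d)
qed

text \<open>The error is an average of translation errors over \<open>norm z \<le> d'\<close>. The
  threshold \<open>d\<close> serves all narrower mollifiers, so one sequence of mollifiers can be
  used for several functions.\<close>

lemma mollifier_approximation:
  fixes g :: "real^'n \<Rightarrow> complex"
  assumes [measurable]: "g \<in> borel_measurable borel" and g: "Lp_int r g < \<infinity>" "1 \<le> r" and \<eta>: "0 < (\<eta>::real)"
  shows "\<exists>d>0. \<forall>d' \<phi>. d' \<le> d \<longrightarrow> mollifier d' \<phi> \<longrightarrow> Lp_int r (\<lambda>y. conv g (cplx \<phi>) y - g y) \<le> ennreal \<eta>"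
proof -
  obtain d where d: "d > 0" "\<And>z. norm z \<le> d \<Longrightarrow> Lp_int r (\<lambda>y. g (y + z) - g y) \<le> ennreal \<eta>"
    using Lp_translate_continuous[OF assms] by blast
  show ?thesis
  proof (intro exI conjI allI impI)
    fix d' and \<phi> :: "real^'n \<Rightarrow> real" assume d': "d' \<le> d" and \<phi>: "mollifier d' \<phi>"
    show "Lp_int r (\<lambda>y. conv g (cplx \<phi>) y - g y) \<le> ennreal \<eta>"
      unfolding conv_mollifier_diff[OF assms(1) g \<phi>]
      by (rule mollified_Lp_int_le[OF _ \<phi> g(2)]) (use d d' in auto)
  qed (rule d)
qed

section \<open>The multiplication formula and convolution\<close>

lemma integrable_pairI:
  fixes F :: "'a::euclidean_space \<Rightarrow> 'b::euclidean_space \<Rightarrow> complex"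
  assumes "case_prod F \<in> borel_measurable (borel \<Otimes>\<^sub>M borel)"
    and "(\<integral>\<^sup>+x. \<integral>\<^sup>+y. ennreal (norm (F x y)) \<partial>lborel \<partial>lborel) < \<infinity>"
  shows "integrable (lborel \<Otimes>\<^sub>M lborel) (case_prod F)"
proof (rule integrableI_bounded)
  show F [measurable]: "case_prod F \<in> borel_measurable (lborel \<Otimes>\<^sub>M lborel)"
    using assms(1) by simp
  have "(\<integral>\<^sup>+p. ennreal (norm (case_prod F p)) \<partial>(lborel \<Otimes>\<^sub>M lborel)) =
      (\<integral>\<^sup>+x. \<integral>\<^sup>+y. ennreal (norm (case_prod F (x, y))) \<partial>lborel \<partial>lborel)"
    by (rule lborel.nn_integral_fst[symmetric]) simp
  then show "(\<integral>\<^sup>+p. ennreal (norm (case_prod F p)) \<partial>(lborel \<Otimes>\<^sub>M lborel)) < \<infinity>"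
    using assms(2) by simp
qed

lemma nn_norm_finite:
  fixes f :: "'a \<Rightarrow> complex"
  shows "integrable M f \<Longrightarrow> (\<integral>\<^sup>+x. ennreal (norm (f x)) \<partial>M) < \<infinity>"
  unfolding integrable_iff_bounded by (erule conjunct2)

lemma integrable_borel: "integrable lborel f \<Longrightarrow> f \<in> borel_measurable borel"
  using borel_measurable_integrable by fastforce

text \<open>Both sides are iterated integrals of the absolutely integrable
  \<open>f x * g \<gamma> * cis (- (\<gamma> \<bullet> x))\<close>, whose phase is symmetric in the
  two variables.\<close>

lemma fourier_multiplication:
  fixes f g :: "real^'n \<Rightarrow> complex"
  assumes f: "integrable lborel f" and g: "integrable lborel g"
  shows "(\<integral>\<gamma>. fourier f \<gamma> * g \<gamma> \<partial>lborel) = (\<integral>x. f x * fourier g x \<partial>lborel)"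
proof -
  have [measurable]: "f \<in> borel_measurable borel" "g \<in> borel_measurable borel"
    using f g by (auto dest: integrable_borel)
  let ?F = "\<lambda>x \<gamma>. f x * g \<gamma> * cis (- (\<gamma> \<bullet> x))"
  have int: "integrable (lborel \<Otimes>\<^sub>M lborel) (case_prod ?F)"
  proof (rule integrable_pairI)
    have "(\<integral>\<^sup>+x. \<integral>\<^sup>+\<gamma>. ennreal (norm (?F x \<gamma>)) \<partial>lborel \<partial>lborel) =
       (\<integral>\<^sup>+x. ennreal (norm (f x)) \<partial>lborel) * (\<integral>\<^sup>+x. ennreal (norm (g x)) \<partial>lborel)"
      by (simp add: norm_mult ennreal_mult nn_integral_cmult nn_integral_multc)
    also have "\<dots> < \<infinity>"
      using nn_norm_finite[OF f] nn_norm_finite[OF g] by (simp add: ennreal_mult_less_top)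
    finally show "(\<integral>\<^sup>+x. \<integral>\<^sup>+\<gamma>. ennreal (norm (?F x \<gamma>)) \<partial>lborel \<partial>lborel) < \<infinity>" .
  qed measurable
  have "(\<integral>\<gamma>. fourier f \<gamma> * g \<gamma> \<partial>lborel) = (\<integral>\<gamma>. \<integral>x. ?F x \<gamma> \<partial>lborel \<partial>lborel)"
  proof (rule Bochner_Integration.integral_cong[OF refl])
    fix \<gamma>
    have "(\<integral>x. ?F x \<gamma> \<partial>lborel) = (\<integral>x. (f x * cis (- (\<gamma> \<bullet> x))) * g \<gamma> \<partial>lborel)"
      by (simp add: mult_ac)
    then show "fourier f \<gamma> * g \<gamma> = (\<integral>x. ?F x \<gamma> \<partial>lborel)"
      by (simp only: fourier_lborel[OF \<open>f \<in> borel_measurable borel\<close>] integral_mult_left_zero)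
  qed
  also have "\<dots> = (\<integral>x. \<integral>\<gamma>. ?F x \<gamma> \<partial>lborel \<partial>lborel)"
    by (rule lborel_pair.Fubini_integral[OF int])
  also have "\<dots> = (\<integral>x. f x * fourier g x \<partial>lborel)"
  proof (rule Bochner_Integration.integral_cong[OF refl])
    fix x
    have "(\<integral>\<gamma>. ?F x \<gamma> \<partial>lborel) = (\<integral>\<gamma>. f x * (g \<gamma> * cis (- (x \<bullet> \<gamma>))) \<partial>lborel)"
      by (simp add: mult_ac inner_commute)
    then show "(\<integral>\<gamma>. ?F x \<gamma> \<partial>lborel) = f x * fourier g x"
      by (simp only: fourier_lborel[OF \<open>g \<in> borel_measurable borel\<close>] integral_mult_right_zero)
  qed
  finally show ?thesis .
qed

lemma schwartz_integrable:
  assumes "schwartz u" shows "integrable lborel u"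
proof (rule Lp_int_1_integrable)
  show "u \<in> borel_measurable borel"
    using assms by (intro borel_measurable_continuous_onI smooth_fun_continuous) (simp add: schwartz_def)
  show "Lp_int 1 u < \<infinity>"
    using assms by (rule schwartz_Lp_finite) simp
qed

lemma has_fourierI:
  fixes f g :: "real^'n \<Rightarrow> complex"
  assumes [measurable]: "f \<in> borel_measurable borel" "g \<in> borel_measurable borel"
    and "\<And>\<phi>. schwartz \<phi> \<Longrightarrow> integrable lborel (\<lambda>x. g x * \<phi> x)"
    and "\<And>\<phi>. schwartz \<phi> \<Longrightarrow> integrable lborel (\<lambda>x. f x * fourier \<phi> x)"
    and "\<And>\<phi>. schwartz \<phi> \<Longrightarrow> (\<integral>x. g x * \<phi> x \<partial>lborel) = (\<integral>x. f x * fourier \<phi> x \<partial>lborel)"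
  shows "has_fourier f g"
  unfolding has_fourier_def
proof (intro conjI allI impI)
  show "g \<in> borel_measurable lebesgue" by (rule measurable_completion) simp
  fix \<phi> :: "real^'n \<Rightarrow> complex" assume \<phi>: "schwartz \<phi>"
  have [measurable]: "\<phi> \<in> borel_measurable borel" "fourier \<phi> \<in> borel_measurable borel"
    using schwartz_integrable[OF \<phi>] by (auto intro: integrable_borel borel_measurable_fourier)
  show "integrable lebesgue (\<lambda>x. g x * \<phi> x)"
    by (subst integrable_completion) (use assms(3)[OF \<phi>] in auto)
  show "integrable lebesgue (\<lambda>x. f x * fourier \<phi> x)"
    by (subst integrable_completion) (use assms(4)[OF \<phi>] in auto)
  show "(\<integral>x. g x * \<phi> x \<partial>lebesgue) = (\<integral>x. f x * fourier \<phi> x \<partial>lebesgue)"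
    by (subst (1 2) integral_completion) (use assms(5)[OF \<phi>] in auto)
qed

lemma has_fourier_integrable:
  fixes f :: "real^'n \<Rightarrow> complex"
  assumes f: "integrable lborel f"
  shows "has_fourier f (fourier f)"
proof (rule has_fourierI)
  show "f \<in> borel_measurable borel" "fourier f \<in> borel_measurable borel"
    using f by (auto intro: integrable_borel borel_measurable_fourier)
  fix \<phi> :: "real^'n \<Rightarrow> complex" assume "schwartz \<phi>"
  then have \<phi>: "integrable lborel \<phi>" by (rule schwartz_integrable)
  have "integrable lborel (\<lambda>x. \<phi> x * fourier f x)"
    using \<phi> norm_fourier_le[OF f] borel_measurable_fourier[OF f] by (intro integrable_mult_bounded) auto
  then show "integrable lborel (\<lambda>x. fourier f x * \<phi> x)"
    by (simp add: mult.commute)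
  show "integrable lborel (\<lambda>x. f x * fourier \<phi> x)"
    using f norm_fourier_le[OF \<phi>] borel_measurable_fourier[OF \<phi>] by (intro integrable_mult_bounded) auto
  show "(\<integral>x. fourier f x * \<phi> x \<partial>lborel) = (\<integral>x. f x * fourier \<phi> x \<partial>lborel)"
    by (rule fourier_multiplication[OF f \<phi>])
qed

lemma integrable_pair_conv:
  fixes m u :: "real^'n \<Rightarrow> complex"
  assumes m: "integrable lborel m" and u: "integrable lborel u"
  shows "integrable (lborel \<Otimes>\<^sub>M lborel) (\<lambda>(w, x). m w * u (x - w))"
proof (rule integrable_pairI)
  have [measurable]: "m \<in> borel_measurable borel" "u \<in> borel_measurable borel"
    using m u by (auto dest: integrable_borel)
  show "(\<lambda>(w, x). m w * u (x - w)) \<in> borel_measurable (borel \<Otimes>\<^sub>M borel)"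
    by measurable
  have "(\<integral>\<^sup>+x. ennreal (norm (u (x - w))) \<partial>lborel) = (\<integral>\<^sup>+x. ennreal (norm (u x)) \<partial>lborel)" for w
    using nn_integral_lborel_translate[of "\<lambda>x. ennreal (norm (u x))" "- w"] by simp
  then have "(\<integral>\<^sup>+w. \<integral>\<^sup>+x. ennreal (norm (m w * u (x - w))) \<partial>lborel \<partial>lborel) =
     (\<integral>\<^sup>+x. ennreal (norm (m x)) \<partial>lborel) * (\<integral>\<^sup>+x. ennreal (norm (u x)) \<partial>lborel)"
    by (simp add: norm_mult ennreal_mult nn_integral_cmult nn_integral_multc)
  also have "\<dots> < \<infinity>"
    using nn_norm_finite[OF m] nn_norm_finite[OF u] by (simp add: ennreal_mult_less_top)
  finally show "(\<integral>\<^sup>+w. \<integral>\<^sup>+x. ennreal (norm (m w * u (x - w))) \<partial>lborel \<partial>lborel) < \<infinity>" .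
qed

lemma integrable_conv:
  assumes "integrable lborel m" "integrable lborel u"
  shows "integrable lborel (conv m u)"
  unfolding conv_def using integrable_pair_conv[OF assms] by (rule lborel_pair.integrable_snd)

lemma fourier_conv:
  fixes m u :: "real^'n \<Rightarrow> complex"
  assumes m: "integrable lborel m" and u: "integrable lborel u"
  shows "fourier (conv m u) \<gamma> = fourier m \<gamma> * fourier u \<gamma>"
proof -
  have [measurable]: "m \<in> borel_measurable borel" "u \<in> borel_measurable borel"
    using m u by (auto dest: integrable_borel)
  have cm: "conv m u \<in> borel_measurable borel"
    using integrable_conv[OF m u] by (rule integrable_borel)
  let ?e = "\<lambda>x. cis (- (\<gamma> \<bullet> x))"
  have "integrable (lborel \<Otimes>\<^sub>M lborel) (\<lambda>p. (case p of (w, x) \<Rightarrow> m w * u (x - w)) * ?e (snd p))"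
    using integrable_pair_conv[OF m u] by (rule integrable_mult_bounded[where B = 1]) auto
  then have int: "integrable (lborel \<Otimes>\<^sub>M lborel) (\<lambda>(w, x). m w * u (x - w) * ?e x)"
    by (simp add: case_prod_beta')
  have "fourier (conv m u) \<gamma> = (\<integral>x. (\<integral>w. m w * u (x - w) \<partial>lborel) * ?e x \<partial>lborel)"
    unfolding fourier_lborel[OF cm] by (simp add: conv_def)
  also have "\<dots> = (\<integral>x. (\<integral>w. m w * u (x - w) * ?e x \<partial>lborel) \<partial>lborel)"
    by simp
  also have "\<dots> = (\<integral>w. (\<integral>x. m w * u (x - w) * ?e x \<partial>lborel) \<partial>lborel)"
    by (rule lborel_pair.Fubini_integral[OF int])
  also have "\<dots> = (\<integral>w. m w * ?e w * fourier u \<gamma> \<partial>lborel)"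
  proof (rule Bochner_Integration.integral_cong[OF refl])
    fix w
    have "(\<integral>x. m w * u (x - w) * ?e x \<partial>lborel) = (\<integral>x. m w * u (x + w - w) * ?e (x + w) \<partial>lborel)"
      by (rule integral_lborel_translate[symmetric]) simp
    also have "\<dots> = (\<integral>x. m w * ?e w * (u x * ?e x) \<partial>lborel)"
    proof (intro Bochner_Integration.integral_cong refl)
      fix x
      have "?e (x + w) = ?e x * ?e w"
        by (simp only: inner_add_right minus_add_distrib cis_mult)
      then show "m w * u (x + w - w) * ?e (x + w) = m w * ?e w * (u x * ?e x)"
        by (simp only: add_diff_cancel_right' mult_ac)
    qed
    also have "\<dots> = m w * ?e w * fourier u \<gamma>"
      by (simp add: fourier_lborel)
    finally show "(\<integral>x. m w * u (x - w) * ?e x \<partial>lborel) = m w * ?e w * fourier u \<gamma>" .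
  qed
  also have "\<dots> = fourier m \<gamma> * fourier u \<gamma>"
    by (simp add: fourier_lborel)
  finally show ?thesis .
qed

lemma conv_commute:
  assumes [measurable]: "m \<in> borel_measurable borel" "u \<in> borel_measurable borel"
  shows "conv m u x = conv u m x"
proof -
  have "conv m u x = (\<integral>w. m (x - w) * u (x - (x - w)) \<partial>lborel)"
    unfolding conv_def by (rule integral_lborel_reflect[symmetric]) simp
  then show ?thesis by (simp add: conv_def mult.commute)
qed

lemma conv_integrable:
  fixes m v :: "real^'n \<Rightarrow> complex"
  assumes "integrable lborel m" "bounded_smooth v"
  shows "integrable lborel (\<lambda>w. m w * v (x - w))"
proof (rule bounded_smooth_bounds[OF assms(2)])
  fix B assume B: "\<And>y. norm (v y) \<le> B"
  have [measurable]: "v \<in> borel_measurable borel"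
    using assms(2) by (intro borel_measurable_continuous_onI smooth_fun_continuous) (simp add: bounded_smooth_def)
  show ?thesis
    by (rule integrable_mult_bounded[OF assms(1) _ B]) simp
qed

text \<open>Derivatives fall on \<open>u\<close>, and on the support of \<open>m\<close> the weight
  at \<open>x\<close> is at most \<open>(1 + d) ^ k\<close> times the weight at
  \<open>x - w\<close>. The rapid decay of \<open>u\<close> is thus inherited.\<close>

lemma schwartz_conv:
  fixes m u :: "real^'n \<Rightarrow> complex"
  assumes m: "integrable lborel m" "\<And>w. d < norm w \<Longrightarrow> m w = 0" and u: "schwartz u" and d: "0 \<le> d"
  shows "schwartz (conv m u)"
  unfolding schwartz_def
proof (intro conjI allI)
  have bu: "bounded_smooth u" using u by (rule schwartz_bounded_smooth)
  show "smooth_fun (conv m u)" by (rule smooth_fun_conv[OF m(1) bu])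
  fix "is" and k :: nat
  let ?v = "iter_pderiv is u"
  have "bounded (range (\<lambda>x. (1 + norm x) ^ k * norm (?v x)))"
    using u unfolding schwartz_def by blast
  then obtain C where "\<forall>y\<in>range (\<lambda>x. (1 + norm x) ^ k * norm (?v x)). norm y \<le> C"
    unfolding bounded_iff ..
  then have C: "(1 + norm x) ^ k * norm (?v x) \<le> C" for x
    by (auto simp: abs_mult)
  have C0: "0 \<le> C"
    using C[of 0] by (meson add_nonneg_nonneg mult_nonneg_nonneg norm_ge_zero order_trans zero_le_one zero_le_power)
  have le: "(1 + norm x) ^ k * norm (conv m ?v x) \<le> (1 + d) ^ k * C * (\<integral>w. norm (m w) \<partial>lborel)" for x
  proof -
    have pw: "norm (of_real ((1 + norm x) ^ k) * (m w * ?v (x - w))) \<le> norm (m w) * ((1 + d) ^ k * C)" for w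
    proof (cases "norm w \<le> d")
      case True
      have "1 + norm x \<le> 1 + (norm w + norm (x - w))"
        using norm_triangle_ineq[of w "x - w"] by simp
      \<comment> \<open>The nonnegative term \<open>d * norm (x - w)\<close> is added so that the
        bound factors.\<close>
      also have "\<dots> \<le> (1 + norm (x - w)) + d + d * norm (x - w)"
      proof -
        have "0 \<le> d * norm (x - w)" using d by simp
        with True show ?thesis by linarith
      qed
      also have "\<dots> = (1 + d) * (1 + norm (x - w))"
        by (simp add: algebra_simps)
      finally have "(1 + norm x) ^ k \<le> (1 + d) ^ k * (1 + norm (x - w)) ^ k"
        by (metis add_nonneg_nonneg norm_ge_zero power_mono power_mult_distrib zero_le_one)
      then have "(1 + norm x) ^ k * norm (?v (x - w)) \<le> (1 + d) ^ k * ((1 + norm (x - w)) ^ k * norm (?v (x - w)))"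
        by (simp add: mult_right_mono flip: mult.assoc)
      also have "\<dots> \<le> (1 + d) ^ k * C"
        using d by (intro mult_left_mono C) auto
      finally have "norm (m w) * ((1 + norm x) ^ k * norm (?v (x - w))) \<le> norm (m w) * ((1 + d) ^ k * C)"
        by (rule mult_left_mono) simp
      then show ?thesis
        by (simp add: norm_mult norm_power abs_mult mult_ac flip: of_real_power)
    next
      case False
      then show ?thesis using m(2)[of w] by simp
    qed
    have "(1 + norm x) ^ k * norm (conv m ?v x) = norm (\<integral>w. of_real ((1 + norm x) ^ k) * (m w * ?v (x - w)) \<partial>lborel)"
    proof -
      have "norm (complex_of_real ((1 + norm x) ^ k)) = (1 + norm x) ^ k"
        unfolding norm_of_real by simp
      then show ?thesis
        unfolding conv_def integral_mult_right_zero norm_mult by (simp only:)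
    qed
    also have "\<dots> \<le> (\<integral>w. norm (m w) * ((1 + d) ^ k * C) \<partial>lborel)"
    proof (rule Bochner_Integration.integral_norm_bound_integral)
      show "integrable lborel (\<lambda>w. of_real ((1 + norm x) ^ k) * (m w * ?v (x - w)))"
        using m(1) bounded_smooth_iter_pderiv[OF bu] by (intro integrable_mult_right conv_integrable)
      show "integrable lborel (\<lambda>w. norm (m w) * ((1 + d) ^ k * C))"
        using m(1) by simp
    qed (rule pw)
    also have "\<dots> = (1 + d) ^ k * C * (\<integral>w. norm (m w) \<partial>lborel)"
      by simp
    finally show ?thesis .
  qed
  show "bounded (range (\<lambda>x. (1 + norm x) ^ k * norm (iter_pderiv is (conv m u) x)))"
    unfolding iter_pderiv_conv[OF m(1) bu] bounded_iff
  proof (intro exI[of _ "(1 + d) ^ k * C * (\<integral>w. norm (m w) \<partial>lborel)"] ballI)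
    fix y assume "y \<in> range (\<lambda>x. (1 + norm x) ^ k * norm (conv m ?v x))"
    then show "norm y \<le> (1 + d) ^ k * C * (\<integral>w. norm (m w) \<partial>lborel)"
      using le by (auto simp: abs_mult)
  qed
qed

section \<open>Uniqueness and modulation of generalized transforms\<close>

text \<open>Applied to real and imaginary parts separately. It allows arguments needing Borel
  measurability to be used for Lebesgue measurable functions.\<close>

lemma complex_ex_borel:
  fixes f :: "'a \<Rightarrow> complex"
  assumes [measurable]: "f \<in> borel_measurable (completion M)"
  obtains f' where "f' \<in> borel_measurable M" "AE x in M. f x = f' x"
proof -
  have "(\<lambda>x. Re (f x)) \<in> borel_measurable (completion M)" "(\<lambda>x. Im (f x)) \<in> borel_measurable (completion M)"
    by measurable
  from this[THEN completion_ex_borel_measurable_real]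
  obtain u v where [measurable]: "u \<in> borel_measurable M" "v \<in> borel_measurable M"
    and ae: "AE x in M. Re (f x) = u x" "AE x in M. Im (f x) = v x"
    by blast
  show thesis
  proof (rule that[of "\<lambda>x. Complex (u x) (v x)"])
    show "(\<lambda>x. Complex (u x) (v x)) \<in> borel_measurable M"
      unfolding Complex_eq by measurable
    show "AE x in M. f x = Complex (u x) (v x)"
      using ae by eventually_elim (simp add: complex_eq_iff)
  qed
qed

text \<open>The test function in \<open>w\<close> whose pairing with a function is the value at
  \<open>y\<close> of the mollified product of that function with the scaled bump.\<close>

lemma C0_inf_scaled_bump_product:
  assumes "mollifier e \<phi>" "0 < R"
  shows "C0_inf (\<lambda>w::real^'n. complex_of_real (bump ((1 / R) *\<^sub>R w)) * of_real (\<phi> (y - w)))"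
proof (rule C0_inf_mult_smooth)
  show "C0_inf (\<lambda>w::real^'n. complex_of_real (bump ((1 / R) *\<^sub>R w)))"
    using assms(2) by (rule C0_inf_bump_scaled)
  show "smooth_fun (\<lambda>w. complex_of_real (\<phi> (y - w)))"
    using smooth_fun_affine[OF C0_inf_smooth[OF mollifier_C0_inf[OF assms(1)]], of "- 1" y] by simp
qed

lemma ennreal_eq_0I:
  assumes "\<And>\<eta>. 0 < (\<eta>::real) \<Longrightarrow> x \<le> ennreal \<eta>" shows "x = 0"
proof (rule ccontr)
  assume "x \<noteq> 0"
  have "x \<le> ennreal 1" by (rule assms) simp
  then obtain y where y: "x = ennreal y" "0 \<le> y"
    by (cases x) (auto simp: top_unique)
  with \<open>x \<noteq> 0\<close> assms[of "y / 2"] show False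
    by (simp add: ennreal_le_iff)
qed

text \<open>The product \<open>d * bump\<close> is integrable, and its mollifications vanish because they are
  pairings of \<open>d\<close> with test functions.\<close>
lemma test_functions_separate:
  fixes d :: "real^'n \<Rightarrow> complex"
  assumes [measurable]: "d \<in> borel_measurable borel"
    and int: "\<And>\<phi>. C0_inf \<phi> \<Longrightarrow> integrable lborel (\<lambda>x. d x * \<phi> x)"
    and zero: "\<And>\<phi>. C0_inf \<phi> \<Longrightarrow> (\<integral>x. d x * \<phi> x \<partial>lborel) = 0"
  shows "AE x in lborel. d x = 0"
proof -
  have "AE x in lborel. d x * complex_of_real (bump ((1 / R) *\<^sub>R x)) = 0" if R: "0 < R" for R
  proof -
    let ?h = "\<lambda>x. d x * complex_of_real (bump ((1 / R) *\<^sub>R x))"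
    have h: "integrable lborel ?h"
      using R by (intro int C0_inf_bump_scaled)
    have hm: "?h \<in> borel_measurable borel"
      using h by (rule integrable_borel)
    have hL: "Lp_int 1 ?h < \<infinity>"
      using nn_norm_finite[OF h] by (simp add: Lp_int_def)
    have "Lp_int 1 ?h = 0"
    proof (rule ennreal_eq_0I)
      fix \<eta> :: real assume "0 < \<eta>"
      from mollifier_approximation[OF hm hL order_refl this]
      obtain e where e: "e > 0 \<and> (\<forall>d' \<phi>. d' \<le> e \<longrightarrow> mollifier d' \<phi> \<longrightarrow>
          Lp_int 1 (\<lambda>y. conv ?h (cplx \<phi>) y - ?h y) \<le> ennreal \<eta>)" ..
      obtain \<phi> :: "real^'n \<Rightarrow> real" where \<phi>: "mollifier e \<phi>"
        using mollifier_exists[OF conjunct1[OF e]] .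
      have "conv ?h (cplx \<phi>) y = 0" for y
        using zero[OF C0_inf_scaled_bump_product[OF \<phi> R, of y]] by (simp add: conv_def mult.assoc)
      then have "Lp_int 1 (\<lambda>y. conv ?h (cplx \<phi>) y - ?h y) = Lp_int 1 ?h"
        by (simp add: Lp_int_def)
      then show "Lp_int 1 ?h \<le> ennreal \<eta>"
        using conjunct2[OF e, rule_format, OF order_refl \<phi>] by (simp only:)
    qed
    then have "AE x in lborel. ennreal (norm (?h x) powr 1) = 0"
      unfolding Lp_int_def using hm by (subst (asm) nn_integral_0_iff_AE) auto
    then show ?thesis by eventually_elim simp
  qed
  then have "AE x in lborel. d x * complex_of_real (bump ((1 / real (Suc n)) *\<^sub>R x)) = 0" for n
    by simp
  then have "AE x in lborel. \<forall>n. d x * complex_of_real (bump ((1 / real (Suc n)) *\<^sub>R x)) = 0"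
    by (subst AE_all_countable) (rule allI)
  then show ?thesis
  proof eventually_elim
    fix x assume *: "\<forall>n. d x * complex_of_real (bump ((1 / real (Suc n)) *\<^sub>R x)) = 0"
    obtain n where n: "norm x < real n"
      using reals_Archimedean2 by blast
    then have "norm ((1 / real (Suc n)) *\<^sub>R x) < 1"
      by simp
    then have "0 < bump ((1 / real (Suc n)) *\<^sub>R x)"
      by (simp only: bump_pos_iff)
    then show "d x = 0"
      using *[rule_format, of n] by simp
  qed
qed

text \<open>Two transforms of \<open>f\<close> have the same pairings with Schwartz functions, so a
  Borel representative of their difference annihilates every test function.\<close>

lemma has_fourier_unique:
  fixes f g g' :: "real^'n \<Rightarrow> complex"
  assumes g: "has_fourier f g" and g': "has_fourier f g'"
  shows "AE x in lborel. g x = g' x"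
proof -
  have m: "g \<in> borel_measurable lebesgue" "g' \<in> borel_measurable lebesgue"
    using g g' by (auto simp: has_fourier_def)
  then have m': "(\<lambda>x. g x - g' x) \<in> borel_measurable lebesgue"
    by simp
  obtain d where d: "d \<in> borel_measurable lborel" "AE x in lborel. g x - g' x = d x"
    using complex_ex_borel[OF m'] .
  have [measurable]: "d \<in> borel_measurable borel" using d(1) by simp
  have dm: "d \<in> borel_measurable lebesgue" using d(1) by (rule measurable_completion)
  have ae: "AE x in lebesgue. g x - g' x = d x" using d(2) by (rule AE_completion)
  have *: "integrable lborel (\<lambda>x. d x * \<phi> x) \<and> (\<integral>x. d x * \<phi> x \<partial>lborel) = 0" if "C0_inf \<phi>" for \<phi> :: "real^'n \<Rightarrow> complex"
  proof -
    have s: "schwartz \<phi>" using that by (rule C0_inf_schwartz)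
    have [measurable]: "\<phi> \<in> borel_measurable borel" using that by (rule C0_inf_borel)
    have pm: "\<phi> \<in> borel_measurable lebesgue" by (rule measurable_completion) simp
    have i: "integrable lebesgue (\<lambda>x. g x * \<phi> x)" "integrable lebesgue (\<lambda>x. g' x * \<phi> x)"
      "(\<integral>x. g x * \<phi> x \<partial>lebesgue) = (\<integral>x. g' x * \<phi> x \<partial>lebesgue)"
      using g g' s unfolding has_fourier_def by auto
    have i': "integrable lebesgue (\<lambda>x. g x * \<phi> x - g' x * \<phi> x)"
      using i by simp
    have i0: "(\<integral>x. g x * \<phi> x - g' x * \<phi> x \<partial>lebesgue) = 0"
      using i by simp
    have ae': "AE x in lebesgue. g x * \<phi> x - g' x * \<phi> x = d x * \<phi> x"
      using ae by eventually_elim (simp add: left_diff_distrib[symmetric])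
    have meas: "(\<lambda>x. g x * \<phi> x - g' x * \<phi> x) \<in> borel_measurable lebesgue"
      using m pm by simp
    have meas': "(\<lambda>x. d x * \<phi> x) \<in> borel_measurable lebesgue"
      using dm pm by simp
    have "integrable lebesgue (\<lambda>x. d x * \<phi> x)"
      using i' integrable_cong_AE[OF meas meas' ae'] by blast
    then have 1: "integrable lborel (\<lambda>x. d x * \<phi> x)"
      by (subst (asm) integrable_completion) auto
    have "(\<integral>x. d x * \<phi> x \<partial>lebesgue) = 0"
      using i0 integral_cong_AE[OF meas meas' ae'] by simp
    then have "(\<integral>x. d x * \<phi> x \<partial>lborel) = 0"
      by (subst (asm) integral_completion) auto
    with 1 show ?thesis ..
  qed
  have "AE x in lborel. d x = 0"
    by (rule test_functions_separate) (use * in auto)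
  with d(2) show ?thesis
    by eventually_elim simp
qed

lemma Lp_int_norm: "Lp_int r (\<lambda>x. complex_of_real (norm (g x))) = Lp_int r g"
  by (simp add: Lp_int_def)

text \<open>Only integrability is wanted, not a norm bound, so the pointwise Young inequality does
  the work of Hoelder's inequality.\<close>

lemma integrable_Lp_mult:
  fixes G \<psi> :: "real^'n \<Rightarrow> complex"
  assumes [measurable]: "G \<in> borel_measurable borel" "\<psi> \<in> borel_measurable borel"
    and q: "1 < q" "1 < q'" "1 / q + 1 / q' = 1"
    and fin: "Lp_int q G < \<infinity>" "Lp_int q' \<psi> < \<infinity>"
  shows "integrable lborel (\<lambda>x. G x * \<psi> x)"
proof -
  have "integrable lborel (\<lambda>x. norm (G x) powr q)" "integrable lborel (\<lambda>x. norm (\<psi> x) powr q')"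
    using fin by (auto intro!: integrableI_bounded simp: Lp_int_def)
  then have "integrable lborel (\<lambda>x. norm (G x) powr q / q + norm (\<psi> x) powr q' / q')"
    by simp
  then show ?thesis
  proof (rule Bochner_Integration.integrable_bound)
    show "AE x in lborel. norm (G x * \<psi> x) \<le> norm (norm (G x) powr q / q + norm (\<psi> x) powr q' / q')"
    proof (intro always_eventually allI)
      fix x
      have "norm (G x * \<psi> x) \<le> norm (G x) powr q / q + norm (\<psi> x) powr q' / q'"
        unfolding norm_mult using q by (intro Youngs_inequality) auto
      then show "norm (G x * \<psi> x) \<le> norm (norm (G x) powr q / q + norm (\<psi> x) powr q' / q')"
        unfolding real_norm_def by (rule order_trans[OF _ abs_ge_self])
    qed
  qed simp
qed

lemma conjugate_exponent:
  assumes "1 < (q::real)"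
  obtains q' where "1 < q'" "1 / q + 1 / q' = 1"
proof (rule that[of "q / (q - 1)"])
  show "1 < q / (q - 1)" "1 / q + 1 / (q / (q - 1)) = 1"
    using assms by (auto simp: field_simps)
qed

text \<open>Multiplying \<open>f\<close> by the transform of a mollifier mollifies the transform of \<open>f\<close>:
  test against \<open>\<psi>\<close> and use that \<open>conv k \<psi>\<close> is again a Schwartz function.\<close>
lemma has_fourier_modulation:
  fixes f g :: "real^'n \<Rightarrow> complex"
  assumes [measurable]: "f \<in> borel_measurable borel" "g \<in> borel_measurable borel"
    and fg: "has_fourier f g" and q: "1 < q" and gq: "Lp_int q g < \<infinity>" and \<phi>: "mollifier d \<phi>" and d: "0 \<le> d"
    and F: "integrable lborel (\<lambda>x. f x * fourier (cplx \<phi>) x)"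
  shows "has_fourier (\<lambda>x. f x * fourier (cplx \<phi>) x) (conv g (cplx \<phi>))"
proof (rule has_fourierI)
  define k where "k = (cplx \<phi>)"
  have kC: "C0_inf k" unfolding k_def using \<phi> by (rule mollifier_C0_inf)
  have kint: "integrable lborel k" using kC by (rule C0_inf_integrable)
  have [measurable]: "k \<in> borel_measurable borel" using kC by (rule C0_inf_borel)
  have keven: "k (- x) = k x" for x unfolding k_def using mollifier_even[OF \<phi>] by simp
  have ksub: "k (x - y) = k (y - x)" for x y using keven[of "x - y"] by simp
  have F': "integrable lborel (\<lambda>x. f x * fourier k x)" using F unfolding k_def .
  show "(\<lambda>x. f x * fourier (cplx \<phi>) x) \<in> borel_measurable borel"
    using F by (rule integrable_borel)
  show cm: "conv g (cplx \<phi>) \<in> borel_measurable borel"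
    unfolding k_def[symmetric] conv_def by measurable
  fix \<psi> :: "real^'n \<Rightarrow> complex" assume \<psi>: "schwartz \<psi>"
  obtain q' where q': "1 < q'" "1 / q + 1 / q' = 1"
    using conjugate_exponent[OF q] .
  have \<psi>int: "integrable lborel \<psi>" using \<psi> by (rule schwartz_integrable)
  have [measurable]: "\<psi> \<in> borel_measurable borel" using \<psi>int by (rule integrable_borel)
  have \<psi>q: "Lp_int q' \<psi> < \<infinity>" using \<psi> q' by (intro schwartz_Lp_finite) auto
  have "Lp_int q (conv g k) \<le> Lp_int q g"
    unfolding k_def using q by (intro conv_Lp_int_le[OF _ \<phi>]) auto
  then have "Lp_int q (conv g k) < \<infinity>" using gq by (rule le_less_trans)
  then show "integrable lborel (\<lambda>x. conv g (cplx \<phi>) x * \<psi> x)"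
    unfolding k_def using cm q q' \<psi>q by (intro integrable_Lp_mult) auto
  show "integrable lborel (\<lambda>x. f x * fourier (cplx \<phi>) x * fourier \<psi> x)"
    using norm_fourier_le[OF \<psi>int] borel_measurable_fourier[OF \<psi>int]
    by (intro integrable_mult_bounded[OF F]) auto
  \<comment> \<open>Fubini below needs absolute convergence. The inner integral of absolute values
    is the mollification of \<open>norm (g x)\<close>, which lies in \<open>L^q\<close> by
    contractivity, and it is paired with \<open>\<psi>\<close> in the conjugate space.\<close>
  let ?gn = "\<lambda>x. complex_of_real (norm (g x))"
  have gn: "Lp_int q (conv ?gn k) < \<infinity>"
  proof (rule le_less_trans)
    show "Lp_int q (conv ?gn k) \<le> Lp_int q ?gn"
      unfolding k_def using q by (intro conv_Lp_int_le[OF _ \<phi>]) auto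
  qed (use gq in \<open>simp add: Lp_int_norm\<close>)
  have [measurable]: "conv ?gn k \<in> borel_measurable borel"
    unfolding conv_def by measurable
  have int: "integrable (lborel \<Otimes>\<^sub>M lborel) (\<lambda>(y, x). g x * k (y - x) * \<psi> y)"
  proof (rule integrable_pairI)
    have "(\<integral>\<^sup>+x. ennreal (norm (g x * k (y - x) * \<psi> y)) \<partial>lborel) = ennreal (norm (conv ?gn k y * \<psi> y))" for y
    proof -
      obtain B where B: "\<And>x. norm (complex_of_real (\<phi> x)) \<le> B"
        using mollifier_bounded[OF \<phi>] by blast
      have "integrable lborel (\<lambda>x. k (y - x))"
        using kint by (rule integrable_lborel_reflect)
      then have i: "integrable lborel (\<lambda>x. g x * k (y - x))"
        using B q gq by (intro Lp_int_mult_integrable[where r = q]) (auto simp: k_def)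
      have "(\<integral>\<^sup>+x. ennreal (norm (g x * k (y - x))) \<partial>lborel) = ennreal (\<integral>x. norm (g x * k (y - x)) \<partial>lborel)"
        using i by (intro nn_integral_eq_integral) auto
      also have "(\<integral>x. norm (g x * k (y - x)) \<partial>lborel) = norm (complex_of_real (\<integral>x. norm (g x * k (y - x)) \<partial>lborel))"
        by simp
      also have "complex_of_real (\<integral>x. norm (g x * k (y - x)) \<partial>lborel) = (\<integral>x. of_real (norm (g x * k (y - x))) \<partial>lborel)"
        by simp
      also have "\<dots> = conv ?gn k y"
        unfolding conv_def using mollifier_nonneg[OF \<phi>] by (intro Bochner_Integration.integral_cong) (auto simp: norm_mult k_def)
      finally show ?thesis
        by (simp add: norm_mult ennreal_mult nn_integral_multc)
    qed
    then have "(\<integral>\<^sup>+y. \<integral>\<^sup>+x. ennreal (norm (g x * k (y - x) * \<psi> y)) \<partial>lborel \<partial>lborel) =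
       (\<integral>\<^sup>+y. ennreal (norm (conv ?gn k y * \<psi> y)) \<partial>lborel)"
      by simp
    also have "\<dots> < \<infinity>"
      by (rule nn_norm_finite, rule integrable_Lp_mult[where q = q and q' = q'])
         (use gn q q' \<psi>q in auto)
    finally show "(\<integral>\<^sup>+y. \<integral>\<^sup>+x. ennreal (norm (g x * k (y - x) * \<psi> y)) \<partial>lborel \<partial>lborel) < \<infinity>" .
  qed measurable
  have k\<psi>: "schwartz (conv k \<psi>)"
    using \<phi> d by (intro schwartz_conv[OF kint _ \<psi>, of d]) (auto simp: k_def mollifier_def)
  have [measurable]: "conv k \<psi> \<in> borel_measurable borel" "fourier (conv k \<psi>) \<in> borel_measurable borel"
    using schwartz_integrable[OF k\<psi>] by (auto intro: integrable_borel borel_measurable_fourier)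
  have "(\<integral>y. conv g k y * \<psi> y \<partial>lborel) = (\<integral>y. \<integral>x. g x * k (y - x) * \<psi> y \<partial>lborel \<partial>lborel)"
    by (simp add: conv_def)
  also have "\<dots> = (\<integral>x. \<integral>y. g x * k (y - x) * \<psi> y \<partial>lborel \<partial>lborel)"
    by (rule lborel_pair.Fubini_integral[OF int, symmetric])
  also have "\<dots> = (\<integral>x. g x * conv k \<psi> x \<partial>lborel)"
  proof (rule Bochner_Integration.integral_cong[OF refl])
    fix x
    \<comment> \<open>Evenness transposes the kernel, so the inner integral is again a convolution
      with \<open>k\<close> and not with its reflection.\<close>
    have "(\<integral>y. g x * k (y - x) * \<psi> y \<partial>lborel) = (\<integral>y. g x * (\<psi> y * k (x - y)) \<partial>lborel)"
      by (simp add: mult_ac ksub[of _ x])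
    also have "\<dots> = g x * conv \<psi> k x"
      by (simp add: conv_def)
    also have "conv \<psi> k x = conv k \<psi> x"
      by (rule conv_commute) auto
    finally show "(\<integral>y. g x * k (y - x) * \<psi> y \<partial>lborel) = g x * conv k \<psi> x" .
  qed
  also have "\<dots> = (\<integral>x. g x * conv k \<psi> x \<partial>lebesgue)"
    by (rule integral_completion[symmetric]) simp
  also have "\<dots> = (\<integral>x. f x * fourier (conv k \<psi>) x \<partial>lebesgue)"
    using fg k\<psi> unfolding has_fourier_def by blast
  also have "\<dots> = (\<integral>x. f x * fourier (conv k \<psi>) x \<partial>lborel)"
    by (rule integral_completion) simp
  also have "\<dots> = (\<integral>x. f x * fourier k x * fourier \<psi> x \<partial>lborel)"
    by (simp add: fourier_conv[OF kint \<psi>int] mult.assoc)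
  finally show "(\<integral>x. conv g (cplx \<phi>) x * \<psi> x \<partial>lborel) =
      (\<integral>x. f x * fourier (cplx \<phi>) x * fourier \<psi> x \<partial>lborel)"
    unfolding k_def .
qed

section \<open>Density of test functions\<close>

text \<open>A chord is no longer than its arc; explicitly the chord has length
  \<open>2 * sin (t / 2)\<close> up to sign.\<close>

lemma norm_cis_minus_one_le: "norm (cis t - 1) \<le> \<bar>t\<bar>"
proof -
  have "(norm (cis t - 1))\<^sup>2 = (cos t - 1)\<^sup>2 + (sin t)\<^sup>2"
    by (simp add: cmod_power2)
  also have "\<dots> = 2 - 2 * cos t"
    using sin_cos_squared_add[of t] by (simp add: power2_diff)
  also have "\<dots> = (2 * sin (t / 2))\<^sup>2"
    using cos_double_sin[of "t / 2"] by (simp add: power_mult_distrib)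
  finally have "norm (cis t - 1) = \<bar>2 * sin (t / 2)\<bar>"
    by (metis abs_norm_cancel power2_eq_iff_nonneg abs_ge_zero power2_abs)
  also have "\<dots> \<le> \<bar>t\<bar>"
    using abs_sin_x_le_abs_x[of "t / 2"] by (simp add: abs_mult)
  finally show ?thesis .
qed

lemma mollifier_fourier_le_1:
  assumes "mollifier d \<phi>" shows "norm (fourier (cplx \<phi>) \<gamma>) \<le> 1"
proof -
  have "integrable lborel (cplx \<phi>)"
    using assms by (intro C0_inf_integrable mollifier_C0_inf)
  from norm_fourier_le[OF this] show ?thesis
    using assms mollifier_nonneg[OF assms] by (simp add: mollifier_def)
qed

text \<open>As \<open>\<phi>\<close> has integral 1, the difference is the average of
  \<open>cis (- (\<gamma> \<bullet> x)) - 1\<close>, and on the support of \<open>\<phi>\<close> the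
  phase is at most \<open>norm \<gamma> * d\<close>.\<close>

lemma mollifier_fourier_near_1:
  fixes \<phi> :: "real^'n \<Rightarrow> real"
  assumes \<phi>: "mollifier d \<phi>"
  shows "norm (fourier (cplx \<phi>) \<gamma> - 1) \<le> norm \<gamma> * d"
proof -
  have i: "integrable lborel (cplx \<phi>)"
    using \<phi> by (intro C0_inf_integrable mollifier_C0_inf)
  have "fourier (cplx \<phi>) \<gamma> - 1 =
     (\<integral>x. of_real (\<phi> x) * cis (- (\<gamma> \<bullet> x)) \<partial>lborel) - (\<integral>x. of_real (\<phi> x) \<partial>lborel)"
    using \<phi> i by (simp add: fourier_lborel integrable_borel mollifier_def)
  also have "\<dots> = (\<integral>x. of_real (\<phi> x) * cis (- (\<gamma> \<bullet> x)) - of_real (\<phi> x) \<partial>lborel)"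
    using integrable_mult_cis[OF i] i by (intro Bochner_Integration.integral_diff[symmetric])
  finally have eq: "fourier (cplx \<phi>) \<gamma> - 1 = (\<integral>x. of_real (\<phi> x) * cis (- (\<gamma> \<bullet> x)) - of_real (\<phi> x) \<partial>lborel)" .
  have "norm (\<integral>x. of_real (\<phi> x) * cis (- (\<gamma> \<bullet> x)) - of_real (\<phi> x) \<partial>lborel) \<le> (\<integral>x. \<phi> x * (norm \<gamma> * d) \<partial>lborel)"
  proof (rule Bochner_Integration.integral_norm_bound_integral)
    show "integrable lborel (\<lambda>x. of_real (\<phi> x) * cis (- (\<gamma> \<bullet> x)) - of_real (\<phi> x))"
      using integrable_mult_cis[OF i] i by (rule Bochner_Integration.integrable_diff)
    show "integrable lborel (\<lambda>x. \<phi> x * (norm \<gamma> * d))"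
      using mollifier_integrable[OF \<phi>] by simp
    fix x
    have "of_real (\<phi> x) * cis (- (\<gamma> \<bullet> x)) - of_real (\<phi> x) = of_real (\<phi> x) * (cis (- (\<gamma> \<bullet> x)) - 1)"
      by (simp add: algebra_simps)
    then have "norm (of_real (\<phi> x) * cis (- (\<gamma> \<bullet> x)) - of_real (\<phi> x)) = \<phi> x * norm (cis (- (\<gamma> \<bullet> x)) - 1)"
      using mollifier_nonneg[OF \<phi>, of x] by (simp add: norm_mult)
    also have "\<dots> \<le> \<phi> x * (norm \<gamma> * d)"
    proof (cases "norm x \<le> d")
      case True
      have "norm (cis (- (\<gamma> \<bullet> x)) - 1) \<le> \<bar>\<gamma> \<bullet> x\<bar>"
        using norm_cis_minus_one_le[of "- (\<gamma> \<bullet> x)"] by simp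
      also have "\<dots> \<le> norm \<gamma> * norm x"
        by (rule Cauchy_Schwarz_ineq2)
      also have "\<dots> \<le> norm \<gamma> * d"
        using True by (intro mult_left_mono) auto
      finally show ?thesis
        using mollifier_nonneg[OF \<phi>] by (rule mult_left_mono)
    next
      case False
      then have "\<phi> x = 0" using \<phi> by (simp add: mollifier_def)
      then show ?thesis by simp
    qed
    finally show "norm (of_real (\<phi> x) * cis (- (\<gamma> \<bullet> x)) - of_real (\<phi> x)) \<le> \<phi> x * (norm \<gamma> * d)" .
  qed
  also have "\<dots> = norm \<gamma> * d"
    using \<phi> by (simp add: mollifier_def)
  finally show ?thesis unfolding eq .
qed

lemma mollifier_sequence:
  obtains \<phi> :: "nat \<Rightarrow> real^'n \<Rightarrow> real" where "\<And>n. mollifier (inverse (real (Suc n))) (\<phi> n)"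
proof -
  have "\<exists>\<phi> :: real^'n \<Rightarrow> real. mollifier (inverse (real (Suc n))) \<phi>" for n
  proof -
    have "0 < inverse (real (Suc n))" by simp
    from mollifier_exists[OF this] obtain \<phi> :: "real^'n \<Rightarrow> real"
      where \<phi>: "mollifier (inverse (real (Suc n))) \<phi>" .
    show ?thesis by (rule exI) (rule \<phi>)
  qed
  then have "\<forall>n. \<exists>\<phi> :: real^'n \<Rightarrow> real. mollifier (inverse (real (Suc n))) \<phi>" ..
  from choice[OF this] obtain \<phi> :: "nat \<Rightarrow> real^'n \<Rightarrow> real" where
    "\<forall>n. mollifier (inverse (real (Suc n))) (\<phi> n)" ..
  then show ?thesis
    by (intro that[of \<phi>]) (rule spec)
qed

text \<open>Dominated convergence with majorant \<open>2 * f x\<close>: the multipliers are bounded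
  by 1 and tend to 1 pointwise because the supports of the mollifiers shrink to the origin.\<close>

lemma mollifier_Lp_tendsto:
  fixes f :: "real^'n \<Rightarrow> complex"
  assumes \<phi>: "\<And>n. mollifier (inverse (real (Suc n))) (\<phi> n)"
    and [measurable]: "f \<in> borel_measurable borel" and f: "Lp_int r f < \<infinity>" "0 < r"
  shows "(\<lambda>n. Lp_int r (\<lambda>x. f x - f x * fourier (cplx (\<phi> n)) x)) \<longlonglongrightarrow> 0"
proof (rule Lp_int_dominated[where f = "\<lambda>x. 2 * f x"])
  have "Lp_int r (\<lambda>x. 2 * f x) \<le> ennreal (2 powr r) * Lp_int r f"
    using f by (intro Lp_int_cmult) (auto simp: norm_mult)
  also have "\<dots> < \<infinity>"
    using f by (simp add: ennreal_mult_less_top)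
  finally show "Lp_int r (\<lambda>x. 2 * f x) < \<infinity>" .
  show "(\<lambda>x. f x - f x * fourier (cplx (\<phi> n)) x) \<in> borel_measurable lborel" for n
    using borel_measurable_fourier[OF C0_inf_integrable[OF mollifier_C0_inf[OF \<phi>]], of n] by simp
  show "norm (f x - f x * fourier (cplx (\<phi> n)) x) \<le> norm (2 * f x)" for n x
  proof -
    have "norm (f x - f x * fourier (cplx (\<phi> n)) x) \<le> norm (f x) + norm (f x) * norm (fourier (cplx (\<phi> n)) x)"
      using norm_triangle_ineq4[of "f x" "f x * fourier (cplx (\<phi> n)) x"] by (simp add: norm_mult)
    also have "\<dots> \<le> norm (f x) + norm (f x) * 1"
      by (intro add_left_mono mult_left_mono mollifier_fourier_le_1[OF \<phi>]) simp
    finally show ?thesis by (simp add: norm_mult)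
  qed
  show "(\<lambda>n. f x - f x * fourier (cplx (\<phi> n)) x) \<longlonglongrightarrow> 0" for x
  proof -
    have "(\<lambda>n. fourier (cplx (\<phi> n)) x - 1) \<longlonglongrightarrow> 0"
    proof (rule Lim_null_comparison)
      show "\<forall>\<^sub>F n in sequentially. norm (fourier (cplx (\<phi> n)) x - 1) \<le> norm x * inverse (real (Suc n))"
        by (intro always_eventually allI mollifier_fourier_near_1 \<phi>)
      show "(\<lambda>n. norm x * inverse (real (Suc n))) \<longlonglongrightarrow> 0"
        by (intro tendsto_mult_right_zero LIMSEQ_inverse_real_of_nat)
    qed
    then have "(\<lambda>n. - f x * (fourier (cplx (\<phi> n)) x - 1)) \<longlonglongrightarrow> 0"
      by (rule tendsto_mult_right_zero)
    then show ?thesis by (simp add: algebra_simps)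
  qed
qed (use f in auto)

lemma Lp_int_minus_commute: "Lp_int r (\<lambda>x. f x - g x) = Lp_int r (\<lambda>x. g x - f x)"
  by (simp add: Lp_int_def norm_minus_commute)

lemma Lp_int_cong_AE: "AE x in lborel. f x = g x \<Longrightarrow> Lp_int r f = Lp_int r g"
  unfolding Lp_int_def by (intro nn_integral_cong_AE) (auto elim!: eventually_mono)

lemma mollifier_sequence_approx:
  fixes g :: "real^'n \<Rightarrow> complex"
  assumes "\<And>n. mollifier (inverse (real (Suc n))) (\<phi> n)"
    and "g \<in> borel_measurable borel" "Lp_int r g < \<infinity>" "1 \<le> r" "0 < (\<eta>::real)"
  shows "\<forall>\<^sub>F n in sequentially. Lp_int r (\<lambda>y. g y - conv g (cplx (\<phi> n)) y) \<le> ennreal \<eta>"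
proof -
  from mollifier_approximation[OF assms(2-5)]
  obtain d where d: "d > 0 \<and> (\<forall>d' \<phi>. d' \<le> d \<longrightarrow> mollifier d' \<phi> \<longrightarrow>
      Lp_int r (\<lambda>y. conv g (cplx \<phi>) y - g y) \<le> ennreal \<eta>)" ..
  have "\<forall>\<^sub>F n in sequentially. inverse (real (Suc n)) < d"
    using d by (intro order_tendstoD(2)[OF LIMSEQ_inverse_real_of_nat]) simp
  then show ?thesis
  proof eventually_elim
    fix n assume "inverse (real (Suc n)) < d"
    then have "Lp_int r (\<lambda>y. conv g (cplx (\<phi> n)) y - g y) \<le> ennreal \<eta>"
      using conjunct2[OF d, rule_format, OF less_imp_le assms(1)] by simp
    then show "Lp_int r (\<lambda>y. g y - conv g (cplx (\<phi> n)) y) \<le> ennreal \<eta>"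
      by (subst Lp_int_minus_commute)
  qed
qed

text \<open>The loss for a chain of three differences: two applications of the inequality with
  factor \<open>2 powr r\<close>, the second inside the first.\<close>

definition tri_const :: "real \<Rightarrow> real" where
  "tri_const r = 2 powr r * (1 + 2 * 2 powr r)"

lemma tri_const_pos: "0 < tri_const r"
  by (simp add: tri_const_def add_pos_pos)

lemma Lp_int_three_steps:
  fixes u v w z :: "real^'n \<Rightarrow> complex"
  assumes [measurable]: "u \<in> borel_measurable borel" "v \<in> borel_measurable borel"
      "w \<in> borel_measurable borel" "z \<in> borel_measurable borel"
    and le: "Lp_int r (\<lambda>x. u x - v x) \<le> ennreal \<delta>" "Lp_int r (\<lambda>x. v x - w x) \<le> ennreal \<delta>"
      "Lp_int r (\<lambda>x. w x - z x) \<le> ennreal \<delta>"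
    and r: "0 \<le> r" "0 \<le> \<delta>"
  shows "Lp_int r (\<lambda>x. u x - z x) \<le> ennreal (tri_const r * \<delta>)"
proof -
  have "Lp_int r (\<lambda>x. v x - z x) \<le> ennreal (2 powr r) * (Lp_int r (\<lambda>x. v x - w x) + Lp_int r (\<lambda>x. w x - z x))"
  proof (rule Lp_int_triangle)
    show "norm (v x - z x) \<le> norm (v x - w x) + norm (w x - z x)" for x
      using norm_triangle_ineq[of "v x - w x" "w x - z x"] by simp
  qed (use r in auto)
  also have "\<dots> \<le> ennreal (2 powr r) * (ennreal \<delta> + ennreal \<delta>)"
    by (intro mult_left_mono add_mono le) simp
  finally have 1: "Lp_int r (\<lambda>x. v x - z x) \<le> ennreal (2 powr r) * (ennreal \<delta> + ennreal \<delta>)" .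
  have "Lp_int r (\<lambda>x. u x - z x) \<le> ennreal (2 powr r) * (Lp_int r (\<lambda>x. u x - v x) + Lp_int r (\<lambda>x. v x - z x))"
  proof (rule Lp_int_triangle)
    show "norm (u x - z x) \<le> norm (u x - v x) + norm (v x - z x)" for x
      using norm_triangle_ineq[of "u x - v x" "v x - z x"] by simp
  qed (use r in auto)
  also have "\<dots> \<le> ennreal (2 powr r) * (ennreal \<delta> + ennreal (2 powr r) * (ennreal \<delta> + ennreal \<delta>))"
    by (intro mult_left_mono add_mono le 1) simp
  also have "\<dots> = ennreal (2 powr r * (\<delta> + 2 powr r * (\<delta> + \<delta>)))"
    using r by (simp add: ennreal_plus[symmetric] ennreal_mult[symmetric] del: ennreal_plus)
  also have "2 powr r * (\<delta> + 2 powr r * (\<delta> + \<delta>)) = tri_const r * \<delta>"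
    by (simp add: tri_const_def algebra_simps)
  finally show ?thesis .
qed

lemma fourier_diff:
  assumes "integrable lborel f" "integrable lborel g"
  shows "fourier (\<lambda>x. f x - g x) \<gamma> = fourier f \<gamma> - fourier g \<gamma>"
  using integrable_borel[OF assms(1)] integrable_borel[OF assms(2)]
    integrable_mult_cis[OF assms(1)] integrable_mult_cis[OF assms(2)]
  by (simp add: fourier_lborel left_diff_distrib)

text \<open>Sharp truncation followed by mollification stays in the test functions; on the Fourier side
  the error is dominated by the \<open>L^1\<close> error times the fixed function \<open>fourier k\<close>, which is in \<open>L^q\<close>.\<close>
lemma truncated_mollification:
  fixes F :: "real^'n \<Rightarrow> complex"
  assumes F: "integrable lborel F" and Fp: "Lp_int p F < \<infinity>" and p: "1 \<le> p" and q: "1 \<le> q"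
    and \<phi>: "mollifier d \<phi>" and \<delta>: "0 < (\<delta>::real)"
  defines "k \<equiv> \<lambda>x. complex_of_real (\<phi> x)"
  shows "\<exists>h. C0_inf h \<and> Lp_int p (\<lambda>x. conv F k x - h x) \<le> ennreal \<delta>
      \<and> Lp_int q (\<lambda>x. fourier F x * fourier k x - fourier h x) \<le> ennreal \<delta>"
proof -
  have kC: "C0_inf k" unfolding k_def using \<phi> by (rule mollifier_C0_inf)
  have kint: "integrable lborel k" using kC by (rule C0_inf_integrable)
  have kb: "bounded_smooth k" using kC by (rule C0_inf_bounded_smooth)
  have [measurable]: "F \<in> borel_measurable borel" using F by (rule integrable_borel)
  define T where "T n x = (if norm x \<le> real n then F x else 0)" for n x
  have [measurable]: "T n \<in> borel_measurable borel" for n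
    unfolding T_def by measurable
  have Tint: "integrable lborel (T n)" for n
    by (rule Bochner_Integration.integrable_bound[OF F]) (auto simp: T_def)
  have Tlim: "(\<lambda>n. F x - T n x) \<longlonglongrightarrow> 0" for x
  proof (rule tendsto_eventually)
    show "\<forall>\<^sub>F n in sequentially. F x - T n x = 0"
      using eventually_ge_at_top[of "nat \<lceil>norm x\<rceil>"]
    proof eventually_elim
      fix n assume "nat \<lceil>norm x\<rceil> \<le> n"
      then have "norm x \<le> real n" by linarith
      then show "F x - T n x = 0" by (simp add: T_def)
    qed
  qed
  have Tle: "norm (F x - T n x) \<le> norm (F x)" for n x
    by (simp add: T_def)
  have hC: "C0_inf (conv (T n) k)" for n
  \<comment> \<open>Supports add under convolution: radius \<open>n\<close> from the cutoff and
    \<open>d\<close> from the mollifier.\<close>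
  proof (rule C0_infI[where R = "real n + d"])
    show "smooth_fun (conv (T n) k)"
      using Tint kb by (rule smooth_fun_conv)
    fix x :: "real^'n" assume x: "real n + d < norm x"
    have "T n w * k (x - w) = 0" for w
    proof (cases "norm w \<le> real n")
      case True
      then have "d < norm (x - w)"
        using x norm_triangle_ineq2[of x w] by linarith
      then show ?thesis using \<phi> by (simp add: k_def mollifier_def)
    qed (simp add: T_def)
    then show "conv (T n) k x = 0"
      unfolding conv_def by (simp only: Bochner_Integration.integral_zero)
  qed
  have conv_eq: "conv F k x - conv (T n) k x = conv (\<lambda>x. F x - T n x) k x" for n x
    unfolding conv_def left_diff_distrib
    using conv_integrable[OF F kb] conv_integrable[OF Tint kb]
    by (rule Bochner_Integration.integral_diff[symmetric])
  have "(\<lambda>n. Lp_int p (\<lambda>x. F x - T n x)) \<longlonglongrightarrow> 0"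
    by (rule Lp_int_dominated[where f = F]) (use Fp p Tle Tlim in auto)
  then have "\<forall>\<^sub>F n in sequentially. Lp_int p (\<lambda>x. F x - T n x) < ennreal \<delta>"
    using \<delta> by (intro order_tendstoD(2)) auto
  moreover
  define e where "e n = (\<integral>x. norm (F x - T n x) \<partial>lborel)" for n
  have "e \<longlonglongrightarrow> (\<integral>x. 0 \<partial>(lborel :: (real^'n) measure))"
    unfolding e_def
  proof (rule integral_dominated_convergence[where w = "\<lambda>x. norm (F x)"])
    show "AE x in lborel. (\<lambda>n. norm (F x - T n x)) \<longlonglongrightarrow> 0"
      using Tlim by (intro always_eventually allI tendsto_norm_zero)
  qed (use F Tle in auto)
  then have e0: "e \<longlonglongrightarrow> 0" by simp
  have epos: "0 \<le> e n" for n by (simp add: e_def)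
  have kq: "Lp_int q (fourier k) < \<infinity>"
    using kC q by (rule fourier_C0_inf_Lp_finite)
  have "(\<lambda>n. e n powr q) \<longlonglongrightarrow> 0 powr q"
    using q epos by (intro tendsto_powr2 e0 tendsto_const) (auto intro: always_eventually)
  then have "(\<lambda>n. ennreal (e n powr q)) \<longlonglongrightarrow> ennreal 0"
    using q by (intro tendsto_ennrealI) simp
  then have "(\<lambda>n. Lp_int q (fourier k) * ennreal (e n powr q)) \<longlonglongrightarrow> Lp_int q (fourier k) * ennreal 0"
    using kq by (intro ennreal_tendsto_cmult) auto
  then have "\<forall>\<^sub>F n in sequentially. Lp_int q (fourier k) * ennreal (e n powr q) < ennreal \<delta>"
    using \<delta> by (intro order_tendstoD(2)) auto
  ultimately have "\<forall>\<^sub>F n in sequentially. Lp_int p (\<lambda>x. F x - T n x) < ennreal \<delta> \<and>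
      Lp_int q (fourier k) * ennreal (e n powr q) < ennreal \<delta>"
    by (rule eventually_conj)
  then obtain n where n: "Lp_int p (\<lambda>x. F x - T n x) < ennreal \<delta>"
      "Lp_int q (fourier k) * ennreal (e n powr q) < ennreal \<delta>"
    unfolding eventually_sequentially by blast
  show ?thesis
  proof (intro exI conjI)
    show "C0_inf (conv (T n) k)" by (rule hC)
    have "Lp_int p (conv (\<lambda>x. F x - T n x) k) \<le> Lp_int p (\<lambda>x. F x - T n x)"
      unfolding k_def using p by (intro conv_Lp_int_le[OF _ \<phi>]) auto
    then have "Lp_int p (\<lambda>x. conv F k x - conv (T n) k x) \<le> Lp_int p (\<lambda>x. F x - T n x)"
      by (simp only: conv_eq)
    then show "Lp_int p (\<lambda>x. conv F k x - conv (T n) k x) \<le> ennreal \<delta>"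
      using n by simp
    have "norm (fourier F x * fourier k x - fourier (conv (T n) k) x) \<le> e n * norm (fourier k x)" for x
    proof -
      have "fourier F x * fourier k x - fourier (conv (T n) k) x = fourier (\<lambda>x. F x - T n x) x * fourier k x"
        by (simp add: fourier_conv[OF Tint kint] fourier_diff[OF F Tint] left_diff_distrib)
      moreover have "norm (fourier (\<lambda>x. F x - T n x) x) \<le> e n"
        unfolding e_def using F Tint by (intro norm_fourier_le Bochner_Integration.integrable_diff)
      ultimately show ?thesis
        by (simp add: norm_mult mult_right_mono)
    qed
    then have "Lp_int q (\<lambda>x. fourier F x * fourier k x - fourier (conv (T n) k) x) \<le> ennreal (e n powr q) * Lp_int q (fourier k)"
      using borel_measurable_fourier[OF kint] epos q by (intro Lp_int_cmult) auto
    then show "Lp_int q (\<lambda>x. fourier F x * fourier k x - fourier (conv (T n) k) x) \<le> ennreal \<delta>"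
      using n(2) by (simp add: mult.commute)
  qed
qed

text \<open>Two parallel chains of three steps: \<open>f\<close>, \<open>F\<close>,
  \<open>conv F (k m)\<close>, \<open>h\<close> in space, and \<open>g\<close>,
  \<open>fourier F\<close>, \<open>fourier F * fourier (k m)\<close>, \<open>fourier h\<close> in
  frequency. At each stage one index is taken large enough for both chains, since each convergence
  holds eventually.\<close>

lemma test_function_approx_borel:
  fixes f g :: "real^'n \<Rightarrow> complex"
  assumes [measurable]: "f \<in> borel_measurable borel" "g \<in> borel_measurable borel"
    and fg: "has_fourier f g" and p: "1 < p" and q: "1 < q"
    and fp: "Lp_int p f < \<infinity>" and gq: "Lp_int q g < \<infinity>" and \<eta>: "0 < (\<eta>::real)"
  shows "\<exists>h. C0_inf h \<and> Lp_int p (\<lambda>x. f x - h x) \<le> ennreal \<eta> \<and> Lp_int q (\<lambda>x. g x - fourier h x) \<le> ennreal \<eta>"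
proof -
  \<comment> \<open>Dividing by the sum makes both \<open>tri_const p * \<delta>\<close> and
    \<open>tri_const q * \<delta>\<close> at most \<open>\<eta>\<close>.\<close>
  define \<delta> where "\<delta> = \<eta> / (tri_const p + tri_const q)"
  have \<delta>: "0 < \<delta>"
    using \<eta> tri_const_pos[of p] tri_const_pos[of q] by (simp add: \<delta>_def)
  have "(tri_const p + tri_const q) * \<delta> = \<eta>"
    using tri_const_pos[of p] tri_const_pos[of q] by (simp add: \<delta>_def)
  then have sum: "tri_const p * \<delta> + tri_const q * \<delta> = \<eta>"
    by (simp only: distrib_right)
  have \<delta>\<eta>: "tri_const p * \<delta> \<le> \<eta>" "tri_const q * \<delta> \<le> \<eta>"
    using sum mult_pos_pos[OF tri_const_pos \<delta>, of p] mult_pos_pos[OF tri_const_pos \<delta>, of q] by linarith+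
  obtain \<phi> :: "nat \<Rightarrow> real^'n \<Rightarrow> real" where \<phi>: "\<And>n. mollifier (inverse (real (Suc n))) (\<phi> n)"
    using mollifier_sequence by blast
  define k where "k n x = complex_of_real (\<phi> n x)" for n x
  have kC: "C0_inf (k n)" for n unfolding k_def using mollifier_C0_inf[OF \<phi>] .
  have kint: "integrable lborel (k n)" for n using kC by (rule C0_inf_integrable)
  have [measurable]: "k n \<in> borel_measurable borel" "fourier (k n) \<in> borel_measurable borel" for n
    using kint[of n] by (auto intro: integrable_borel borel_measurable_fourier)
  have "(\<lambda>n. Lp_int p (\<lambda>x. f x - f x * fourier (k n) x)) \<longlonglongrightarrow> 0"
    unfolding k_def using p fp by (intro mollifier_Lp_tendsto \<phi>) auto
  then have "\<forall>\<^sub>F n in sequentially. Lp_int p (\<lambda>x. f x - f x * fourier (k n) x) < ennreal \<delta>"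
    using \<delta> by (intro order_tendstoD(2)) auto
  moreover have "\<forall>\<^sub>F n in sequentially. Lp_int q (\<lambda>x. g x - conv g (k n) x) \<le> ennreal \<delta>"
    unfolding k_def using q gq \<delta> by (intro mollifier_sequence_approx \<phi>) auto
  ultimately have "\<forall>\<^sub>F n in sequentially. Lp_int p (\<lambda>x. f x - f x * fourier (k n) x) < ennreal \<delta> \<and>
      Lp_int q (\<lambda>x. g x - conv g (k n) x) \<le> ennreal \<delta>"
    by (rule eventually_conj)
  then obtain n where n: "Lp_int p (\<lambda>x. f x - f x * fourier (k n) x) < ennreal \<delta>"
      "Lp_int q (\<lambda>x. g x - conv g (k n) x) \<le> ennreal \<delta>"
    unfolding eventually_sequentially by blast
  define F where "F x = f x * fourier (k n) x" for x
  obtain p' where p': "1 < p'" "1 / p + 1 / p' = 1"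
    using conjugate_exponent[OF p] .
  have F: "integrable lborel F"
    unfolding F_def using p p' fp fourier_C0_inf_Lp_finite[OF kC, of p' n]
    by (intro integrable_Lp_mult[where q = p and q' = p']) auto
  have [measurable]: "F \<in> borel_measurable borel" "fourier F \<in> borel_measurable borel"
    using F by (auto intro: integrable_borel borel_measurable_fourier)
  have Fp: "Lp_int p F < \<infinity>"
  proof (rule le_less_trans[OF _ fp], rule Lp_int_mono)
    show "norm (F x) \<le> norm (f x)" for x
      using mollifier_fourier_le_1[OF \<phi>, of n x] unfolding F_def norm_mult k_def
      by (simp add: mult_left_le)
  qed (use p in simp)
  have "has_fourier F (conv g (k n))"
    unfolding F_def[abs_def] k_def
  proof (rule has_fourier_modulation[OF _ _ fg q gq \<phi>])
    show "integrable lborel (\<lambda>x. f x * fourier (cplx (\<phi> n)) x)"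
      using F unfolding F_def[abs_def] k_def .
  qed auto
  \<comment> \<open>Uniqueness identifies the classical transform of the integrable \<open>F\<close>
    with the mollified \<open>g\<close>. This puts \<open>fourier F\<close> in \<open>L^q\<close>
    and close to \<open>g\<close>.\<close>
  then have ae: "AE x in lborel. fourier F x = conv g (k n) x"
    using has_fourier_integrable[OF F] by (intro has_fourier_unique)
  have "Lp_int q (conv g (k n)) \<le> Lp_int q g"
    unfolding k_def using q by (intro conv_Lp_int_le[OF _ \<phi>]) auto
  then have Fq: "Lp_int q (fourier F) < \<infinity>"
    using gq Lp_int_cong_AE[OF ae, of q] by simp
  have "AE x in lborel. g x - fourier F x = g x - conv g (k n) x"
    using ae by eventually_elim simp
  from Lp_int_cong_AE[OF this] n(2) have gF: "Lp_int q (\<lambda>x. g x - fourier F x) \<le> ennreal \<delta>"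
    by simp
  have "\<forall>\<^sub>F m in sequentially. Lp_int p (\<lambda>x. F x - conv F (k m) x) \<le> ennreal \<delta>"
    unfolding k_def using p Fp \<delta> by (intro mollifier_sequence_approx \<phi>) auto
  moreover have "(\<lambda>m. Lp_int q (\<lambda>x. fourier F x - fourier F x * fourier (k m) x)) \<longlonglongrightarrow> 0"
    unfolding k_def using q Fq by (intro mollifier_Lp_tendsto \<phi>) auto
  then have "\<forall>\<^sub>F m in sequentially. Lp_int q (\<lambda>x. fourier F x - fourier F x * fourier (k m) x) < ennreal \<delta>"
    using \<delta> by (intro order_tendstoD(2)) auto
  ultimately have "\<forall>\<^sub>F m in sequentially. Lp_int p (\<lambda>x. F x - conv F (k m) x) \<le> ennreal \<delta> \<and>
     Lp_int q (\<lambda>x. fourier F x - fourier F x * fourier (k m) x) < ennreal \<delta>"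
    by (rule eventually_conj)
  then obtain m where m: "Lp_int p (\<lambda>x. F x - conv F (k m) x) \<le> ennreal \<delta>"
     "Lp_int q (\<lambda>x. fourier F x - fourier F x * fourier (k m) x) < ennreal \<delta>"
    unfolding eventually_sequentially by blast
  obtain h where h: "C0_inf h" "Lp_int p (\<lambda>x. conv F (k m) x - h x) \<le> ennreal \<delta>"
      "Lp_int q (\<lambda>x. fourier F x * fourier (k m) x - fourier h x) \<le> ennreal \<delta>"
    using truncated_mollification[OF F Fp less_imp_le[OF p] less_imp_le[OF q] \<phi> \<delta>, of m]
    unfolding k_def by blast
  have [measurable]: "h \<in> borel_measurable borel" "fourier h \<in> borel_measurable borel"
    using C0_inf_integrable[OF h(1)] by (auto intro: integrable_borel borel_measurable_fourier)
  have [measurable]: "conv F (k m) \<in> borel_measurable borel"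
    using integrable_conv[OF F kint] by (rule integrable_borel)
  have "Lp_int p (\<lambda>x. f x - h x) \<le> ennreal (tri_const p * \<delta>)"
    by (rule Lp_int_three_steps[where v = F and w = "conv F (k m)"])
       (use n m h p \<delta> in \<open>auto simp: F_def\<close>)
  then have 1: "Lp_int p (\<lambda>x. f x - h x) \<le> ennreal \<eta>"
    using \<delta>\<eta>(1) by (meson ennreal_leI order_trans)
  have "Lp_int q (\<lambda>x. g x - fourier h x) \<le> ennreal (tri_const q * \<delta>)"
    by (rule Lp_int_three_steps[where v = "fourier F" and w = "\<lambda>x. fourier F x * fourier (k m) x"])
       (use gF m h q \<delta> in auto)
  then have "Lp_int q (\<lambda>x. g x - fourier h x) \<le> ennreal \<eta>"
    using \<delta>\<eta>(2) by (meson ennreal_leI order_trans)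
  with 1 h(1) show ?thesis by blast
qed

section \<open>Grand Lebesgue spaces\<close>

lemma Lp_int_lebesgue: "Lp_int r f = (\<integral>\<^sup>+x. ennreal (norm (f x) powr r) \<partial>lebesgue)"
  by (simp add: Lp_int_def nn_integral_completion)

lemma in_Lp_iff: "in_Lp r f \<longleftrightarrow> f \<in> borel_measurable lebesgue \<and> Lp_int r f < \<infinity>"
  by (simp add: in_Lp_def Lp_int_lebesgue)

lemma Lp_norm_le:
  assumes "Lp_int r f \<le> ennreal (s powr r)" "0 < r" "0 \<le> s"
  shows "Lp_norm r f \<le> s"
proof -
  have "enn2real (Lp_int r f) \<le> s powr r"
    using assms(1) by (intro enn2real_leI) auto
  then have "enn2real (Lp_int r f) powr (1 / r) \<le> (s powr r) powr (1 / r)"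
    using assms by (intro powr_mono2) auto
  also have "\<dots> = s"
    using assms by (simp add: powr_powr)
  finally show ?thesis
    by (simp add: Lp_norm_def Lp_int_lebesgue)
qed

lemma has_fourier_diff:
  fixes f g :: "real^'n \<Rightarrow> complex"
  assumes "has_fourier f g" "has_fourier h k"
  shows "has_fourier (f - h) (\<lambda>x. g x - k x)"
  unfolding has_fourier_def
proof (intro conjI allI impI)
  have "g \<in> borel_measurable lebesgue" "k \<in> borel_measurable lebesgue"
    using assms by (auto simp: has_fourier_def)
  then show "(\<lambda>x. g x - k x) \<in> borel_measurable lebesgue"
    by (rule borel_measurable_diff)
  fix \<phi> :: "real^'n \<Rightarrow> complex" assume \<phi>: "schwartz \<phi>"
  have i: "integrable lebesgue (\<lambda>x. g x * \<phi> x)" "integrable lebesgue (\<lambda>x. k x * \<phi> x)"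
      "integrable lebesgue (\<lambda>x. f x * fourier \<phi> x)" "integrable lebesgue (\<lambda>x. h x * fourier \<phi> x)"
      "(\<integral>x. g x * \<phi> x \<partial>lebesgue) = (\<integral>x. f x * fourier \<phi> x \<partial>lebesgue)"
      "(\<integral>x. k x * \<phi> x \<partial>lebesgue) = (\<integral>x. h x * fourier \<phi> x \<partial>lebesgue)"
    using assms \<phi> unfolding has_fourier_def by auto
  show "integrable lebesgue (\<lambda>x. (g x - k x) * \<phi> x)"
    using i by (simp add: left_diff_distrib)
  show "integrable lebesgue (\<lambda>x. (f - h) x * fourier \<phi> x)"
    using i by (simp add: left_diff_distrib)
  show "(\<integral>x. (g x - k x) * \<phi> x \<partial>lebesgue) = (\<integral>x. (f - h) x * fourier \<phi> x \<partial>lebesgue)"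
    using i by (simp add: left_diff_distrib)
qed

lemma has_fourier_cong_AE:
  fixes f g f' g' :: "real^'n \<Rightarrow> complex"
  assumes fg: "has_fourier f g"
    and m: "f \<in> borel_measurable lebesgue" "f' \<in> borel_measurable borel" "g' \<in> borel_measurable borel"
    and ae: "AE x in lborel. f x = f' x" "AE x in lborel. g x = g' x"
  shows "has_fourier f' g'"
  unfolding has_fourier_def
proof (intro conjI allI impI)
  have gm: "g \<in> borel_measurable lebesgue" using fg by (simp add: has_fourier_def)
  have f'm: "f' \<in> borel_measurable lebesgue" "g' \<in> borel_measurable lebesgue"
    using m by (auto intro: measurable_completion)
  show "g' \<in> borel_measurable lebesgue" by fact
  fix \<phi> :: "real^'n \<Rightarrow> complex" assume \<phi>: "schwartz \<phi>"
  have "\<phi> \<in> borel_measurable lborel" "fourier \<phi> \<in> borel_measurable lborel"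
    using integrable_borel[OF schwartz_integrable[OF \<phi>]] borel_measurable_fourier[OF schwartz_integrable[OF \<phi>]] by auto
  then have \<phi>m: "\<phi> \<in> borel_measurable lebesgue" "fourier \<phi> \<in> borel_measurable lebesgue"
    by (auto intro: measurable_completion)
  have i: "integrable lebesgue (\<lambda>x. g x * \<phi> x)" "integrable lebesgue (\<lambda>x. f x * fourier \<phi> x)"
    "(\<integral>x. g x * \<phi> x \<partial>lebesgue) = (\<integral>x. f x * fourier \<phi> x \<partial>lebesgue)"
    using fg \<phi> unfolding has_fourier_def by auto
  have a1: "AE x in lebesgue. g x * \<phi> x = g' x * \<phi> x"
    using AE_completion[OF ae(2)] by eventually_elim simp
  have a2: "AE x in lebesgue. f x * fourier \<phi> x = f' x * fourier \<phi> x"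
    using AE_completion[OF ae(1)] by eventually_elim simp
  have m1: "(\<lambda>x. g x * \<phi> x) \<in> borel_measurable lebesgue" "(\<lambda>x. g' x * \<phi> x) \<in> borel_measurable lebesgue"
    and m2: "(\<lambda>x. f x * fourier \<phi> x) \<in> borel_measurable lebesgue" "(\<lambda>x. f' x * fourier \<phi> x) \<in> borel_measurable lebesgue"
    using gm f'm m \<phi>m by auto
  show "integrable lebesgue (\<lambda>x. g' x * \<phi> x)"
    using i(1) integrable_cong_AE[OF m1 a1] by simp
  show "integrable lebesgue (\<lambda>x. f' x * fourier \<phi> x)"
    using i(2) integrable_cong_AE[OF m2 a2] by simp
  show "(\<integral>x. g' x * \<phi> x \<partial>lebesgue) = (\<integral>x. f' x * fourier \<phi> x \<partial>lebesgue)"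
    using i(3) integral_cong_AE[OF m1 a1] integral_cong_AE[OF m2 a2] by simp
qed

text \<open>The pairings and \<open>Lp_int\<close> depend only on classes modulo null sets, so Borel
  representatives may replace \<open>f\<close> and \<open>g\<close>.\<close>

lemma test_function_approx:
  fixes f g :: "real^'n \<Rightarrow> complex"
  assumes fg: "has_fourier f g" and p: "1 < p" and q: "1 < q" and f: "in_Lp p f" and g: "in_Lp q g"
    and \<eta>: "0 < (\<eta>::real)"
  shows "\<exists>h. C0_inf h \<and> Lp_int p (\<lambda>x. f x - h x) \<le> ennreal \<eta> \<and> Lp_int q (\<lambda>x. g x - fourier h x) \<le> ennreal \<eta>"
proof -
  have fm: "f \<in> borel_measurable lebesgue" and gm: "g \<in> borel_measurable lebesgue"
    using f g by (auto simp: in_Lp_iff)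
  obtain f' where f': "f' \<in> borel_measurable lborel" "AE x in lborel. f x = f' x"
    using complex_ex_borel[OF fm] .
  obtain g' where g': "g' \<in> borel_measurable lborel" "AE x in lborel. g x = g' x"
    using complex_ex_borel[OF gm] .
  have b: "f' \<in> borel_measurable borel" "g' \<in> borel_measurable borel" using f'(1) g'(1) by auto
  have "\<exists>h. C0_inf h \<and> Lp_int p (\<lambda>x. f' x - h x) \<le> ennreal \<eta> \<and> Lp_int q (\<lambda>x. g' x - fourier h x) \<le> ennreal \<eta>"
  proof (rule test_function_approx_borel[OF b _ p q _ _ \<eta>])
    show "has_fourier f' g'"
      by (rule has_fourier_cong_AE[OF fg fm b f'(2) g'(2)])
    show "Lp_int p f' < \<infinity>" "Lp_int q g' < \<infinity>"
      using f g Lp_int_cong_AE[OF f'(2), of p] Lp_int_cong_AE[OF g'(2), of q] by (auto simp: in_Lp_iff)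
  qed
  then obtain h where h: "C0_inf h" "Lp_int p (\<lambda>x. f' x - h x) \<le> ennreal \<eta>" "Lp_int q (\<lambda>x. g' x - fourier h x) \<le> ennreal \<eta>"
    by blast
  have "AE x in lborel. f x - h x = f' x - h x" "AE x in lborel. g x - fourier h x = g' x - fourier h x"
    using f'(2) g'(2) by (auto elim!: eventually_mono)
  from this[THEN Lp_int_cong_AE] h show ?thesis
    by (intro exI[of _ h]) simp
qed

lemma C0_inf_has_fourier: "C0_inf h \<Longrightarrow> has_fourier h (fourier h)"
  by (intro has_fourier_integrable C0_inf_integrable)

lemma C0_inf_in_Lp:
  assumes "C0_inf h" "1 \<le> r" shows "in_Lp r h" "in_Lp r (fourier h)"
proof -
  have "h \<in> borel_measurable lborel" "fourier h \<in> borel_measurable lborel"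
    using C0_inf_borel[OF assms(1)] borel_measurable_fourier[OF C0_inf_integrable[OF assms(1)]] by auto
  then have "h \<in> borel_measurable lebesgue" "fourier h \<in> borel_measurable lebesgue"
    by (auto intro: measurable_completion)
  then show "in_Lp r h" "in_Lp r (fourier h)"
    using assms schwartz_Lp_finite[OF C0_inf_schwartz] fourier_C0_inf_Lp_finite
    by (auto simp: in_Lp_iff)
qed

lemma C0_inf_in_Apq: "C0_inf h \<Longrightarrow> 1 < p \<Longrightarrow> 1 < q \<Longrightarrow> in_Apq p q h"
  unfolding in_Apq_def using C0_inf_in_Lp C0_inf_has_fourier by (metis less_imp_le)

lemma in_Lp_diff:
  assumes "in_Lp r f" "in_Lp r g" "0 \<le> r" shows "in_Lp r (\<lambda>x. f x - g x)"
proof -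
  have m: "f \<in> borel_measurable lebesgue" "g \<in> borel_measurable lebesgue"
    and fin: "Lp_int r f < \<infinity>" "Lp_int r g < \<infinity>"
    using assms by (auto simp: in_Lp_iff)
  obtain f' where f': "f' \<in> borel_measurable lborel" "AE x in lborel. f x = f' x"
    using complex_ex_borel[OF m(1)] .
  obtain g' where g': "g' \<in> borel_measurable lborel" "AE x in lborel. g x = g' x"
    using complex_ex_borel[OF m(2)] .
  have "AE x in lborel. f x - g x = f' x - g' x"
    using f'(2) g'(2) by eventually_elim simp
  from Lp_int_cong_AE[OF this, of r]
  have "Lp_int r (\<lambda>x. f x - g x) \<le> ennreal (2 powr r) * (Lp_int r f' + Lp_int r g')"
    using Lp_int_triangle[OF f'(1) g'(1) assms(3), where h = "\<lambda>x. f' x - g' x", OF norm_triangle_ineq4]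
    by simp
  also have "\<dots> < \<infinity>"
    using fin Lp_int_cong_AE[OF f'(2), of r] Lp_int_cong_AE[OF g'(2), of r] by (simp add: ennreal_mult_less_top)
  finally show ?thesis using m by (simp add: in_Lp_iff)
qed

lemma Apq_density:
  fixes f :: "real^'n \<Rightarrow> complex"
  assumes f: "in_Apq p q f" and p: "1 < p" and q: "1 < q" and e: "0 < e"
  shows "\<exists>h. C0_inf h \<and> Apq_norm p q (f - h) < e"
proof -
  obtain g where fg: "has_fourier f g" and fp: "in_Lp p f" and gq: "in_Lp q g"
    using f unfolding in_Apq_def by blast
  \<comment> \<open>Each of the two norms will be at most \<open>s\<close>, with sum
    \<open>2 * e / 3 < e\<close>. Since \<open>Lp_int\<close> is a power of the norm,
    \<open>\<eta>\<close> must lie below both \<open>s powr p\<close> and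
    \<open>s powr q\<close>.\<close>
  define s where "s = e / 3"
  have s: "0 < s" using e by (simp add: s_def)
  define \<eta> where "\<eta> = min (s powr p) (s powr q)"
  have \<eta>: "0 < \<eta>" using s by (simp add: \<eta>_def)
  obtain h where h: "C0_inf h" "Lp_int p (\<lambda>x. f x - h x) \<le> ennreal \<eta>" "Lp_int q (\<lambda>x. g x - fourier h x) \<le> ennreal \<eta>"
    using test_function_approx[OF fg p q fp gq \<eta>] by blast
  \<comment> \<open>The transform picked by the norm need not be \<open>g - fourier h\<close>, but
    it agrees with it almost everywhere.\<close>
  define G where "G = (SOME G. has_fourier (f - h) G \<and> in_Lp q G)"
  have d: "has_fourier (f - h) (\<lambda>x. g x - fourier h x)"
    using fg C0_inf_has_fourier[OF h(1)] by (rule has_fourier_diff)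
  moreover have "in_Lp q (\<lambda>x. g x - fourier h x)"
    using gq C0_inf_in_Lp(2)[OF h(1)] q by (intro in_Lp_diff) auto
  ultimately have "has_fourier (f - h) G \<and> in_Lp q G"
    unfolding G_def by (intro someI[of "\<lambda>G. has_fourier (f - h) G \<and> in_Lp q G"] conjI)
  then have "AE x in lborel. G x = g x - fourier h x"
    using d by (intro has_fourier_unique) auto
  then have "Lp_int q G \<le> ennreal \<eta>"
    using h(3) Lp_int_cong_AE by metis
  also have "\<dots> \<le> ennreal (s powr q)"
    by (intro ennreal_leI) (simp add: \<eta>_def)
  finally have 1: "Lp_norm q G \<le> s"
    using q s by (intro Lp_norm_le) auto
  have "Lp_int p (f - h) \<le> ennreal \<eta>"
    using h(2) by (simp add: fun_diff_def)
  also have "\<dots> \<le> ennreal (s powr p)"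
    by (intro ennreal_leI) (simp add: \<eta>_def)
  finally have "Lp_norm p (f - h) \<le> s"
    using p s by (intro Lp_norm_le) auto
  with 1 have "Apq_norm p q (f - h) < e"
    using e by (simp add: Apq_norm_def G_def[symmetric] s_def)
  with h(1) show ?thesis by blast
qed

text \<open>Weighted Young inequality for \<open>(t / s) powr p\<close> and \<open>a\<close> with
  the exponents \<open>(p - \<epsilon>) / p\<close> and \<open>\<epsilon> / p\<close>. The scale
  \<open>s\<close> stands for the size of the \<open>L^p\<close> norm: after integration the bracket
  is at most 1 plus the integral of the weight.\<close>

lemma weight_interpolation:
  assumes "0 < \<epsilon>" "\<epsilon> < p" "0 < s" "0 \<le> t" "0 \<le> (a::real)"
  shows "t powr (p - \<epsilon>) * a powr (\<epsilon> / p) \<le> s powr (p - \<epsilon>) * (s powr (- p) * t powr p + a)"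
proof (cases "t = 0 \<or> a = 0")
  \<comment> \<open>The left side is 0 here, because \<open>0 powr x = 0\<close> for every
    exponent.\<close>
  case True
  then show ?thesis using assms by auto
next
  case False
  have p: "0 < p" using assms by linarith
  define \<alpha> where "\<alpha> = (p - \<epsilon>) / p"
  define \<beta> where "\<beta> = \<epsilon> / p"
  have ab: "0 \<le> \<alpha>" "0 \<le> \<beta>" "\<alpha> + \<beta> = 1" "\<alpha> \<le> 1" "\<beta> \<le> 1"
    using assms p by (auto simp: \<alpha>_def \<beta>_def field_simps)
  define X where "X = (t / s) powr p"
  have X: "0 < X" using False assms by (simp add: X_def)
  have "X powr \<alpha> * a powr \<beta> \<le> \<alpha> * X + \<beta> * a"
    using ab X False assms by (intro Youngs_inequality_0) auto
  also have "\<dots> \<le> 1 * X + 1 * a"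
    using ab X assms by (intro add_mono mult_right_mono) auto
  finally have "X powr \<alpha> * a powr \<beta> \<le> X + a" by simp
  moreover have "X powr \<alpha> = (t / s) powr (p - \<epsilon>)"
    using p by (simp add: X_def \<alpha>_def powr_powr)
  moreover have "(t / s) powr r * s powr r = t powr r" for r
    using assms by (simp add: powr_divide)
  ultimately have "t powr (p - \<epsilon>) * a powr \<beta> \<le> s powr (p - \<epsilon>) * (X + a)"
    using mult_left_mono[of "(t / s) powr (p - \<epsilon>) * a powr \<beta>" "X + a" "s powr (p - \<epsilon>)"]
    by (simp add: mult_ac)
  moreover have "X = s powr (- p) * t powr p"
    using powr_divide[of t s p] assms by (simp add: X_def powr_minus divide_inverse mult.commute del: powr_divide)
  ultimately show ?thesis
    by (simp add: \<beta>_def)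
qed

text \<open>Here \<open>s\<close> is any positive upper bound for the \<open>L^p\<close> norm, so
  \<open>u = 0\<close> needs no separate treatment and the final bound is linear in
  \<open>s\<close>.\<close>

lemma GLp_embedding:
  fixes a :: "real^'n \<Rightarrow> real" and u :: "real^'n \<Rightarrow> complex"
  assumes a: "weight a" "integrable lebesgue a" and p: "1 < p" and \<theta>: "0 \<le> \<theta>"
    and u: "u \<in> borel_measurable lebesgue" "Lp_int p u \<le> ennreal (s powr p)" and s: "0 < s"
  shows "in_GLp a p \<theta> u \<and> GLp_norm a p \<theta> u \<le> (p - 1) powr \<theta> * (1 + integral\<^sup>L lebesgue a) * s"
proof -
  have a0: "0 \<le> a x" for x using a by (simp add: weight_def)
  define K where "K = 1 + integral\<^sup>L lebesgue a"
  have K: "1 \<le> K" using a0 by (simp add: K_def)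
  have ai: "(\<integral>\<^sup>+x. ennreal (a x) \<partial>lebesgue) = ennreal (integral\<^sup>L lebesgue a)"
    using a a0 by (intro nn_integral_eq_integral) auto
  have int: "glp_int a p u \<epsilon> \<le> ennreal (s powr (p - \<epsilon>) * K)" if \<epsilon>: "\<epsilon> \<in> {0<..p-1}" for \<epsilon>
  proof -
    have "glp_int a p u \<epsilon> \<le> (\<integral>\<^sup>+x. ennreal (s powr (p - \<epsilon>)) * (ennreal (s powr (- p)) * ennreal (norm (u x) powr p) + ennreal (a x)) \<partial>lebesgue)"
      unfolding glp_int_def
    proof (rule nn_integral_mono)
      fix x
      have "norm (u x) powr (p - \<epsilon>) * a x powr (\<epsilon> / p) \<le> s powr (p - \<epsilon>) * (s powr (- p) * norm (u x) powr p + a x)"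
        using \<epsilon> s a0 by (intro weight_interpolation) auto
      then show "ennreal (norm (u x) powr (p - \<epsilon>) * a x powr (\<epsilon> / p)) \<le>
          ennreal (s powr (p - \<epsilon>)) * (ennreal (s powr (- p)) * ennreal (norm (u x) powr p) + ennreal (a x))"
        using a0[of x] by (simp add: ennreal_mult[symmetric] ennreal_plus[symmetric] ennreal_leI del: ennreal_plus)
    qed
    also have "\<dots> = ennreal (s powr (p - \<epsilon>)) * (ennreal (s powr (- p)) * Lp_int p u + ennreal (integral\<^sup>L lebesgue a))"
      using u a unfolding Lp_int_lebesgue ai[symmetric] by (simp add: nn_integral_cmult nn_integral_add weight_def)
    also have "\<dots> \<le> ennreal (s powr (p - \<epsilon>)) * (ennreal (s powr (- p)) * ennreal (s powr p) + ennreal (integral\<^sup>L lebesgue a))"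
      by (intro mult_left_mono add_right_mono u) auto
    also have "ennreal (s powr (- p)) * ennreal (s powr p) = ennreal 1"
      using s by (simp add: ennreal_mult[symmetric] powr_add[symmetric])
    also have "ennreal 1 + ennreal (integral\<^sup>L lebesgue a) = ennreal K"
      unfolding K_def using a0 by (intro ennreal_plus[symmetric]) auto
    also have "ennreal (s powr (p - \<epsilon>)) * ennreal K = ennreal (s powr (p - \<epsilon>) * K)"
      using K by (intro ennreal_mult[symmetric]) auto
    finally show ?thesis .
  qed
  have tb: "glp_term a p \<theta> u \<epsilon> \<le> (p - 1) powr \<theta> * K * s" if \<epsilon>: "\<epsilon> \<in> {0<..p-1}" for \<epsilon>
  proof -
    have "enn2real (glp_int a p u \<epsilon>) \<le> s powr (p - \<epsilon>) * K"
      using int[OF \<epsilon>] K by (intro enn2real_leI) auto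
    then have "enn2real (glp_int a p u \<epsilon>) powr (1 / (p - \<epsilon>)) \<le> (s powr (p - \<epsilon>) * K) powr (1 / (p - \<epsilon>))"
      using \<epsilon> by (intro powr_mono2) auto
    also have "\<dots> = s * K powr (1 / (p - \<epsilon>))"
      using \<epsilon> s K by (simp add: powr_mult powr_powr)
    \<comment> \<open>From \<open>\<epsilon> \<le> p - 1\<close> the exponent
      \<open>1 / (p - \<epsilon>)\<close> is at most 1, and \<open>1 \<le> K\<close>; this removes
      the dependence on \<open>\<epsilon>\<close>.\<close>
    also have "\<dots> \<le> s * K powr 1"
      using \<epsilon> s K by (intro mult_left_mono powr_mono) (auto simp: field_simps)
    finally have "enn2real (glp_int a p u \<epsilon>) powr (1 / (p - \<epsilon>)) \<le> s * K"
      using K by simp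
    moreover have "\<epsilon> powr \<theta> \<le> (p - 1) powr \<theta>"
      using \<epsilon> \<theta> by (intro powr_mono2) auto
    ultimately have "glp_term a p \<theta> u \<epsilon> \<le> (p - 1) powr \<theta> * (s * K)"
      unfolding glp_term_def using s K by (intro mult_mono) auto
    then show ?thesis by (simp add: mult_ac)
  qed
  have "in_GLp a p \<theta> u"
    unfolding in_GLp_def
  proof (intro conjI ballI)
    show "glp_int a p u \<epsilon> < \<infinity>" if "\<epsilon> \<in> {0<..p-1}" for \<epsilon>
      using int[OF that] by (rule le_less_trans) simp
    show "bdd_above (glp_term a p \<theta> u ` {0<..p-1})"
      using tb by (rule bdd_aboveI2)
  qed (rule u)
  moreover have "GLp_norm a p \<theta> u \<le> (p - 1) powr \<theta> * K * s"
    unfolding GLp_norm_def using p tb by (intro cSUP_least) auto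
  ultimately show ?thesis by (simp add: K_def)
qed

text \<open>After division by \<open>x + y\<close> both fractions lie in \<open>[0, 1]\<close>,
  where \<open>z \<le> z powr s\<close>; the fractions sum to 1. It is used with
  \<open>s = 1 / r\<close>, to split a root of a sum.\<close>

lemma powr_add_subadditive:
  assumes "0 \<le> x" "0 \<le> y" "0 < s" "s \<le> (1::real)"
  shows "(x + y) powr s \<le> x powr s + y powr s"
proof (cases "x + y = 0")
  case False
  then have pos: "0 < x + y" using assms by linarith
  have le: "z / (x + y) \<le> (z / (x + y)) powr s" if "0 \<le> z" "z \<le> x + y" for z
  proof (cases "z = 0")
    case False
    then have "(z / (x + y)) powr 1 \<le> (z / (x + y)) powr s"
      using that pos assms by (intro powr_mono') auto
    then show ?thesis using that pos by simp
  qed simp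
  have "1 = x / (x + y) + y / (x + y)"
    using pos by (simp flip: add_divide_distrib)
  also have "\<dots> \<le> (x / (x + y)) powr s + (y / (x + y)) powr s"
    using assms by (intro add_mono le) auto
  also have "\<dots> = (x powr s + y powr s) / (x + y) powr s"
    using assms pos by (simp add: powr_divide add_divide_distrib)
  finally show ?thesis
    using pos by (simp add: le_divide_eq)
qed (use assms in auto)

text \<open>The power \<open>r = p - \<epsilon>\<close> costs \<open>2 powr r\<close>, and the root
  of the same order turns this into exactly 2. The constant is therefore uniform in
  \<open>\<epsilon>\<close> and survives the supremum.\<close>

lemma glp_term_triangle:
  fixes a :: "real^'n \<Rightarrow> real" and u v w :: "real^'n \<Rightarrow> complex"
  assumes a: "weight a" and m: "u \<in> borel_measurable lebesgue" "v \<in> borel_measurable lebesgue"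
    and \<epsilon>: "\<epsilon> \<in> {0<..p-1}" and fin: "glp_int a p u \<epsilon> < \<infinity>" "glp_int a p v \<epsilon> < \<infinity>"
    and le: "AE x in lebesgue. norm (w x) \<le> norm (u x) + norm (v x)"
  shows "glp_int a p w \<epsilon> < \<infinity> \<and> glp_term a p \<theta> w \<epsilon> \<le> 2 * (glp_term a p \<theta> u \<epsilon> + glp_term a p \<theta> v \<epsilon>)"
proof -
  define r where "r = p - \<epsilon>"
  have r: "1 \<le> r" using \<epsilon> by (simp add: r_def)
  have am: "a \<in> borel_measurable lebesgue" using a by (simp add: weight_def)
  have "glp_int a p w \<epsilon> \<le> (\<integral>\<^sup>+x. ennreal (2 powr r) * (ennreal (norm (u x) powr r * a x powr (\<epsilon> / p)) +
      ennreal (norm (v x) powr r * a x powr (\<epsilon> / p))) \<partial>lebesgue)"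
    unfolding glp_int_def r_def[symmetric]
  proof (rule nn_integral_mono_AE, use le in eventually_elim)
    fix x assume "norm (w x) \<le> norm (u x) + norm (v x)"
    then have "norm (w x) powr r \<le> (norm (u x) + norm (v x)) powr r"
      using r by (intro powr_mono2) auto
    also have "\<dots> \<le> 2 powr r * (norm (u x) powr r + norm (v x) powr r)"
      using r by (intro powr_add_le) auto
    finally have "norm (w x) powr r * a x powr (\<epsilon> / p) \<le>
      2 powr r * (norm (u x) powr r + norm (v x) powr r) * a x powr (\<epsilon> / p)"
      by (rule mult_right_mono) simp
    then show "ennreal (norm (w x) powr r * a x powr (\<epsilon> / p)) \<le> ennreal (2 powr r) * (ennreal (norm (u x) powr r * a x powr (\<epsilon> / p)) +
      ennreal (norm (v x) powr r * a x powr (\<epsilon> / p)))"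
      by (simp add: ennreal_mult[symmetric] ennreal_plus[symmetric] ennreal_leI algebra_simps del: ennreal_plus)
  qed
  also have "\<dots> = ennreal (2 powr r) * (glp_int a p u \<epsilon> + glp_int a p v \<epsilon>)"
    unfolding glp_int_def r_def[symmetric] using m am by (simp add: nn_integral_cmult nn_integral_add)
  finally have I: "glp_int a p w \<epsilon> \<le> ennreal (2 powr r) * (glp_int a p u \<epsilon> + glp_int a p v \<epsilon>)" .
  obtain U where U: "glp_int a p u \<epsilon> = ennreal U" "0 \<le> U" using fin(1) by (cases "glp_int a p u \<epsilon>") auto
  obtain V where V: "glp_int a p v \<epsilon> = ennreal V" "0 \<le> V" using fin(2) by (cases "glp_int a p v \<epsilon>") auto
  have I': "glp_int a p w \<epsilon> \<le> ennreal (2 powr r * (U + V))"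
    using I U V by (simp add: ennreal_mult ennreal_plus)
  then have "enn2real (glp_int a p w \<epsilon>) \<le> 2 powr r * (U + V)"
    using U V by (intro enn2real_leI) auto
  then have "enn2real (glp_int a p w \<epsilon>) powr (1 / r) \<le> (2 powr r * (U + V)) powr (1 / r)"
    using r by (intro powr_mono2) auto
  also have "\<dots> = 2 * (U + V) powr (1 / r)"
    using r U V by (simp add: powr_mult powr_powr)
  also have "\<dots> \<le> 2 * (U powr (1 / r) + V powr (1 / r))"
    using r U V by (intro mult_left_mono powr_add_subadditive) auto
  finally have "\<epsilon> powr \<theta> * enn2real (glp_int a p w \<epsilon>) powr (1 / r) \<le> \<epsilon> powr \<theta> * (2 * (U powr (1 / r) + V powr (1 / r)))"
    by (intro mult_left_mono) auto
  then have "glp_term a p \<theta> w \<epsilon> \<le> 2 * (glp_term a p \<theta> u \<epsilon> + glp_term a p \<theta> v \<epsilon>)"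
    using U V by (simp add: glp_term_def r_def algebra_simps)
  moreover have "glp_int a p w \<epsilon> < \<infinity>"
    using I' by (rule le_less_trans) simp
  ultimately show ?thesis by blast
qed

text \<open>An arbitrary dominated \<open>w\<close> lets one statement serve both for differences
  and for inserting an intermediate function.\<close>

lemma GLp_triangle:
  fixes a :: "real^'n \<Rightarrow> real" and u v w :: "real^'n \<Rightarrow> complex"
  assumes a: "weight a" and p: "1 < p" and u: "in_GLp a p \<theta> u" and v: "in_GLp a p \<theta> v"
    and w: "w \<in> borel_measurable lebesgue" "AE x in lebesgue. norm (w x) \<le> norm (u x) + norm (v x)"
  shows "in_GLp a p \<theta> w \<and> GLp_norm a p \<theta> w \<le> 2 * (GLp_norm a p \<theta> u + GLp_norm a p \<theta> v)"
proof -
  have *: "glp_int a p w \<epsilon> < \<infinity> \<and> glp_term a p \<theta> w \<epsilon> \<le> 2 * (GLp_norm a p \<theta> u + GLp_norm a p \<theta> v)"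
    if \<epsilon>: "\<epsilon> \<in> {0<..p-1}" for \<epsilon>
  proof -
    have t: "glp_int a p w \<epsilon> < \<infinity> \<and> glp_term a p \<theta> w \<epsilon> \<le> 2 * (glp_term a p \<theta> u \<epsilon> + glp_term a p \<theta> v \<epsilon>)"
      using u v \<epsilon> w by (intro glp_term_triangle[OF a]) (auto simp: in_GLp_def)
    have "glp_term a p \<theta> u \<epsilon> \<le> GLp_norm a p \<theta> u" "glp_term a p \<theta> v \<epsilon> \<le> GLp_norm a p \<theta> v"
      using u v \<epsilon> unfolding GLp_norm_def by (auto intro!: cSUP_upper simp: in_GLp_def)
    then have "2 * (glp_term a p \<theta> u \<epsilon> + glp_term a p \<theta> v \<epsilon>) \<le> 2 * (GLp_norm a p \<theta> u + GLp_norm a p \<theta> v)"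
      by (intro mult_left_mono add_mono) auto
    with conjunct2[OF t] have "glp_term a p \<theta> w \<epsilon> \<le> 2 * (GLp_norm a p \<theta> u + GLp_norm a p \<theta> v)"
      by (rule order_trans)
    with conjunct1[OF t] show ?thesis ..
  qed
  have "in_GLp a p \<theta> w"
    unfolding in_GLp_def
  proof (intro conjI ballI)
    show "glp_int a p w \<epsilon> < \<infinity>" if "\<epsilon> \<in> {0<..p-1}" for \<epsilon>
      using *[OF that] by blast
    show "bdd_above (glp_term a p \<theta> w ` {0<..p-1})"
      by (rule bdd_aboveI2) (rule conjunct2[OF *])
  qed (rule w)
  moreover have "GLp_norm a p \<theta> w \<le> 2 * (GLp_norm a p \<theta> u + GLp_norm a p \<theta> v)"
    unfolding GLp_norm_def[of a p \<theta> w] using p * by (intro cSUP_least) auto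
  ultimately show ?thesis by blast
qed

lemma GLp_norm_cong_AE:
  assumes "AE x in lebesgue. f x = g x" shows "GLp_norm a p \<theta> f = GLp_norm a p \<theta> g"
proof -
  have "glp_int a p f \<epsilon> = glp_int a p g \<epsilon>" for \<epsilon>
    unfolding glp_int_def using assms by (intro nn_integral_cong_AE) (auto elim!: eventually_mono)
  then show ?thesis by (simp add: GLp_norm_def glp_term_def)
qed

lemma Agl_norm_eq:
  fixes f g :: "real^'n \<Rightarrow> complex"
  assumes "has_fourier f g" "in_GLp b q \<theta>2 g"
  shows "Agl_norm p \<theta>1 q \<theta>2 a b f = GLp_norm a p \<theta>1 f + GLp_norm b q \<theta>2 g"
proof -
  define G where "G = (SOME G. has_fourier f G \<and> in_GLp b q \<theta>2 G)"
  have "has_fourier f G \<and> in_GLp b q \<theta>2 G"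
    unfolding G_def using assms by (intro someI[of "\<lambda>G. has_fourier f G \<and> in_GLp b q \<theta>2 G"] conjI)
  then have "AE x in lborel. G x = g x"
    using assms by (intro has_fourier_unique) auto
  then have "GLp_norm b q \<theta>2 G = GLp_norm b q \<theta>2 g"
    by (intro GLp_norm_cong_AE AE_completion)
  then show ?thesis by (simp add: Agl_norm_def G_def)
qed

section \<open>Comparison of the two closures\<close>

lemma Lp_int_le_powr:
  assumes "Lp_int p f < \<infinity>" "0 < p"
  obtains s where "0 < s" "Lp_int p f \<le> ennreal (s powr p)"
proof -
  obtain N where N: "Lp_int p f = ennreal N" "0 \<le> N"
    using assms by (cases "Lp_int p f") auto
  show ?thesis
  proof (rule that[of "(N + 1) powr (1 / p)"])
    show "Lp_int p f \<le> ennreal (((N + 1) powr (1 / p)) powr p)"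
      using N assms by (simp add: powr_powr)
  qed (use N in simp)
qed

lemma in_Lp_in_GLp:
  assumes "weight a" "integrable lebesgue a" "1 < p" "0 \<le> \<theta>" "in_Lp p u"
  shows "in_GLp a p \<theta> u"
proof -
  have u: "u \<in> borel_measurable lebesgue" "Lp_int p u < \<infinity>" and p: "0 < p"
    using assms by (auto simp: in_Lp_iff)
  obtain s where "0 < s" "Lp_int p u \<le> ennreal (s powr p)"
    using Lp_int_le_powr[OF u(2) p] .
  then show ?thesis
    using GLp_embedding[OF assms(1-4) u(1)] by blast
qed

text \<open>The bookkeeping of the two factors 2: the total is at most
  \<open>2 * N0 + 2 * (x + y)\<close>, and each bracket is below \<open>e / 4\<close>.\<close>

lemma closure_estimate:
  fixes N :: real
  assumes "N = A + B" "A \<le> 2 * (A0 + A1)" "B \<le> 2 * (B0 + B1)" "A1 \<le> x" "B1 \<le> y"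
    "N0 = A0 + B0" "N0 < e / 4" "x + y < e / 4"
  shows "N < e"
proof -
  have "A \<le> 2 * A0 + 2 * A1" "B \<le> 2 * B0 + 2 * B1"
    using assms(2,3) by simp_all
  with assms show ?thesis by linarith
qed

text \<open>An element \<open>h0\<close> of \<open>A^{p,q}\<close> close to \<open>f\<close> in the
  grand norm is replaced by a test function \<open>h\<close> close to \<open>h0\<close> in the
  \<open>L^p\<close> and \<open>L^q\<close> norms; the embedding makes \<open>h0 - h\<close> and its
  transform small in the grand spaces as well.\<close>

lemma Agl_closure_subset:
  fixes p q \<theta>1 \<theta>2 :: real and a b :: "real^'n \<Rightarrow> real"
  assumes p: "1 < p" and q: "1 < q" and \<theta>: "0 < \<theta>1" "0 < \<theta>2"
    and a: "weight a" "integrable lebesgue a" and b: "weight b" "integrable lebesgue b"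
    and f: "f \<in> Agl_closure p \<theta>1 q \<theta>2 a b {f. in_Apq p q f}"
  shows "f \<in> Agl_closure p \<theta>1 q \<theta>2 a b {h. C0_inf h}"
proof -
  have fA: "in_Agl p \<theta>1 q \<theta>2 a b f"
    using f by (simp add: Agl_closure_def)
  then obtain g where g: "has_fourier f g" "in_GLp b q \<theta>2 g" and fG: "in_GLp a p \<theta>1 f"
    by (auto simp: in_Agl_def)
  have gm: "g \<in> borel_measurable lebesgue" and fm: "f \<in> borel_measurable lebesgue"
    using g fG by (auto simp: in_GLp_def)
  have "\<exists>h. C0_inf h \<and> in_Agl p \<theta>1 q \<theta>2 a b h \<and> Agl_norm p \<theta>1 q \<theta>2 a b (f - h) < e" if e: "0 < e" for e
  proof -
    obtain h0 where h0: "in_Apq p q h0" "in_Agl p \<theta>1 q \<theta>2 a b h0" "Agl_norm p \<theta>1 q \<theta>2 a b (f - h0) < e / 4"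
      using f e unfolding Agl_closure_def by (auto elim: allE[of _ "e / 4"])
    obtain g0 where g0: "has_fourier h0 g0" "in_Lp q g0" and h0p: "in_Lp p h0"
      using h0(1) by (auto simp: in_Apq_def)
    define Ka where "Ka = (p - 1) powr \<theta>1 * (1 + integral\<^sup>L lebesgue a)"
    define Kb where "Kb = (q - 1) powr \<theta>2 * (1 + integral\<^sup>L lebesgue b)"
    have "0 \<le> integral\<^sup>L lebesgue a" "0 \<le> integral\<^sup>L lebesgue b"
      using a b by (auto simp: weight_def)
    then have K: "0 \<le> Ka" "0 \<le> Kb" by (auto simp: Ka_def Kb_def)
    \<comment> \<open>Chosen so that \<open>(Ka + Kb + 1) * s = e / 4\<close>; the summand 1 avoids
      division by 0 and makes the bound for \<open>Ka * s + Kb * s\<close> strict.\<close>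
    define s where "s = e / (4 * (Ka + Kb + 1))"
    have s: "0 < s" using e K by (simp add: s_def)
    have Ks: "Ka * s + Kb * s < e / 4"
    proof -
      have "(Ka + Kb + 1) * s = e / 4" using K by (simp add: s_def field_simps)
      then have "Ka * s + Kb * s + s = e / 4" by (simp add: distrib_right)
      with s show ?thesis by linarith
    qed
    define \<eta> where "\<eta> = min (s powr p) (s powr q)"
    have \<eta>: "0 < \<eta>" using s by (simp add: \<eta>_def)
    obtain h where h: "C0_inf h" "Lp_int p (\<lambda>x. h0 x - h x) \<le> ennreal \<eta>" "Lp_int q (\<lambda>x. g0 x - fourier h x) \<le> ennreal \<eta>"
      using test_function_approx[OF g0(1) p q h0p g0(2) \<eta>] by blast
    have hp: "in_Lp p h" "in_Lp q (fourier h)"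
      using C0_inf_in_Lp[OF h(1)] p q by auto
    have m: "h \<in> borel_measurable lebesgue" "fourier h \<in> borel_measurable lebesgue"
        "h0 \<in> borel_measurable lebesgue" "g0 \<in> borel_measurable lebesgue"
      using hp h0p g0 by (auto simp: in_Lp_def)
    have hG: "in_GLp a p \<theta>1 h" "in_GLp b q \<theta>2 (fourier h)" "in_GLp a p \<theta>1 h0" "in_GLp b q \<theta>2 g0"
      using a b p q \<theta> hp h0p g0 by (auto intro!: in_Lp_in_GLp)
    have hA: "in_Agl p \<theta>1 q \<theta>2 a b h"
      using hG C0_inf_has_fourier[OF h(1)] by (auto simp: in_Agl_def)
    have "Lp_int p (\<lambda>x. h0 x - h x) \<le> ennreal (s powr p)" "Lp_int q (\<lambda>x. g0 x - fourier h x) \<le> ennreal (s powr q)"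
      using h(2,3) by (auto elim!: order_trans intro!: ennreal_leI simp: \<eta>_def)
    then have ha: "in_GLp a p \<theta>1 (\<lambda>x. h0 x - h x) \<and> GLp_norm a p \<theta>1 (\<lambda>x. h0 x - h x) \<le> Ka * s"
      and hb: "in_GLp b q \<theta>2 (\<lambda>x. g0 x - fourier h x) \<and> GLp_norm b q \<theta>2 (\<lambda>x. g0 x - fourier h x) \<le> Kb * s"
      using GLp_embedding[OF a p _ _ _ s, of \<theta>1] GLp_embedding[OF b q _ _ _ s, of \<theta>2] \<theta> m
      by (auto simp: Ka_def Kb_def)
    \<comment> \<open>Membership is needed before the norm of \<open>f - h0\<close> can be used: a
      supremum bounds its terms only when they are bounded above, and the chosen transform is
      determined only once an admissible one exists.\<close>
    have f0: "in_GLp a p \<theta>1 (f - h0)"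
      using fm m by (intro conjunct1[OF GLp_triangle[OF a(1) p fG hG(3)]]) (auto intro: norm_triangle_ineq4 simp: fun_diff_def)
    have g0d: "in_GLp b q \<theta>2 (\<lambda>x. g x - g0 x)"
      using gm m by (intro conjunct1[OF GLp_triangle[OF b(1) q g(2) hG(4)]]) (auto intro: norm_triangle_ineq4)
    have eq0: "Agl_norm p \<theta>1 q \<theta>2 a b (f - h0) = GLp_norm a p \<theta>1 (f - h0) + GLp_norm b q \<theta>2 (\<lambda>x. g x - g0 x)"
      using has_fourier_diff[OF g(1) g0(1)] g0d by (rule Agl_norm_eq)
    have A: "in_GLp a p \<theta>1 (f - h) \<and> GLp_norm a p \<theta>1 (f - h) \<le>
        2 * (GLp_norm a p \<theta>1 (f - h0) + GLp_norm a p \<theta>1 (\<lambda>x. h0 x - h x))"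
    proof (rule GLp_triangle[OF a(1) p f0 conjunct1[OF ha]])
      show "f - h \<in> borel_measurable lebesgue" using fm m by (simp add: fun_diff_def)
      show "AE x in lebesgue. norm ((f - h) x) \<le> norm ((f - h0) x) + norm (h0 x - h x)"
      proof (intro always_eventually allI)
        fix x show "norm ((f - h) x) \<le> norm ((f - h0) x) + norm (h0 x - h x)"
          using norm_triangle_ineq[of "f x - h0 x" "h0 x - h x"] by simp
      qed
    qed
    have B: "in_GLp b q \<theta>2 (\<lambda>x. g x - fourier h x) \<and> GLp_norm b q \<theta>2 (\<lambda>x. g x - fourier h x) \<le>
        2 * (GLp_norm b q \<theta>2 (\<lambda>x. g x - g0 x) + GLp_norm b q \<theta>2 (\<lambda>x. g0 x - fourier h x))"
    proof (rule GLp_triangle[OF b(1) q g0d conjunct1[OF hb]])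
      show "(\<lambda>x. g x - fourier h x) \<in> borel_measurable lebesgue" using gm m by simp
      show "AE x in lebesgue. norm (g x - fourier h x) \<le> norm (g x - g0 x) + norm (g0 x - fourier h x)"
      proof (intro always_eventually allI)
        fix x show "norm (g x - fourier h x) \<le> norm (g x - g0 x) + norm (g0 x - fourier h x)"
          using norm_triangle_ineq[of "g x - g0 x" "g0 x - fourier h x"] by simp
      qed
    qed
    have "Agl_norm p \<theta>1 q \<theta>2 a b (f - h) = GLp_norm a p \<theta>1 (f - h) + GLp_norm b q \<theta>2 (\<lambda>x. g x - fourier h x)"
      using has_fourier_diff[OF g(1) C0_inf_has_fourier[OF h(1)]] conjunct1[OF B] by (rule Agl_norm_eq)
    then have "Agl_norm p \<theta>1 q \<theta>2 a b (f - h) < e"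
      by (rule closure_estimate[OF _ conjunct2[OF A] conjunct2[OF B] conjunct2[OF ha] conjunct2[OF hb] eq0 h0(3) Ks])
    with h(1) hA show ?thesis by blast
  qed
  with fA show ?thesis
    by (simp add: Agl_closure_def)
qed

theorem theorem5:
  fixes p q \<theta>1 \<theta>2 :: real and a b :: "real^'n::finite \<Rightarrow> real"
  assumes "1 < p" "1 < q" "0 < \<theta>1" "0 < \<theta>2"
    and "weight a" "weight b"
    and "integrable lebesgue a" "integrable lebesgue b"
  shows "((\<forall>h::real^'n \<Rightarrow> complex. C0_inf h \<longrightarrow> in_Apq p q h) \<and>
          (\<forall>f::real^'n \<Rightarrow> complex. in_Apq p q f \<longrightarrow> (\<forall>e>0. \<exists>h. C0_inf h \<and> Apq_norm p q (f - h) < e)))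
       \<and> Agl_closure p \<theta>1 q \<theta>2 a b {f. in_Apq p q f}
           = Agl_closure p \<theta>1 q \<theta>2 a b {h. C0_inf h}"
proof (intro conjI allI impI)
  show "in_Apq p q h" if "C0_inf h" for h :: "real^'n \<Rightarrow> complex"
    using that assms(1,2) by (rule C0_inf_in_Apq)
  show "\<exists>h. C0_inf h \<and> Apq_norm p q (f - h) < e" if "in_Apq p q f" "0 < e" for f :: "real^'n \<Rightarrow> complex" and e
    using that(1) assms(1,2) that(2) by (rule Apq_density)
  show "Agl_closure p \<theta>1 q \<theta>2 a b {f. in_Apq p q f} = Agl_closure p \<theta>1 q \<theta>2 a b {h. C0_inf h}"
  proof (rule subset_antisym)
    show "Agl_closure p \<theta>1 q \<theta>2 a b {f. in_Apq p q f} \<subseteq> Agl_closure p \<theta>1 q \<theta>2 a b {h. C0_inf h}"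
      using Agl_closure_subset[OF assms(1-5,7,6,8)] by (rule subsetI)
    \<comment> \<open>The same approximants work, because every test function lies in
      \<open>A^{p,q}\<close>.\<close>
    show "Agl_closure p \<theta>1 q \<theta>2 a b {h. C0_inf h} \<subseteq> Agl_closure p \<theta>1 q \<theta>2 a b {f. in_Apq p q f}"
      using C0_inf_in_Apq[OF _ assms(1,2)] unfolding Agl_closure_def by blast
  qed
qed

end
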